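(* Let $n,d,t\ge 1$ and let $u=x_{i_1}x_{i_2}\cdots x_{i_d}$ and $v=x_{j_1}x_{j_2}\cdots x_{j_d}$ (indices written in increasing order) be monomials in $M_{n,d,t}$ with $\min(u)=i_1=1$ and $\min(v)=j_1>1$. Assume that $I=(\mathcal{L}_t(u,v))$ is an incompletely $t$-spread lexsegment ideal of $S=K[x_1,\dots,x_n]$. Then $I$ has a linear resolution if and only if there is an integer $\ell$ with $2\le \ell<n-(d-1)t$ such that $$u<_{\mathrm{slex}}x_1x_{\ell+1+t}x_{\ell+1+2t}\cdots x_{\ell+1+(d-1)t}\quad\text{and}\quad v=x_{\ell}x_{n-(d-2)t}\cdots x_{n-t}x_n .$$
   Context: $K$ is a field and $S=K[x_1,\dots,x_n]$ is the standard graded polynomial ring. A monomial $x_{i_1}\cdots x_{i_d}$ with $i_1\le\dots\le i_d$ is $t$-spread if $i_{j+1}-i_j\ge t$ for all $j=1,\dots,d-1$. $M_{n,d,t}$ is the set of all $t$-spread monomials of degree $d$ in $S$; it is assumed throughout that $n\ge 1+(d-1)t$. For a monomial $w\neq 1$, $\min(w)$ and $\max(w)$ are the smallest and largest index $i$ such that $x_i$ divides $w$. The squarefree lexicographic order on $M_{n,d,t}$ ($t\geq 1$): for $x_{i_1}\cdots x_{i_d}$ and $x_{j_1}\cdots x_{j_d}$ with increasing indices, $x_{i_1}\cdots x_{i_d}>_{\mathrm{slex}}x_{j_1}\cdots x_{j_d}$ if for some $1\le s\le d$ one has $i_1=j_1,\dots,i_{s-1}=j_{s-1}$ and $i_s<j_s$.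 For $u,v\in M_{n,d,t}$ with $u\ge_{\mathrm{slex}}v$, set $\mathcal{L}_t(u,v)=\{w\in M_{n,d,t}:u\ge_{\mathrm{slex}}w\ge_{\mathrm{slex}}v\}$, $\mathcal{L}_t^i(v)=\{w\in M_{n,d,t}: w\ge_{\mathrm{slex}}v\}$, $\mathcal{L}_t^f(u)=\{w\in M_{n,d,t}:w\le_{\mathrm{slex}}u\}$. A $t$-spread lexsegment ideal is an ideal $I=(\mathcal{L}_t(u,v))$ of $S$ generated by such a set $\mathcal{L}_t(u,v)$. It is completely $t$-spread lexsegment if $I=(\mathcal{L}_t^i(v))\cap(\mathcal{L}_t^f(u))$, and incompletely $t$-spread lexsegment otherwise. A graded ideal $I$ generated in degree $d$ has a ($d$-)linear resolution if $\beta_{i,i+j}(I)=0$ for all $i$ and all $j\ne d$, where $\beta_{i,j}(I)=\dim_K\mathrm{Tor}_i^S(I,K)_j$. *)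

theory Defs
  imports
    Complex_Main
    "HOL-Library.Poly_Mapping"
    "HOL-Library.Function_Algebras"
    "HOL-Algebra.Ideal"
begin

section \<open>The standard graded polynomial ring\<close>

text \<open>
  Polynomials in variables indexed by \<open>nat\<close>; a power product is its exponent vector of type
  \<open>nat \<Rightarrow>\<^sub>0 nat\<close>. The ring $K[x_1,\dots,x_n]$ is carved out by its carrier, the variables
  being indexed by \<open>{1..n}\<close>.
\<close>

type_synonym 'k mpoly = "(nat \<Rightarrow>\<^sub>0 nat) \<Rightarrow>\<^sub>0 'k"

definition poly_ring :: "nat \<Rightarrow> 'k::field mpoly ring" where
  "poly_ring n =
    \<lparr>carrier = {p. \<forall>m\<in>Poly_Mapping.keys p. Poly_Mapping.keys m \<subseteq> {1..n}},
     mult = (*), one = 1, zero = 0, add = (+)\<rparr>"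

definition pp_degree :: "(nat \<Rightarrow>\<^sub>0 nat) \<Rightarrow> nat" where
  "pp_degree m = (\<Sum>i\<in>Poly_Mapping.keys m. Poly_Mapping.lookup m i)"

text \<open>Zero is homogeneous of every degree, and is the only element of negative degree.\<close>

definition homogeneous_of_degree :: "int \<Rightarrow> 'k::field mpoly \<Rightarrow> bool" where
  "homogeneous_of_degree e p \<longleftrightarrow> (\<forall>m\<in>Poly_Mapping.keys p. int (pp_degree m) = e)"

definition monomial_ideal :: "nat \<Rightarrow> (nat \<Rightarrow>\<^sub>0 nat) set \<Rightarrow> 'k::field mpoly set" where
  "monomial_ideal n A = Idl\<^bsub>poly_ring n\<^esub> ((\<lambda>m. Poly_Mapping.single m 1) ` A)"


section \<open>Spread monomials and lexsegments\<close>

text \<open>The power product $x_{i_1}\cdots x_{i_d}$ of an index list $[i_1,\dots,i_d]$.\<close>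

definition pp_of_indices :: "nat list \<Rightarrow> (nat \<Rightarrow>\<^sub>0 nat)" where
  "pp_of_indices is = (\<Sum>i\<leftarrow>is. Poly_Mapping.single i 1)"

definition spread_monomials :: "nat \<Rightarrow> nat \<Rightarrow> nat \<Rightarrow> (nat \<Rightarrow>\<^sub>0 nat) set" where
  "spread_monomials n d t =
    {pp_of_indices is | is. length is = d \<and> set is \<subseteq> {1..n} \<and> sorted is \<and>
       (\<forall>j. Suc j < d \<longrightarrow> is ! Suc j - is ! j \<ge> t)}"

definition slex_less :: "(nat \<Rightarrow>\<^sub>0 nat) \<Rightarrow> (nat \<Rightarrow>\<^sub>0 nat) \<Rightarrow> bool" where
  "slex_less v u \<longleftrightarrow>
    (\<exists>is js. u = pp_of_indices is \<and> v = pp_of_indices js \<and>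
       sorted_wrt (<) is \<and> sorted_wrt (<) js \<and> length is = length js \<and>
       (\<exists>s<length is. take s is = take s js \<and> is ! s < js ! s))"

definition slex_le :: "(nat \<Rightarrow>\<^sub>0 nat) \<Rightarrow> (nat \<Rightarrow>\<^sub>0 nat) \<Rightarrow> bool" where
  "slex_le v u \<longleftrightarrow> v = u \<or> slex_less v u"

definition lexsegment ::
  "nat \<Rightarrow> nat \<Rightarrow> nat \<Rightarrow> (nat \<Rightarrow>\<^sub>0 nat) \<Rightarrow> (nat \<Rightarrow>\<^sub>0 nat) \<Rightarrow> (nat \<Rightarrow>\<^sub>0 nat) set" where
  "lexsegment n d t u v = {w \<in> spread_monomials n d t. slex_le w u \<and> slex_le v w}"

definition initial_lexsegment ::
  "nat \<Rightarrow> nat \<Rightarrow> nat \<Rightarrow> (nat \<Rightarrow>\<^sub>0 nat) \<Rightarrow> (nat \<Rightarrow>\<^sub>0 nat) set" where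
  "initial_lexsegment n d t v = {w \<in> spread_monomials n d t. slex_le v w}"

definition final_lexsegment ::
  "nat \<Rightarrow> nat \<Rightarrow> nat \<Rightarrow> (nat \<Rightarrow>\<^sub>0 nat) \<Rightarrow> (nat \<Rightarrow>\<^sub>0 nat) set" where
  "final_lexsegment n d t u = {w \<in> spread_monomials n d t. slex_le w u}"

text \<open>
  The monomials \<open>u\<close>, \<open>v\<close> below are determined by the ideal when \<open>t \<ge> 1\<close>: its monomials of
  degree \<open>d\<close> form the segment, of which \<open>u\<close> is the largest and \<open>v\<close> the smallest.
\<close>

definition lexsegment_ideal :: "nat \<Rightarrow> nat \<Rightarrow> nat \<Rightarrow> 'k::field mpoly set \<Rightarrow> bool" where
  "lexsegment_ideal n d t I \<longleftrightarrow>
    (\<exists>u\<in>spread_monomials n d t. \<exists>v\<in>spread_monomials n d t. slex_le v u \<and>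
       I = monomial_ideal n (lexsegment n d t u v))"

definition completely_lexsegment_ideal :: "nat \<Rightarrow> nat \<Rightarrow> nat \<Rightarrow> 'k::field mpoly set \<Rightarrow> bool" where
  "completely_lexsegment_ideal n d t I \<longleftrightarrow>
    (\<exists>u\<in>spread_monomials n d t. \<exists>v\<in>spread_monomials n d t. slex_le v u \<and>
       I = monomial_ideal n (lexsegment n d t u v) \<and>
       I = monomial_ideal n (initial_lexsegment n d t v) \<inter>
           monomial_ideal n (final_lexsegment n d t u))"

definition incompletely_lexsegment_ideal :: "nat \<Rightarrow> nat \<Rightarrow> nat \<Rightarrow> 'k::field mpoly set \<Rightarrow> bool" where
  "incompletely_lexsegment_ideal n d t I \<longleftrightarrow>
    lexsegment_ideal n d t I \<and> \<not> completely_lexsegment_ideal n d t I"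


section \<open>Graded free resolutions, Tor and Betti numbers\<close>

text \<open>
  Data of a complex $\cdots \to F_1 \to F_0 \to S$ of graded free $S$-modules of finite rank:
  $F_i = \bigoplus_{k < \mathit{rnk}\,i} S(-\mathit{dgr}\,i\,k)$, the map $F_0 \to S$ sends the
  \<open>k\<close>-th basis element to \<open>aug k\<close>, and \<open>dif i l k\<close> is the entry in row \<open>l\<close> and column \<open>k\<close> of the
  matrix of $F_{i+1} \to F_i$.
\<close>

record (overloaded) 'k free_complex =
  rnk :: "nat \<Rightarrow> nat"
  dgr :: "nat \<Rightarrow> nat \<Rightarrow> int"
  aug :: "nat \<Rightarrow> 'k mpoly"
  dif :: "nat \<Rightarrow> nat \<Rightarrow> nat \<Rightarrow> 'k mpoly"

text \<open>The free module \<open>S\<^sup>r\<close>; vectors are padded with zeros outside \<open>{..<r}\<close>.\<close>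

definition free_module :: "nat \<Rightarrow> nat \<Rightarrow> (nat \<Rightarrow> 'k::field mpoly) set" where
  "free_module n r = {x. (\<forall>k<r. x k \<in> carrier (poly_ring n)) \<and> (\<forall>k\<ge>r. x k = 0)}"

definition mat_apply ::
  "nat \<Rightarrow> nat \<Rightarrow> (nat \<Rightarrow> nat \<Rightarrow> 'a::comm_ring_1) \<Rightarrow> (nat \<Rightarrow> 'a) \<Rightarrow> (nat \<Rightarrow> 'a)" where
  "mat_apply r s A x = (\<lambda>l. if l < s then \<Sum>k<r. A l k * x k else 0)"

abbreviation aug_map :: "'k::field free_complex \<Rightarrow> (nat \<Rightarrow> 'k mpoly) \<Rightarrow> 'k mpoly" where
  "aug_map F x \<equiv> \<Sum>k<rnk F 0. aug F k * x k"

abbreviation dif_map ::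
  "'k::field free_complex \<Rightarrow> nat \<Rightarrow> (nat \<Rightarrow> 'k mpoly) \<Rightarrow> (nat \<Rightarrow> 'k mpoly)" where
  "dif_map F i \<equiv> mat_apply (rnk F (Suc i)) (rnk F i) (dif F i)"

text \<open>Exactness of $\cdots \to F_1 \to F_0 \to I \to 0$ with all maps homogeneous of degree 0.\<close>

definition graded_free_resolution :: "nat \<Rightarrow> 'k::field mpoly set \<Rightarrow> 'k free_complex \<Rightarrow> bool" where
  "graded_free_resolution n I F \<longleftrightarrow>
    (\<forall>k<rnk F 0. aug F k \<in> carrier (poly_ring n) \<and>
       homogeneous_of_degree (dgr F 0 k) (aug F k)) \<and>
    (\<forall>i. \<forall>l<rnk F i. \<forall>k<rnk F (Suc i). dif F i l k \<in> carrier (poly_ring n) \<and>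
       homogeneous_of_degree (dgr F (Suc i) k - dgr F i l) (dif F i l k)) \<and>
    aug_map F ` free_module n (rnk F 0) = I \<and>
    {x \<in> free_module n (rnk F 0). aug_map F x = 0} = dif_map F 0 ` free_module n (rnk F 1) \<and>
    (\<forall>i. {x \<in> free_module n (rnk F (Suc i)). dif_map F i x = 0} =
       dif_map F (Suc i) ` free_module n (rnk F (Suc (Suc i))))"

text \<open>
  Since $S(-a) \otimes_S K = K(-a)$, the degree \<open>j\<close> part of $F_i \otimes_S K$ is spanned by the basis
  elements of $F_i$ of degree \<open>j\<close>, and the maps of $F \otimes_S K$ are given by the matrices of \<open>F\<close>
  reduced modulo $(x_1,\dots,x_n)$, that is, by the constant coefficients of their entries.
  As usual, $F$ is truncated at $F_0$ (without the augmentation) before tensoring.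
\<close>

definition tensor_strand :: "'k::field free_complex \<Rightarrow> nat \<Rightarrow> int \<Rightarrow> (nat \<Rightarrow> 'k) set" where
  "tensor_strand F i j = {x. \<forall>k. x k \<noteq> 0 \<longrightarrow> k < rnk F i \<and> dgr F i k = j}"

abbreviation tensor_dif ::
  "'k::field free_complex \<Rightarrow> nat \<Rightarrow> (nat \<Rightarrow> 'k) \<Rightarrow> (nat \<Rightarrow> 'k)" where
  "tensor_dif F i \<equiv>
    mat_apply (rnk F (Suc i)) (rnk F i) (\<lambda>l k. Poly_Mapping.lookup (dif F i l k) 0)"

definition tensor_cycles :: "'k::field free_complex \<Rightarrow> nat \<Rightarrow> int \<Rightarrow> (nat \<Rightarrow> 'k) set" where
  "tensor_cycles F i j =
    {x \<in> tensor_strand F i j. case i of 0 \<Rightarrow> True | Suc i' \<Rightarrow> tensor_dif F i' x = 0}"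

definition tensor_boundaries :: "'k::field free_complex \<Rightarrow> nat \<Rightarrow> int \<Rightarrow> (nat \<Rightarrow> 'k) set" where
  "tensor_boundaries F i j = tensor_dif F i ` tensor_strand F (Suc i) j"

definition K_dim :: "(nat \<Rightarrow> 'k::field) set \<Rightarrow> nat" where
  "K_dim = vector_space.dim (\<lambda>c x k. c * x k)"

lemma vector_space_K: "vector_space (\<lambda>(c::'k::field) (x::nat \<Rightarrow> 'k) k. c * x k)"
  by unfold_locales (auto simp: fun_eq_iff algebra_simps)

text \<open>
  $\dim_K H_i(F \otimes_S K)_j$. When \<open>F\<close> is a graded free resolution, the boundaries form a subspace
  of the finite-dimensional space of cycles, so the subtraction is the dimension of the quotient.
\<close>

definition tensor_homology_dim :: "'k::field free_complex \<Rightarrow> nat \<Rightarrow> int \<Rightarrow> nat" where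
  "tensor_homology_dim F i j = K_dim (tensor_cycles F i j) - K_dim (tensor_boundaries F i j)"

text \<open>
  $\beta_{i,j}(I) = \dim_K \mathrm{Tor}_i^S(I,K)_j$, computed from a chosen graded free resolution of
  the graded ideal \<open>I\<close>. One exists because $S$ is Noetherian, and the value does not depend on the
  choice.
\<close>

definition graded_betti :: "nat \<Rightarrow> 'k::field mpoly set \<Rightarrow> nat \<Rightarrow> int \<Rightarrow> nat" where
  "graded_betti n I i j = tensor_homology_dim (SOME F. graded_free_resolution n I F) i j"

text \<open>For a graded ideal \<open>I\<close> generated in degree \<open>d\<close>.\<close>

definition has_linear_resolution :: "nat \<Rightarrow> nat \<Rightarrow> 'k::field mpoly set \<Rightarrow> bool" where
  "has_linear_resolution n d I \<longleftrightarrow> (\<forall>i j. j \<noteq> int d \<longrightarrow> graded_betti n I i (int i + j) = 0)"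

end

theory Submission
  imports Defs "HOL-Library.List_Lexorder"
begin

text \<open>
  The proof has a homological and a combinatorial half, which meet in two criteria.

  A monomial ideal generated in degree \<open>d\<close> has a linear resolution if its generators can be ordered
  such that the ideal of the earlier generators, divided by the next one, is always generated by
  variables (\<open>linear_quotients\<close>): adding a generator amounts to a mapping cone (\<open>mapping_cone\<close>),
  and ideals of variables have linear resolutions for the same reason. Conversely, if there is a
  linear resolution, then the syzygies are generated by the linear ones, and any two generators
  that divide a monomial \<open>\<alpha>\<close> are joined by a path of generators dividing \<open>\<alpha>\<close>, in which
  neighbours have a least common multiple of degree at most $d + 1$
  (\<open>linear_resolution_connected\<close>). Since Betti numbers are computed from some chosen resolution,
  both criteria rest on the vanishing of Tor not depending on this choice
  (\<open>tor_vanishes_transfer\<close>), and on resolutions of the given ideal existing at all, which mapping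
  cones provide as well.

  Let $u = x_1 u'$ and $v = x_l v'$. If the segment is incomplete, there is a spread monomial
  $b < v$ such that $b$ with its first variable removed exceeds $u'$ (\<open>incomplete_witness\<close>). On a
  path from a generator divisible by $x_1$ to one that is not, some step has to trade $x_1$ for
  $x_l$ (\<open>crossing\<close>), and the other factor lies between $v'$ and $u'$. The path from $u$ to $v$ then
  shows $v' \<le> u'$, so that $b$ starts after $x_l$, which yields the bound on $u$. Let \<open>z\<close> be the
  smallest spread monomial of degree $d - 1$. The path from $x_1 z$ to the monomial obtained from
  $x_l z$ by putting $x_{l+t}$ in the place of the first variable of \<open>z\<close> leaves no other choice
  for that factor than \<open>z\<close>, hence $v' = z$.

  If conversely \<open>u\<close> and \<open>v\<close> have this form, then the segment consists of all spread monomials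
  starting with one of $x_2, \<dots>, x_l$ and of some monomials $x_1 c$ where the indices in \<open>c\<close> exceed
  $l + t$. In such a product $x_1$ may be replaced by each of $x_2, \<dots>, x_l$, and linear quotients
  result (\<open>segment_sufficient\<close>).
\<close>

section \<open>Monomials, homogeneous components and monomial ideals\<close>

abbreviation lookup :: "('a \<Rightarrow>\<^sub>0 'b::zero) \<Rightarrow> 'a \<Rightarrow> 'b" where
  "lookup \<equiv> Poly_Mapping.lookup"

abbreviation keys :: "('a \<Rightarrow>\<^sub>0 'b::zero) \<Rightarrow> 'a set" where
  "keys \<equiv> Poly_Mapping.keys"

abbreviation polys :: "nat \<Rightarrow> 'k::field mpoly set" where
  "polys n \<equiv> carrier (poly_ring n)"

definition pp_dvd :: "(nat \<Rightarrow>\<^sub>0 nat) \<Rightarrow> (nat \<Rightarrow>\<^sub>0 nat) \<Rightarrow> bool" where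
  "pp_dvd a m \<longleftrightarrow> (\<exists>c. m = a + c)"

lemma pp_dvd_iff: "pp_dvd a m \<longleftrightarrow> (\<forall>i. lookup a i \<le> lookup m i)"
proof
  assume "\<forall>i. lookup a i \<le> lookup m i"
  hence "m = a + (m - a)"
    by (intro poly_mapping_eqI) (simp add: lookup_add lookup_minus)
  thus "pp_dvd a m" unfolding pp_dvd_def by blast
qed (auto simp: pp_dvd_def lookup_add)

lemma pp_dvd_diff: "pp_dvd a m \<Longrightarrow> a + (m - a) = m"
  by (intro poly_mapping_eqI) (auto simp: pp_dvd_iff lookup_add lookup_minus)

lemma pp_dvd_refl [simp]: "pp_dvd a a"
  by (simp add: pp_dvd_iff)

lemma pp_dvd_trans: "pp_dvd a b \<Longrightarrow> pp_dvd b c \<Longrightarrow> pp_dvd a c"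
  unfolding pp_dvd_iff by (meson order_trans)

lemma pp_dvd_add: "pp_dvd a b \<Longrightarrow> pp_dvd a (b + c)" "pp_dvd a b \<Longrightarrow> pp_dvd a (c + b)"
  by (auto simp: pp_dvd_iff lookup_add trans_le_add1 trans_le_add2)

lemma pp_dvd_keys: "pp_dvd a m \<Longrightarrow> keys a \<subseteq> keys m"
  unfolding pp_dvd_iff by (metis in_keys_iff le_zero_eq subsetI)

text \<open>
  Subtraction of exponents is truncated, so $a - m$ stands for $a / \gcd(a, m)$: these quotients
  generate the colon ideal of a monomial ideal by \<open>m\<close>.
\<close>

lemma pp_dvd_minus_iff: "pp_dvd (a - m) s \<longleftrightarrow> pp_dvd a (m + s)"
  by (auto simp: pp_dvd_iff lookup_add lookup_minus) (metis add.commute le_diff_conv)+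

lemma keys_pp_minus: "keys (a - m :: nat \<Rightarrow>\<^sub>0 nat) \<subseteq> keys a"
  by (auto simp: in_keys_iff lookup_minus)

lemma pp_keys_add: "keys (a + b :: nat \<Rightarrow>\<^sub>0 nat) = keys a \<union> keys b"
  by (auto simp: in_keys_iff lookup_add)

lemma pp_degree_superset:
  "finite A \<Longrightarrow> keys m \<subseteq> A \<Longrightarrow> pp_degree m = (\<Sum>i\<in>A. lookup m i)"
  unfolding pp_degree_def by (rule sum.mono_neutral_left) (auto simp: in_keys_iff)

lemma pp_degree_add: "pp_degree (a + b) = pp_degree a + pp_degree b"
proof -
  let ?A = "keys a \<union> keys b"
  have "pp_degree (a + b) = (\<Sum>i\<in>?A. lookup (a + b) i)"
    by (intro pp_degree_superset) (auto simp: pp_keys_add)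
  also have "\<dots> = (\<Sum>i\<in>?A. lookup a i) + (\<Sum>i\<in>?A. lookup b i)"
    by (simp add: lookup_add sum.distrib)
  also have "\<dots> = pp_degree a + pp_degree b"
    by (simp add: pp_degree_superset[of ?A a] pp_degree_superset[of ?A b])
  finally show ?thesis .
qed

lemma pp_degree_eq_0_iff: "pp_degree m = 0 \<longleftrightarrow> m = 0"
  by (auto simp: pp_degree_def in_keys_iff intro: poly_mapping_eqI)

lemma pp_degree_0 [simp]: "pp_degree 0 = 0"
  by (simp add: pp_degree_def)

lemma pp_degree_single [simp]: "pp_degree (Poly_Mapping.single i c) = c"
  by (cases "c = 0") (simp_all add: pp_degree_def)

lemma pp_dvd_degree_le: "pp_dvd a m \<Longrightarrow> pp_degree a \<le> pp_degree m"
  by (auto simp: pp_dvd_def pp_degree_add)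

lemma pp_degree_minus: "pp_dvd a m \<Longrightarrow> pp_degree (m - a) = pp_degree m - pp_degree a"
  by (metis add_diff_cancel_left' pp_degree_add pp_dvd_diff)

subsection \<open>Coefficients of products\<close>

lemma poly_expand: "p = (\<Sum>m\<in>keys p. Poly_Mapping.single m (lookup p m))"
  by (intro poly_mapping_eqI)
     (auto simp: lookup_sum lookup_single when_def in_keys_iff sum.delta)

lemma lookup_single_times:
  fixes p :: "'k::field mpoly"
  shows "lookup (Poly_Mapping.single a c * p) m = (if pp_dvd a m then c * lookup p (m - a) else 0)"
proof -
  have eq: "lookup (Poly_Mapping.single a c * Poly_Mapping.single b e) m =
      (if pp_dvd a m then c * lookup (Poly_Mapping.single b e) (m - a) else 0)" for b and e :: 'k
  proof (cases "pp_dvd a m")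
    case True
    thus ?thesis
      using pp_dvd_diff[OF True] by (auto simp: mult_single lookup_single when_def)
  qed (auto simp: mult_single lookup_single when_def pp_dvd_def)
  have "Poly_Mapping.single a c * p =
      (\<Sum>b\<in>keys p. Poly_Mapping.single a c * Poly_Mapping.single b (lookup p b))"
    by (subst poly_expand[of p]) (simp add: sum_distrib_left)
  hence "lookup (Poly_Mapping.single a c * p) m =
      (\<Sum>b\<in>keys p. if pp_dvd a m then c * lookup (Poly_Mapping.single b (lookup p b)) (m - a) else 0)"
    by (simp add: lookup_sum eq)
  also have "\<dots> = (if pp_dvd a m then c * lookup p (m - a) else 0)"
    by (subst (2) poly_expand[of p]) (simp add: lookup_sum sum_distrib_left)
  finally show ?thesis .
qed

lemma lookup_times:
  fixes p q :: "'k::field mpoly"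
  shows "lookup (q * p) m =
    (\<Sum>a\<in>keys q. if pp_dvd a m then lookup q a * lookup p (m - a) else 0)"
proof -
  have "q * p = (\<Sum>a\<in>keys q. Poly_Mapping.single a (lookup q a) * p)"
    by (subst poly_expand[of q]) (simp add: sum_distrib_right)
  thus ?thesis by (simp add: lookup_sum lookup_single_times)
qed

text \<open>
  The power product 1 has no divisor except itself, hence taking the constant coefficient is a ring
  homomorphism. It is the reduction modulo the variables, which turns a resolution into the complex
  that computes Tor.
\<close>

lemma lookup_times_0:
  fixes p q :: "'k::field mpoly"
  shows "lookup (q * p) 0 = lookup q 0 * lookup p 0"
proof -
  have "pp_dvd a 0 \<longleftrightarrow> a = 0" for a
    by (auto simp: pp_dvd_iff intro: poly_mapping_eqI)
  hence "lookup (q * p) 0 =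
      (\<Sum>a\<in>keys q. if a = 0 then lookup q a * lookup p (0 - a) else 0)"
    by (simp add: lookup_times cong: if_cong)
  also have "\<dots> = (\<Sum>a\<in>keys q. if a = 0 then lookup q 0 * lookup p 0 else 0)"
    by (intro sum.cong) auto
  also have "\<dots> = lookup q 0 * lookup p 0"
    by (simp add: sum.delta in_keys_iff)
  finally show ?thesis .
qed

lemma keys_times_dest:
  fixes p q :: "'k::field mpoly"
  assumes "m \<in> keys (p * q)"
  obtains a b where "a \<in> keys p" "b \<in> keys q" "m = a + b"
  using assms keys_mult[of p q] by blast

subsection \<open>The carrier\<close>

lemma polys_iff: "p \<in> polys n \<longleftrightarrow> (\<forall>m\<in>keys p. keys m \<subseteq> {1..n})"
  by (simp add: poly_ring_def)

lemma polys_0 [simp, intro]: "0 \<in> polys n"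
  and polys_1 [simp, intro]: "1 \<in> polys n"
  by (auto simp: polys_iff)

lemma polys_plus [intro]: "p \<in> polys n \<Longrightarrow> q \<in> polys n \<Longrightarrow> p + q \<in> polys n"
  using keys_add[of p q] by (auto simp: polys_iff)

lemma polys_uminus [intro]: "p \<in> polys n \<Longrightarrow> - p \<in> polys n"
  by (simp add: polys_iff in_keys_iff)

lemma polys_minus [intro]: "p \<in> polys n \<Longrightarrow> q \<in> polys n \<Longrightarrow> p - q \<in> polys n"
  using polys_plus[of p n "- q"] by auto

lemma polys_times [intro]: "p \<in> polys n \<Longrightarrow> q \<in> polys n \<Longrightarrow> p * q \<in> polys n"
  by (auto simp: polys_iff pp_keys_add elim!: keys_times_dest) (meson atLeastAtMost_iff subsetD)+

lemma polys_sum [intro]: "(\<And>i. i \<in> X \<Longrightarrow> f i \<in> polys n) \<Longrightarrow> sum f X \<in> polys n"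
  by (induction X rule: infinite_finite_induct) auto

lemma polys_single [intro]: "keys m \<subseteq> {1..n} \<Longrightarrow> Poly_Mapping.single m c \<in> polys n"
  by (auto simp: polys_iff split: if_splits)

subsection \<open>Homogeneous components\<close>

definition hom_part :: "int \<Rightarrow> 'k::field mpoly \<Rightarrow> 'k mpoly" where
  "hom_part e p =
    (\<Sum>m\<in>{m\<in>keys p. int (pp_degree m) = e}. Poly_Mapping.single m (lookup p m))"

lemma lookup_hom_part:
  "lookup (hom_part e p) m = (if int (pp_degree m) = e then lookup p m else 0)"
  by (auto simp: hom_part_def lookup_sum lookup_single when_def in_keys_iff sum.delta)

lemma homogeneous_iff:
  "homogeneous_of_degree e p \<longleftrightarrow> (\<forall>m. lookup p m \<noteq> 0 \<longrightarrow> int (pp_degree m) = e)"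
  by (auto simp: homogeneous_of_degree_def in_keys_iff)

lemma homogeneous_hom_part [simp, intro]: "homogeneous_of_degree e (hom_part e p)"
  by (simp add: homogeneous_iff lookup_hom_part)

lemma hom_part_eq_self: "homogeneous_of_degree e p \<Longrightarrow> hom_part e p = p"
  by (intro poly_mapping_eqI) (auto simp: homogeneous_iff lookup_hom_part)

lemma hom_part_sum: "hom_part e (sum f X) = (\<Sum>x\<in>X. hom_part e (f x))"
  by (intro poly_mapping_eqI) (simp add: lookup_hom_part lookup_sum)

lemma polys_hom_part [intro]: "p \<in> polys n \<Longrightarrow> hom_part e p \<in> polys n"
  by (auto simp: polys_iff in_keys_iff lookup_hom_part split: if_splits)

lemma hom_part_times:
  fixes p q :: "'k::field mpoly"
  assumes "homogeneous_of_degree a q"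
  shows "hom_part (a + e) (q * p) = q * hom_part e p"
proof (rule poly_mapping_eqI)
  fix m
  have *: "lookup q b = 0 \<or> int (pp_degree m) = a + int (pp_degree (m - b))" if "pp_dvd b m" for b
  proof -
    have "pp_degree m = pp_degree b + pp_degree (m - b)"
      using that by (metis pp_degree_add pp_dvd_diff)
    thus ?thesis using assms by (auto simp: homogeneous_iff)
  qed
  have "(if pp_dvd b m then lookup q b * lookup (hom_part e p) (m - b) else 0) =
    (if int (pp_degree m) = a + e then if pp_dvd b m then lookup q b * lookup p (m - b) else 0 else 0)" for b
    using *[of b] by (auto simp: lookup_hom_part)
  thus "lookup (hom_part (a + e) (q * p)) m = lookup (q * hom_part e p) m"
    by (simp add: lookup_hom_part[of "a + e"] lookup_times)
qed

lemma homogeneous_0 [simp, intro]: "homogeneous_of_degree e 0"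
  by (simp add: homogeneous_iff)

lemma homogeneous_1 [simp, intro]: "homogeneous_of_degree 0 (1 :: 'k::field mpoly)"
  by (simp add: homogeneous_iff lookup_one when_def)

lemma homogeneous_uminus [intro]: "homogeneous_of_degree e p \<Longrightarrow> homogeneous_of_degree e (- p)"
  by (simp add: homogeneous_iff)

lemma homogeneous_minus [intro]:
  "homogeneous_of_degree e p \<Longrightarrow> homogeneous_of_degree e q \<Longrightarrow> homogeneous_of_degree e (p - q)"
  by (auto simp: homogeneous_iff lookup_minus) (metis diff_zero)+

lemma homogeneous_sum [intro]:
  "(\<And>i. i \<in> X \<Longrightarrow> homogeneous_of_degree e (f i)) \<Longrightarrow> homogeneous_of_degree e (sum f X)"
  unfolding homogeneous_iff lookup_sum by (metis (no_types, lifting) sum.neutral)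

lemma homogeneous_times:
  fixes p q :: "'k::field mpoly"
  assumes "homogeneous_of_degree a p" "homogeneous_of_degree b q" "c = a + b"
  shows "homogeneous_of_degree c (p * q)"
  using assms by (auto simp: homogeneous_of_degree_def pp_degree_add elim!: keys_times_dest)

lemma homogeneous_single:
  "int (pp_degree m) = e \<Longrightarrow> homogeneous_of_degree e (Poly_Mapping.single m c)"
  by (auto simp: homogeneous_iff lookup_single when_def)

subsection \<open>Monomial ideals\<close>

lemma poly_ring_ops [simp]:
  "p \<otimes>\<^bsub>poly_ring n\<^esub> q = p * q" "p \<oplus>\<^bsub>poly_ring n\<^esub> q = p + q"
  "\<one>\<^bsub>poly_ring n\<^esub> = 1" "\<zero>\<^bsub>poly_ring n\<^esub> = 0"
  by (simp_all add: poly_ring_def)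

lemma ring_poly_ring: "ring (poly_ring n :: 'k::field mpoly ring)"
proof (rule ringI)
  show "abelian_group (poly_ring n :: 'k mpoly ring)"
  proof (rule abelian_groupI)
    fix x :: "'k mpoly" assume "x \<in> polys n"
    thus "\<exists>y\<in>polys n. y \<oplus>\<^bsub>poly_ring n\<^esub> x = \<zero>\<^bsub>poly_ring n\<^esub>"
      by (intro bexI[of _ "- x"]) (simp_all add: polys_uminus)
  qed (simp_all add: polys_plus add.assoc add.commute)
  show "monoid (poly_ring n :: 'k mpoly ring)"
    by (rule monoidI) (simp_all add: polys_times mult.assoc)
qed (simp_all add: distrib_left distrib_right)

definition monomial_span :: "nat \<Rightarrow> (nat \<Rightarrow>\<^sub>0 nat) set \<Rightarrow> 'k::field mpoly set" where
  "monomial_span n A = {p \<in> polys n. \<forall>m\<in>keys p. \<exists>a\<in>A. pp_dvd a m}"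

lemma monomial_span_ideal: "ideal (monomial_span n A) (poly_ring n :: 'k::field mpoly ring)"
proof (rule idealI)
  show "ring (poly_ring n :: 'k mpoly ring)" by (rule ring_poly_ring)
  show "subgroup (monomial_span n A) (add_monoid (poly_ring n :: 'k mpoly ring))"
  proof (rule group.subgroupI)
    show "Group.group (add_monoid (poly_ring n :: 'k mpoly ring))"
      using ring_poly_ring abelian_group.a_group ring.is_abelian_group by blast
    have inv: "inv\<^bsub>add_monoid (poly_ring n)\<^esub> p = - p" if "p \<in> polys n" for p :: "'k mpoly"
    proof -
      interpret abelian_group "poly_ring n :: 'k mpoly ring"
        using ring_poly_ring by (rule ring.is_abelian_group)
      have "\<ominus>\<^bsub>poly_ring n\<^esub> p = - p"
        by (rule minus_equality) (use that in \<open>simp_all add: polys_uminus\<close>)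
      thus ?thesis by (simp add: a_inv_def)
    qed
    show "inv\<^bsub>add_monoid (poly_ring n)\<^esub> p \<in> monomial_span n A"
      if "p \<in> monomial_span n A" for p :: "'k mpoly"
      using that inv[of p] by (simp add: monomial_span_def polys_uminus del: partial_object.simps)
    show "p \<otimes>\<^bsub>add_monoid (poly_ring n)\<^esub> q \<in> monomial_span n A"
      if "p \<in> monomial_span n A" "q \<in> monomial_span n A" for p q :: "'k mpoly"
      using that keys_add[of p q] polys_plus[of p n q]
      by (auto simp: monomial_span_def)
  qed (auto simp: monomial_span_def)
  fix a x :: "'k mpoly" assume a: "a \<in> monomial_span n A" "x \<in> polys n"
  have "x * a \<in> monomial_span n A"
    using a by (auto simp: monomial_span_def polys_times elim!: keys_times_dest) (meson pp_dvd_add)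
  thus "x \<otimes>\<^bsub>poly_ring n\<^esub> a \<in> monomial_span n A" "a \<otimes>\<^bsub>poly_ring n\<^esub> x \<in> monomial_span n A"
    by (simp_all add: mult.commute)
qed

text \<open>
  Membership is decided one monomial at a time; this is the only description of these ideals used
  below.
\<close>

lemma monomial_ideal_eq_span:
  assumes A: "\<And>a. a \<in> A \<Longrightarrow> keys a \<subseteq> {1..n}"
  shows "monomial_ideal n A = (monomial_span n A :: 'k::field mpoly set)"
proof
  have "Poly_Mapping.single a 1 \<in> (monomial_span n A :: 'k mpoly set)" if "a \<in> A" for a
    using polys_single[OF A[OF that], of "1::'k"] that by (auto simp: monomial_span_def intro: pp_dvd_refl)
  hence "(\<lambda>m. Poly_Mapping.single m 1) ` A \<subseteq> (monomial_span n A :: 'k mpoly set)"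
    by auto
  thus "monomial_ideal n A \<subseteq> (monomial_span n A :: 'k mpoly set)"
    unfolding monomial_ideal_def
    by (intro ring.genideal_minimal[OF ring_poly_ring] monomial_span_ideal)
  show "monomial_span n A \<subseteq> (monomial_ideal n A :: 'k mpoly set)"
  proof
    fix p :: "'k mpoly" assume p: "p \<in> monomial_span n A"
    have gen: "(\<lambda>m. Poly_Mapping.single m 1) ` A \<subseteq> (polys n :: 'k mpoly set)"
      using A by (meson image_subsetI polys_single)
    interpret I: ideal "monomial_ideal n A :: 'k mpoly set" "poly_ring n"
      unfolding monomial_ideal_def by (rule ring.genideal_ideal[OF ring_poly_ring gen])
    have "Poly_Mapping.single m (lookup p m) \<in> monomial_ideal n A" if m: "m \<in> keys p" for m
    proof -
      obtain a where a: "a \<in> A" "pp_dvd a m" using p m by (auto simp: monomial_span_def)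
      have "Poly_Mapping.single a (1::'k) \<in> monomial_ideal n A"
        using ring.genideal_self[OF ring_poly_ring gen] a by (auto simp: monomial_ideal_def)
      moreover have "Poly_Mapping.single (m - a) (lookup p m) \<in> polys n"
        using p m keys_pp_minus[of m a] by (intro polys_single) (auto simp: monomial_span_def polys_iff)
      ultimately have "Poly_Mapping.single a 1 * Poly_Mapping.single (m - a) (lookup p m) \<in> monomial_ideal n A"
        using I.I_r_closed by fastforce
      thus ?thesis using a by (simp add: mult_single pp_dvd_diff)
    qed
    moreover have "sum f X \<in> monomial_ideal n A" if "\<And>x. x \<in> X \<Longrightarrow> f x \<in> monomial_ideal n A"
      for X and f :: "(nat \<Rightarrow>\<^sub>0 nat) \<Rightarrow> 'k mpoly"
      using that additive_subgroup.a_closed[OF I.additive_subgroup_axioms]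
        additive_subgroup.zero_closed[OF I.additive_subgroup_axioms]
      by (induction X rule: infinite_finite_induct) auto
    ultimately show "p \<in> monomial_ideal n A"
      by (subst poly_expand) auto
  qed
qed

lemma monomial_span_mono:
  assumes "\<And>a. a \<in> A \<Longrightarrow> \<exists>b\<in>B. pp_dvd b a"
  shows "monomial_span n A \<subseteq> monomial_span n B"
  using assms pp_dvd_trans unfolding monomial_span_def by blast

lemma monomial_span_times:
  assumes "p \<in> monomial_span n A" "q \<in> polys n"
  shows "p * q \<in> monomial_span n A"
  using assms by (auto simp: monomial_span_def elim!: keys_times_dest) (meson pp_dvd_add)

lemma monomial_span_plus:
  "p \<in> monomial_span n A \<Longrightarrow> q \<in> monomial_span n A \<Longrightarrow> p + q \<in> monomial_span n A"
  using keys_add[of p q] by (auto simp: monomial_span_def)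

lemma monomial_span_0 [simp]: "0 \<in> monomial_span n A"
  by (auto simp: monomial_span_def)

lemma monomial_span_sum:
  "(\<And>i. i \<in> X \<Longrightarrow> f i \<in> monomial_span n A) \<Longrightarrow> sum f X \<in> monomial_span n A"
  by (induction X rule: infinite_finite_induct) (auto intro: monomial_span_plus)

section \<open>Graded matrices and resolutions\<close>

definition mat_mult :: "nat \<Rightarrow> (nat \<Rightarrow> nat \<Rightarrow> 'a::comm_ring_1) \<Rightarrow> (nat \<Rightarrow> nat \<Rightarrow> 'a) \<Rightarrow> nat \<Rightarrow> nat \<Rightarrow> 'a" where
  "mat_mult r A B = (\<lambda>l k. \<Sum>j<r. A l j * B j k)"

definition mat_vec :: "nat \<Rightarrow> (nat \<Rightarrow> nat \<Rightarrow> 'a::comm_ring_1) \<Rightarrow> (nat \<Rightarrow> 'a) \<Rightarrow> nat \<Rightarrow> 'a" where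
  "mat_vec r A x = (\<lambda>l. \<Sum>k<r. A l k * x k)"

lemma mat_vec_assoc: "mat_vec r A (mat_vec s B x) = mat_vec s (mat_mult r A B) x"
  unfolding mat_vec_def mat_mult_def sum_distrib_left sum_distrib_right
  by (subst sum.swap) (simp add: mult.assoc)

lemma mat_mult_column: "(\<lambda>l. mat_mult r A B l k) = mat_vec r A (\<lambda>l. B l k)"
  by (simp add: mat_mult_def mat_vec_def)

lemma mat_mult_eq: "mat_mult r A B l k = mat_vec r A (\<lambda>l. B l k) l"
  by (simp add: mat_mult_def mat_vec_def)

lemma mat_vec_cong:
  "(\<And>k. k < r \<Longrightarrow> A l k = B l k) \<Longrightarrow> (\<And>k. k < r \<Longrightarrow> x k = y k) \<Longrightarrow> mat_vec r A x l = mat_vec r B y l"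
  unfolding mat_vec_def by (intro sum.cong) auto

lemma mat_vec_add: "mat_vec r A (\<lambda>k. x k + y k) l = mat_vec r A x l + mat_vec r A y l"
  and mat_vec_diff: "mat_vec r A (\<lambda>k. x k - y k) l = mat_vec r A x l - mat_vec r A y l"
  and mat_vec_uminus: "mat_vec r A (\<lambda>k. - x k) l = - mat_vec r A x l"
  and mat_vec_minus_left: "mat_vec r (\<lambda>l k. A l k - B l k) x l = mat_vec r A x l - mat_vec r B x l"
  and mat_vec_zero [simp]: "mat_vec r A (\<lambda>k. 0) l = 0"
  by (simp_all add: mat_vec_def sum.distrib sum_subtractf sum_negf algebra_simps)

lemma mat_vec_unit: "l < r \<Longrightarrow> mat_vec r (\<lambda>l k. if l = k then 1 else 0) x l = x l"
  unfolding mat_vec_def by (simp add: if_distrib[of "\<lambda>c. c * _"] sum.delta cong: if_cong)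

lemma mat_vec_polys:
  "(\<And>k. k < r \<Longrightarrow> A l k \<in> polys n) \<Longrightarrow> (\<And>k. k < r \<Longrightarrow> x k \<in> polys n) \<Longrightarrow> mat_vec r A x l \<in> polys n"
  unfolding mat_vec_def by (intro polys_sum polys_times) auto

lemma sum_lessThan_add:
  fixes f :: "nat \<Rightarrow> 'a::comm_monoid_add"
  shows "(\<Sum>k<a + b. f k) = (\<Sum>k<a. f k) + (\<Sum>k<b. f (a + k))"
  by (induction b) (simp_all add: add.assoc)

text \<open>
  The matrix of a homogeneous map of degree 0 from the free module with \<open>r\<close> basis elements of
  degrees \<open>a\<close> to the one with \<open>s\<close> basis elements of degrees \<open>b\<close>.
\<close>

definition graded_matrix ::
  "nat \<Rightarrow> nat \<Rightarrow> (nat \<Rightarrow> int) \<Rightarrow> nat \<Rightarrow> (nat \<Rightarrow> int) \<Rightarrow> (nat \<Rightarrow> nat \<Rightarrow> 'k::field mpoly) \<Rightarrow> bool" where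
  "graded_matrix n s b r a A \<longleftrightarrow>
    (\<forall>l<s. \<forall>k<r. A l k \<in> polys n \<and> homogeneous_of_degree (a k - b l) (A l k))"

lemma graded_matrixD:
  assumes "graded_matrix n s b r a A" "l < s" "k < r"
  shows "A l k \<in> polys n" "homogeneous_of_degree (a k - b l) (A l k)"
  using assms by (auto simp: graded_matrix_def)

lemma graded_matrix_mult:
  assumes "graded_matrix n s b r a A" "graded_matrix n r a q c B"
  shows "graded_matrix n s b q c (mat_mult r A B)"
  unfolding graded_matrix_def mat_mult_def
proof (intro allI impI conjI)
  fix l k assume l: "l < s" and k: "k < q"
  show "(\<Sum>j<r. A l j * B j k) \<in> polys n"
    by (intro polys_sum polys_times) (use assms l k in \<open>auto simp: graded_matrix_def\<close>)
  show "homogeneous_of_degree (c k - b l) (\<Sum>j<r. A l j * B j k)"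
  proof (rule homogeneous_sum)
    fix j assume "j \<in> {..<r}"
    thus "homogeneous_of_degree (c k - b l) (A l j * B j k)"
      using graded_matrixD(2)[OF assms(1) l, of j] graded_matrixD(2)[OF assms(2) _ k, of j]
      by (auto elim: homogeneous_times)
  qed
qed

lemma graded_matrix_diff:
  "graded_matrix n s b r a A \<Longrightarrow> graded_matrix n s b r a B \<Longrightarrow>
   graded_matrix n s b r a (\<lambda>l k. A l k - B l k)"
  by (auto simp: graded_matrix_def)

lemma graded_matrix_unit:
  "graded_matrix n s b s b (\<lambda>l k. if l = k then 1 else 0)"
  by (auto simp: graded_matrix_def)

lemma graded_matrix_const:
  assumes "graded_matrix n s b r a A" "l < s" "k < r" "lookup (A l k) 0 \<noteq> 0"
  shows "b l = a k"
  using graded_matrixD(2)[OF assms(1-3)] assms(4) by (force simp: homogeneous_iff)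

text \<open>
  In the bottom degree the cycles are the elements of \<open>I\<close>: exactness there says that the
  augmentation maps onto \<open>I\<close>.
\<close>

definition cycle ::
  "'k::field mpoly set \<Rightarrow> (nat \<Rightarrow> nat) \<Rightarrow> (nat \<Rightarrow> nat \<Rightarrow> nat \<Rightarrow> 'k mpoly) \<Rightarrow> nat \<Rightarrow> (nat \<Rightarrow> 'k mpoly) \<Rightarrow> bool"
where
  "cycle I R D i x \<longleftrightarrow>
    (case i of 0 \<Rightarrow> x 0 \<in> I | Suc j \<Rightarrow> \<forall>l<R j. mat_vec (R i) (D j) x l = 0)"

lemma cycle_0: "cycle I R D 0 x \<longleftrightarrow> x 0 \<in> I"
  and cycle_Suc: "cycle I R D (Suc j) x \<longleftrightarrow> (\<forall>l<R j. mat_vec (R (Suc j)) (D j) x l = 0)"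
  by (simp_all add: cycle_def)

text \<open>
  A resolution is recorded as the complex $\cdots \to M_2 \to M_1 \to M_0 = S$ whose image in $S$
  is \<open>I\<close>: the augmentation counts as the differential $D_0$. Then comparison maps, homotopies
  and mapping cones need no special treatment of the bottom degree.
\<close>

locale free_resolution =
  fixes n :: nat and I :: "'k::field mpoly set"
    and R :: "nat \<Rightarrow> nat" and E :: "nat \<Rightarrow> nat \<Rightarrow> int" and D :: "nat \<Rightarrow> nat \<Rightarrow> nat \<Rightarrow> 'k mpoly"
  assumes rank_0: "R 0 = 1" and degree_0: "E 0 0 = 0"
    and graded: "\<And>i. graded_matrix n (R i) (E i) (R (Suc i)) (E (Suc i)) (D i)"
    and columns: "\<And>i k. k < R (Suc i) \<Longrightarrow> cycle I R D i (\<lambda>l. D i l k)"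
    and exact: "\<And>i x. (\<And>l. l < R i \<Longrightarrow> x l \<in> polys n) \<Longrightarrow> cycle I R D i x \<Longrightarrow>
      \<exists>y. (\<forall>k<R (Suc i). y k \<in> polys n) \<and> (\<forall>l<R i. x l = mat_vec (R (Suc i)) (D i) y l)"
begin

lemma complex: "l < R i \<Longrightarrow> k < R (Suc (Suc i)) \<Longrightarrow> mat_mult (R (Suc i)) (D i) (D (Suc i)) l k = 0"
  using columns[of k "Suc i"] by (simp add: cycle_Suc mat_mult_eq)

lemma complex_vec: "l < R i \<Longrightarrow> mat_vec (R (Suc i)) (D i) (mat_vec (R (Suc (Suc i))) (D (Suc i)) x) l = 0"
  unfolding mat_vec_assoc by (subst mat_vec_def) (simp add: complex)

text \<open>
  As the differential is homogeneous, a preimage of a homogeneous cycle may be replaced by its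
  components of the right degrees. All columns are treated together, to lift whole maps.
\<close>

lemma lift:
  assumes A: "graded_matrix n (R i) (E i) r \<delta> A" and Z: "\<And>k. k < r \<Longrightarrow> cycle I R D i (\<lambda>l. A l k)"
  obtains B where "graded_matrix n (R (Suc i)) (E (Suc i)) r \<delta> B"
    and "\<And>l k. l < R i \<Longrightarrow> k < r \<Longrightarrow> A l k = mat_mult (R (Suc i)) (D i) B l k"
proof -
  define Y where "Y k = (SOME y. (\<forall>j<R (Suc i). y j \<in> polys n) \<and>
      (\<forall>l<R i. A l k = mat_vec (R (Suc i)) (D i) y l))" for k
  have Y: "(\<forall>j<R (Suc i). Y k j \<in> polys n) \<and> (\<forall>l<R i. A l k = mat_vec (R (Suc i)) (D i) (Y k) l)"
    if "k < r" for k
    unfolding Y_def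
    by (rule someI_ex[OF exact[of i "\<lambda>l. A l k"]])
       (use graded_matrixD(1)[OF A _ that] Z[OF that] in auto)
  define B where "B = (\<lambda>j k. hom_part (\<delta> k - E (Suc i) j) (Y k j))"
  show ?thesis
  proof
    show "graded_matrix n (R (Suc i)) (E (Suc i)) r \<delta> B"
      unfolding graded_matrix_def B_def using Y by (auto intro!: polys_hom_part)
    fix l k assume l: "l < R i" and k: "k < r"
    have "A l k = hom_part (\<delta> k - E i l) (A l k)"
      using graded_matrixD(2)[OF A l k] by (simp add: hom_part_eq_self)
    also have "\<dots> = (\<Sum>j<R (Suc i). hom_part (\<delta> k - E i l) (D i l j * Y k j))"
      using Y[OF k] l by (simp add: mat_vec_def hom_part_sum)
    also have "\<dots> = (\<Sum>j<R (Suc i). D i l j * B j k)"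
    proof (rule sum.cong)
      fix j assume "j \<in> {..<R (Suc i)}"
      hence "homogeneous_of_degree (E (Suc i) j - E i l) (D i l j)"
        using graded_matrixD(2)[OF graded l] by simp
      from hom_part_times[OF this, of "\<delta> k - E (Suc i) j" "Y k j"]
      show "hom_part (\<delta> k - E i l) (D i l j * Y k j) = D i l j * B j k"
        by (simp add: B_def)
    qed simp
    finally show "A l k = mat_mult (R (Suc i)) (D i) B l k"
      by (simp add: mat_mult_def)
  qed
qed

end

text \<open>
  The chain map is built upwards: the part found so far, composed with the differential of \<open>F\<close>,
  has cycles of \<open>G\<close> as columns, and these can be lifted. Resolutions of the same ideal are compared
  with $q = 1$; mapping cones need an arbitrary monomial \<open>q\<close>.
\<close>

lemma comparison_map:
  assumes F: "free_resolution n J RF EF DF" and G: "free_resolution n I RG EG DG"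
    and q: "q \<in> polys n" "homogeneous_of_degree e q" and qJ: "\<And>p. p \<in> J \<Longrightarrow> q * p \<in> I"
  obtains \<phi> where "\<phi> 0 0 0 = q"
    and "\<And>i. graded_matrix n (RG i) (EG i) (RF i) (\<lambda>k. EF i k + e) (\<phi> i)"
    and "\<And>i l k. l < RG i \<Longrightarrow> k < RF (Suc i) \<Longrightarrow>
      mat_mult (RF i) (\<phi> i) (DF i) l k = mat_mult (RG (Suc i)) (DG i) (\<phi> (Suc i)) l k"
proof -
  interpret F: free_resolution n J RF EF DF by (rule F)
  interpret G: free_resolution n I RG EG DG by (rule G)
  define P where "P i f \<longleftrightarrow> graded_matrix n (RG i) (EG i) (RF i) (\<lambda>k. EF i k + e) f \<and>
      (i = 0 \<longrightarrow> f 0 0 = q) \<and>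
      (\<forall>k<RF (Suc i). cycle I RG DG i (\<lambda>l. mat_mult (RF i) f (DF i) l k))" for i f
  define Q where "Q i f g \<longleftrightarrow> (\<forall>l<RG i. \<forall>k<RF (Suc i).
      mat_mult (RF i) f (DF i) l k = mat_mult (RG (Suc i)) (DG i) g l k)" for i f g
  have "\<exists>\<phi>. \<forall>i. P i (\<phi> i) \<and> Q i (\<phi> i) (\<phi> (Suc i))"
  proof (rule dependent_nat_choice)
    have "q * DF 0 0 k \<in> I" if "k < RF 1" for k
      using F.columns[of k 0] that qJ by (simp add: cycle_0)
    thus "\<exists>f. P 0 f"
      using q by (intro exI[of _ "\<lambda>_ _. q"])
        (auto simp: P_def graded_matrix_def cycle_0 mat_mult_def F.rank_0 G.rank_0 F.degree_0 G.degree_0)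
  next
    fix f i assume P: "P i f"
    have gr: "graded_matrix n (RG i) (EG i) (RF (Suc i)) (\<lambda>k. EF (Suc i) k + e) (mat_mult (RF i) f (DF i))"
    proof (rule graded_matrix_mult)
      show "graded_matrix n (RF i) (\<lambda>k. EF i k + e) (RF (Suc i)) (\<lambda>k. EF (Suc i) k + e) (DF i)"
        using F.graded[of i] by (simp add: graded_matrix_def)
    qed (use P in \<open>simp add: P_def\<close>)
    obtain g where g: "graded_matrix n (RG (Suc i)) (EG (Suc i)) (RF (Suc i)) (\<lambda>k. EF (Suc i) k + e) g"
      and fg: "\<And>l k. l < RG i \<Longrightarrow> k < RF (Suc i) \<Longrightarrow>
        mat_mult (RF i) f (DF i) l k = mat_mult (RG (Suc i)) (DG i) g l k"
      using G.lift[OF gr] P unfolding P_def by blast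
    have "cycle I RG DG (Suc i) (\<lambda>l. mat_mult (RF (Suc i)) g (DF (Suc i)) l k)"
      if k: "k < RF (Suc (Suc i))" for k
      unfolding cycle_Suc
    proof (intro allI impI)
      fix l assume l: "l < RG i"
      have "mat_vec (RG (Suc i)) (DG i) (\<lambda>l. mat_mult (RF (Suc i)) g (DF (Suc i)) l k) l =
          mat_vec (RF (Suc i)) (mat_mult (RG (Suc i)) (DG i) g) (\<lambda>l. DF (Suc i) l k) l"
        by (simp add: mat_mult_column mat_vec_assoc)
      also have "\<dots> = mat_vec (RF (Suc i)) (mat_mult (RF i) f (DF i)) (\<lambda>l. DF (Suc i) l k) l"
        by (rule mat_vec_cong) (use fg l in auto)
      also have "\<dots> = mat_vec (RF i) f (\<lambda>l. mat_mult (RF (Suc i)) (DF i) (DF (Suc i)) l k) l"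
        by (simp add: mat_mult_column mat_vec_assoc)
      also have "\<dots> = mat_vec (RF i) f (\<lambda>l. 0) l"
        by (rule mat_vec_cong) (use F.complex k in auto)
      finally show "mat_vec (RG (Suc i)) (DG i) (\<lambda>l. mat_mult (RF (Suc i)) g (DF (Suc i)) l k) l = 0"
        by simp
    qed
    thus "\<exists>g. P (Suc i) g \<and> Q i f g"
      using g fg by (auto simp: P_def Q_def)
  qed
  then obtain \<phi> where "\<And>i. P i (\<phi> i)" "\<And>i. Q i (\<phi> i) (\<phi> (Suc i))" by blast
  thus thesis by (intro that[of \<phi>]) (auto simp: P_def Q_def)
qed

text \<open>
  The homotopy may start with 0 because \<open>\<chi>\<close> is the identity on $M_0 = S$. From then on, the
  difference of \<open>\<chi>\<close> and the identity, corrected by the homotopy found so far, has cycles as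
  columns, and these can be lifted.
\<close>

lemma (in free_resolution) homotopy:
  assumes gr: "\<And>i. graded_matrix n (R i) (E i) (R i) (E i) (\<chi> i)" and \<chi>0: "\<chi> 0 0 0 = 1"
    and comm: "\<And>i l k. l < R i \<Longrightarrow> k < R (Suc i) \<Longrightarrow>
      mat_mult (R i) (\<chi> i) (D i) l k = mat_mult (R (Suc i)) (D i) (\<chi> (Suc i)) l k"
  obtains h where "\<And>i. graded_matrix n (R (Suc i)) (E (Suc i)) (R i) (E i) (h i)"
    and "h 0 = (\<lambda>_ _. 0)"
    and "\<And>i l k. l < R (Suc i) \<Longrightarrow> k < R (Suc i) \<Longrightarrow>
      \<chi> (Suc i) l k - (if l = k then 1 else 0) =
        mat_mult (R (Suc (Suc i))) (D (Suc i)) (h (Suc i)) l k + mat_mult (R i) (h i) (D i) l k"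
proof -
  define \<theta> where "\<theta> i = (\<lambda>l k. \<chi> i l k - (if l = k then 1 else 0))" for i
  have \<theta>gr: "graded_matrix n (R i) (E i) (R i) (E i) (\<theta> i)" for i
    unfolding \<theta>_def by (intro graded_matrix_diff gr graded_matrix_unit)
  have \<theta>0: "\<theta> 0 0 0 = 0" by (simp add: \<theta>_def \<chi>0)
  have \<theta>comm: "mat_mult (R i) (\<theta> i) (D i) l k = mat_mult (R (Suc i)) (D i) (\<theta> (Suc i)) l k"
    if l: "l < R i" and k: "k < R (Suc i)" for i l k
  proof -
    have "mat_mult (R i) (\<theta> i) (D i) l k = mat_mult (R i) (\<chi> i) (D i) l k - D i l k"
      unfolding mat_mult_eq \<theta>_def mat_vec_minus_left by (simp add: mat_vec_unit l)
    moreover have "mat_mult (R (Suc i)) (D i) (\<theta> (Suc i)) l k =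
        mat_mult (R (Suc i)) (D i) (\<chi> (Suc i)) l k - D i l k"
      unfolding mat_mult_eq \<theta>_def mat_vec_diff
      using k by (simp add: mat_vec_def if_distrib[of "\<lambda>c. _ * c"] sum.delta cong: if_cong)
    ultimately show ?thesis using comm[OF l k] by simp
  qed
  define A where "A i h = (\<lambda>l k. \<theta> (Suc i) l k - mat_mult (R i) h (D i) l k)" for i h
  define P where "P i h \<longleftrightarrow> graded_matrix n (R (Suc i)) (E (Suc i)) (R i) (E i) h \<and>
      (i = 0 \<longrightarrow> h = (\<lambda>_ _. 0)) \<and> (\<forall>k<R (Suc i). cycle I R D (Suc i) (\<lambda>l. A i h l k))" for i h
  define Q where "Q i h h' \<longleftrightarrow> (\<forall>l<R (Suc i). \<forall>k<R (Suc i).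
      A i h l k = mat_mult (R (Suc (Suc i))) (D (Suc i)) h' l k)" for i h h'
  have "\<exists>h. \<forall>i. P i (h i) \<and> Q i (h i) (h (Suc i))"
  proof (rule dependent_nat_choice)
    have "mat_vec (R (Suc 0)) (D 0) (\<lambda>l. \<theta> (Suc 0) l k) 0 = 0" if "k < R (Suc 0)" for k
      using \<theta>comm[of 0 0 k] that \<theta>0 by (simp add: rank_0 mat_mult_def mat_vec_def)
    thus "\<exists>h. P 0 h"
      by (intro exI[of _ "\<lambda>_ _. 0"])
         (auto simp: P_def A_def graded_matrix_def cycle_Suc rank_0 mat_mult_def)
  next
    fix h i assume P: "P i h"
    have Agr: "graded_matrix n (R (Suc i)) (E (Suc i)) (R (Suc i)) (E (Suc i)) (A i h)"
      unfolding A_def using P graded[of i]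
      by (intro graded_matrix_diff \<theta>gr graded_matrix_mult[of _ _ _ _ "E i"]) (auto simp: P_def)
    obtain h' where h': "graded_matrix n (R (Suc (Suc i))) (E (Suc (Suc i))) (R (Suc i)) (E (Suc i)) h'"
      and eq: "\<And>l k. l < R (Suc i) \<Longrightarrow> k < R (Suc i) \<Longrightarrow>
        A i h l k = mat_mult (R (Suc (Suc i))) (D (Suc i)) h' l k"
      using lift[OF Agr] P unfolding P_def by blast
    have "mat_vec (R (Suc (Suc i))) (D (Suc i)) (\<lambda>l. A (Suc i) h' l k) l = 0"
      if k: "k < R (Suc (Suc i))" and l: "l < R (Suc i)" for k l
    proof -
      let ?d = "\<lambda>l. D (Suc i) l k"
      have "mat_vec (R (Suc (Suc i))) (D (Suc i)) (\<lambda>l. mat_mult (R (Suc i)) h' (D (Suc i)) l k) l =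
          mat_vec (R (Suc i)) (mat_mult (R (Suc (Suc i))) (D (Suc i)) h') ?d l"
        by (simp add: mat_mult_column mat_vec_assoc)
      also have "\<dots> = mat_vec (R (Suc i)) (A i h) ?d l"
        by (rule mat_vec_cong) (use eq l in auto)
      also have "\<dots> = mat_vec (R (Suc i)) (\<theta> (Suc i)) ?d l -
          mat_vec (R i) h (mat_vec (R (Suc i)) (D i) ?d) l"
        by (simp add: A_def mat_vec_minus_left mat_vec_assoc)
      also have "mat_vec (R i) h (mat_vec (R (Suc i)) (D i) ?d) l = mat_vec (R i) h (\<lambda>k. 0) l"
        by (rule mat_vec_cong) (use complex[of _ i k] k in \<open>auto simp: mat_mult_eq\<close>)
      also have "mat_vec (R (Suc i)) (\<theta> (Suc i)) ?d l =
          mat_vec (R (Suc (Suc i))) (D (Suc i)) (\<lambda>l. \<theta> (Suc (Suc i)) l k) l"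
        using \<theta>comm[OF l k] by (simp add: mat_mult_eq)
      finally show ?thesis by (simp add: A_def mat_vec_diff)
    qed
    thus "\<exists>h'. P (Suc i) h' \<and> Q i h h'"
      using h' eq by (auto simp: P_def Q_def cycle_Suc)
  qed
  then obtain h where "\<And>i. P i (h i)" "\<And>i. Q i (h i) (h (Suc i))" by blast
  thus thesis
    by (intro that[of h]) (auto simp: P_def Q_def A_def \<theta>_def algebra_simps)
qed

subsection \<open>The mapping cone\<close>

lemma colon_monomial_span:
  assumes "keys m \<subseteq> {1..n}" "s \<in> polys n"
  shows "Poly_Mapping.single m (1::'k::field) * s \<in> monomial_span n A \<longleftrightarrow>
    s \<in> monomial_span n ((\<lambda>a. a - m) ` A)"
proof -
  have keys: "keys (Poly_Mapping.single m (1::'k) * s) = (\<lambda>b. m + b) ` keys s"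
    by (auto simp: in_keys_iff lookup_single_times pp_dvd_def image_iff split: if_splits)
  have "Poly_Mapping.single m 1 * s \<in> polys n"
    using assms by (intro polys_times polys_single)
  thus ?thesis
    using assms(2) by (auto simp: monomial_span_def keys pp_dvd_minus_iff)
qed

lemma monomial_span_insert:
  assumes "p \<in> monomial_span n (insert m A)"
  obtains a s where "a \<in> monomial_span n A" "s \<in> polys n"
    "p = a + Poly_Mapping.single m (1::'k::field) * s"
proof -
  define X where "X = {b\<in>keys p. \<exists>a\<in>A. pp_dvd a b}"
  define a where "a = (\<Sum>b\<in>X. Poly_Mapping.single b (lookup p b))"
  define s where "s = (\<Sum>b\<in>keys p - X. Poly_Mapping.single (b - m) (lookup p b))"
  have kp: "keys b \<subseteq> {1..n}" if "b \<in> keys p" for b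
    using assms that by (auto simp: monomial_span_def polys_iff)
  have dvd: "pp_dvd m b" if "b \<in> keys p - X" for b
    using assms that by (auto simp: monomial_span_def X_def)
  show thesis
  proof
    show "a \<in> monomial_span n A"
      unfolding a_def
    proof (rule monomial_span_sum)
      fix b assume b: "b \<in> X"
      have "Poly_Mapping.single b (lookup p b) \<in> polys n"
        using b kp by (intro polys_single) (auto simp: X_def)
      thus "Poly_Mapping.single b (lookup p b) \<in> monomial_span n A"
        using b by (auto simp: monomial_span_def X_def split: if_splits)
    qed
    show "s \<in> polys n"
      unfolding s_def using kp keys_pp_minus by (intro polys_sum polys_single) blast
    have "Poly_Mapping.single m 1 * s = (\<Sum>b\<in>keys p - X. Poly_Mapping.single b (lookup p b))"
      unfolding s_def sum_distrib_left
      by (intro sum.cong) (use dvd in \<open>auto simp: mult_single pp_dvd_diff\<close>)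
    thus "p = a + Poly_Mapping.single m 1 * s"
      using sum.subset_diff[of X "keys p" "\<lambda>b. Poly_Mapping.single b (lookup p b)"] poly_expand[of p]
      by (simp add: a_def X_def add.commute)
  qed
qed

text \<open>
  If \<open>m\<close> is added to the generators of $I' = (A)$, then $(I' + (m))/I' \cong S/(I' : m)$ up to a
  shift of degrees. So the mapping cone of a lift of multiplication by \<open>m\<close>, from a resolution of
  the colon ideal to one of $I'$, resolves $I' + (m)$.
\<close>

lemma mapping_cone:
  assumes G: "free_resolution n (monomial_span n A :: 'k::field mpoly set) RG EG DG"
    and F: "free_resolution n (monomial_span n ((\<lambda>a. a - m) ` A) :: 'k mpoly set) RF EF DF"
    and m: "keys m \<subseteq> {1..n}"
  obtains RC EC DC where
    "free_resolution n (monomial_span n (insert m A) :: 'k mpoly set) RC EC DC"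
    and "\<And>i. RC (Suc i) = RG (Suc i) + RF i"
    and "\<And>i k. k < RG (Suc i) \<Longrightarrow> EC (Suc i) k = EG (Suc i) k"
    and "\<And>i k. EC (Suc i) (RG (Suc i) + k) = EF i k + int (pp_degree m)"
    and "\<And>k. k < RG 1 \<Longrightarrow> DC 0 0 k = DG 0 0 k"
    and "DC 0 0 (RG 1) = Poly_Mapping.single m 1"
proof -
  let ?q = "Poly_Mapping.single m 1 :: 'k mpoly" and ?e = "int (pp_degree m)"
  let ?I' = "monomial_span n A :: 'k mpoly set" and ?I = "monomial_span n (insert m A) :: 'k mpoly set"
  let ?J = "monomial_span n ((\<lambda>a. a - m) ` A) :: 'k mpoly set"
  interpret G: free_resolution n ?I' RG EG DG by (rule G)
  interpret F: free_resolution n ?J RF EF DF by (rule F)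
  have qpoly: "?q \<in> polys n" using m by (rule polys_single)
  have J: "?q * s \<in> ?I' \<longleftrightarrow> s \<in> ?J" if "s \<in> polys n" for s
    using colon_monomial_span[OF m that] .
  have Jp: "s \<in> polys n" if "s \<in> ?J" for s using that by (simp add: monomial_span_def)
  have II: "p \<in> ?I" if "p \<in> ?I'" for p using that by (auto simp: monomial_span_def)
  obtain \<phi> where \<phi>0: "\<phi> 0 0 0 = ?q"
    and \<phi>gr: "\<And>i. graded_matrix n (RG i) (EG i) (RF i) (\<lambda>k. EF i k + ?e) (\<phi> i)"
    and \<phi>: "\<And>i l k. l < RG i \<Longrightarrow> k < RF (Suc i) \<Longrightarrow>
      mat_mult (RF i) (\<phi> i) (DF i) l k = mat_mult (RG (Suc i)) (DG i) (\<phi> (Suc i)) l k"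
  proof (rule comparison_map[OF F G qpoly])
    show "homogeneous_of_degree ?e ?q" by (rule homogeneous_single) simp
  qed (use J Jp in blast)+
  define rf where "rf i = (case i of 0 \<Rightarrow> 0 | Suc j \<Rightarrow> RF j)" for i
  define RC where "RC i = RG i + rf i" for i
  define EC where "EC i k = (if k < RG i then EG i k else EF (i - 1) (k - RG i) + ?e)" for i k
  define DC where "DC i l k =
    (if k < RG (Suc i) then (if l < RG i then DG i l k else 0)
     else if l < RG i then \<phi> i l (k - RG (Suc i))
     else - DF (i - 1) (l - RG i) (k - RG (Suc i)))" for i l k
  have rf [simp]: "rf 0 = 0" "rf (Suc i) = RF i" for i by (simp_all add: rf_def)
  have RC0: "RC 0 = 1" by (simp add: RC_def G.rank_0)
  have RCS: "RC (Suc i) = RG (Suc i) + RF i" for i by (simp add: RC_def)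
  \<comment> \<open>A vector of the cone is a concatenation, so that sums over its entries split in two.\<close>
  have vec_top: "mat_vec (RC (Suc i)) (DC i) x l =
      mat_vec (RG (Suc i)) (DG i) x l + mat_vec (RF i) (\<phi> i) (\<lambda>k. x (RG (Suc i) + k)) l"
    if "l < RG i" for i l x
    unfolding mat_vec_def RCS sum_lessThan_add using that by (simp add: DC_def)
  have vec_bot: "mat_vec (RC (Suc (Suc i))) (DC (Suc i)) x (RG (Suc i) + l) =
      - mat_vec (RF (Suc i)) (DF i) (\<lambda>k. x (RG (Suc (Suc i)) + k)) l" for i l x
    unfolding mat_vec_def RCS sum_lessThan_add by (simp add: DC_def sum_negf)
  have row_cases [consumes 1, case_names 1 2]: thesis
    if lR: "l < RC i" and top: "l < RG i \<Longrightarrow> thesis"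
and bot: "\<And>j l'. i = Suc j \<Longrightarrow> l' < RF j \<Longrightarrow> l = RG (Suc j) + l' \<Longrightarrow> thesis" for l i thesis
  proof (cases "l < RG i")
    case False
    obtain j where "i = Suc j" using False lR by (cases i) (auto simp: RC_def)
    thus thesis using bot[of j "l - RG i"] False lR by (simp add: RC_def)
  qed (rule top)
  have C: "free_resolution n ?I RC EC DC"
  proof
    show "RC 0 = 1" by (rule RC0)
    show "EC 0 0 = 0" by (simp add: EC_def G.rank_0 G.degree_0)
    show "graded_matrix n (RC i) (EC i) (RC (Suc i)) (EC (Suc i)) (DC i)" for i
      unfolding graded_matrix_def
    proof (intro allI impI)
      fix l k assume l: "l < RC i" and k: "k < RC (Suc i)"
      from l show "DC i l k \<in> polys n \<and> homogeneous_of_degree (EC (Suc i) k - EC i l) (DC i l k)"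
      proof (cases rule: row_cases)
        case 1
        show ?thesis
        proof (cases "k < RG (Suc i)")
          case True
          thus ?thesis using graded_matrixD[OF G.graded[of i] 1 True] 1 by (simp add: DC_def EC_def)
        next
          case False
          hence "k - RG (Suc i) < RF i" using k by (simp add: RCS)
          thus ?thesis using graded_matrixD[OF \<phi>gr 1] 1 False by (simp add: DC_def EC_def)
        qed
      next
        case (2 j l')
        show ?thesis
        proof (cases "k < RG (Suc i)")
          case True
          thus ?thesis using 2 by (auto simp: DC_def)
        next
          case False
          hence "k - RG (Suc i) < RF (Suc j)" using k 2 by (simp add: RCS)
          thus ?thesis using graded_matrixD[OF F.graded 2(2)] 2 False
            by (auto simp: DC_def EC_def intro!: polys_uminus homogeneous_uminus)
        qed
      qed
    qed
    show "cycle ?I RC DC i (\<lambda>l. DC i l k)" if k: "k < RC (Suc i)" for i k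
    proof (cases i)
      case 0
      have "?q \<in> ?I" using qpoly by (auto simp: monomial_span_def)
      thus ?thesis
        using 0 k \<phi>0 II G.columns[of k 0]
        by (auto simp: cycle_0 DC_def RCS F.rank_0 G.rank_0)
    next
      case (Suc j)
      show ?thesis unfolding Suc cycle_Suc
      proof (intro allI impI)
        fix l assume "l < RC j"
        thus "mat_vec (RC (Suc j)) (DC j) (\<lambda>l. DC (Suc j) l k) l = 0"
        proof (cases rule: row_cases)
          case 1
          have "mat_vec (RG (Suc j)) (DG j) (\<lambda>l. DC (Suc j) l k) l =
              mat_vec (RG (Suc j)) (DG j) (\<lambda>l. if k < RG (Suc (Suc j)) then DG (Suc j) l k
                else \<phi> (Suc j) l (k - RG (Suc (Suc j)))) l"
            by (rule mat_vec_cong) (auto simp: DC_def)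
          moreover have "mat_vec (RF j) (\<phi> j) (\<lambda>l. DC (Suc j) (RG (Suc j) + l) k) l =
              mat_vec (RF j) (\<phi> j) (\<lambda>l. if k < RG (Suc (Suc j)) then 0
                else - DF j l (k - RG (Suc (Suc j)))) l"
            by (rule mat_vec_cong) (auto simp: DC_def)
          ultimately show ?thesis
            using k Suc G.complex[OF 1, of k] \<phi>[OF 1, of "k - RG (Suc (Suc j))"]
            unfolding vec_top[OF 1]
            by (cases "k < RG (Suc (Suc j))") (simp_all add: mat_mult_eq RCS mat_vec_uminus)
        next
          case (2 j' l')
          have "mat_vec (RF (Suc j')) (DF j') (\<lambda>l. DC (Suc j) (RG (Suc j) + l) k) l' =
              mat_vec (RF (Suc j')) (DF j') (\<lambda>l. if k < RG (Suc (Suc j)) then 0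
                else - DF j l (k - RG (Suc (Suc j)))) l'"
            by (rule mat_vec_cong) (auto simp: DC_def)
          thus ?thesis
            using k Suc F.complex[OF 2(2), of "k - RG (Suc (Suc j))"]
            unfolding 2(1) 2(3) vec_bot
            by (cases "k < RG (Suc (Suc j))") (simp_all add: 2(1) mat_mult_eq RCS mat_vec_uminus)
        qed
      qed
    qed
    fix i and x :: "nat \<Rightarrow> 'k mpoly"
    assume xp: "\<And>l. l < RC i \<Longrightarrow> x l \<in> polys n" and x: "cycle ?I RC DC i x"
    show "\<exists>y. (\<forall>k<RC (Suc i). y k \<in> polys n) \<and> (\<forall>l<RC i. x l = mat_vec (RC (Suc i)) (DC i) y l)"
    proof (cases i)
      case 0
      obtain a s where a: "a \<in> ?I'" and s: "s \<in> polys n" and xas: "x 0 = a + ?q * s"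
        using x monomial_span_insert unfolding 0 cycle_0 by blast
      obtain y where y: "\<forall>k<RG (Suc 0). y k \<in> polys n" "a = mat_vec (RG (Suc 0)) (DG 0) y 0"
        using G.exact[of 0 "\<lambda>_. a"] a by (auto simp: cycle_0 G.rank_0 monomial_span_def)
      define z where "z k = (if k < RG (Suc 0) then y k else s)" for k
      have "mat_vec (RG (Suc 0)) (DG 0) z 0 = a"
        unfolding y(2) by (rule mat_vec_cong) (auto simp: z_def)
      hence "x 0 = mat_vec (RC (Suc 0)) (DC 0) z 0"
        by (subst vec_top) (simp_all add: G.rank_0 xas F.rank_0 \<phi>0 z_def mat_vec_def)
      moreover have "\<forall>k<RC (Suc 0). z k \<in> polys n" using y s by (simp add: z_def)
      ultimately show ?thesis unfolding 0 RC0 by auto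
    next
      case (Suc j)
      let ?f = "\<lambda>l. x (RG (Suc j) + l)"
      have top: "mat_vec (RG (Suc j)) (DG j) x l + mat_vec (RF j) (\<phi> j) ?f l = 0" if "l < RG j" for l
        using x that vec_top[OF that, of x] unfolding Suc cycle_Suc by (simp add: RC_def)
      have fp: "?f l \<in> polys n" if "l < RF j" for l using xp that by (simp add: Suc RCS)
      have gp: "x l \<in> polys n" if "l < RG (Suc j)" for l using xp that by (simp add: Suc RCS)
      have "cycle ?J RF DF j ?f"
      proof (cases j)
        case 0
        have "mat_vec (RG (Suc 0)) (DG 0) x 0 \<in> ?I'"
          unfolding mat_vec_def using gp G.columns[of _ 0] 0
          by (intro monomial_span_sum monomial_span_times) (auto simp: cycle_0)
        hence "mat_vec (RG (Suc 0)) (DG 0) x 0 * (- 1) \<in> ?I'"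
          by (intro monomial_span_times polys_uminus) auto
        moreover have "?q * ?f 0 = mat_vec (RG (Suc 0)) (DG 0) x 0 * (- 1)"
          using top[of 0] 0 G.rank_0 F.rank_0 \<phi>0 by (simp add: mat_vec_def eq_neg_iff_add_eq_0 add.commute)
        ultimately show ?thesis using J[OF fp[of 0]] 0 F.rank_0 by (simp add: cycle_0)
      next
        case (Suc j')
        have "mat_vec (RF j) (DF j') ?f l = 0" if l: "l < RF j'" for l
        proof -
          have "RG j + l < RC j" using l by (simp add: Suc RCS)
          hence "mat_vec (RC (Suc j)) (DC j) x (RG j + l) = 0"
            using x unfolding \<open>i = Suc j\<close> cycle_Suc by blast
          thus ?thesis using vec_bot[of j' x l] by (simp add: Suc)
        qed
        thus ?thesis unfolding Suc cycle_Suc by (simp add: Suc)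
      qed
      then obtain f' where f'p: "\<And>k. k < RF (Suc j) \<Longrightarrow> f' k \<in> polys n"
        and f': "\<And>l. l < RF j \<Longrightarrow> ?f l = mat_vec (RF (Suc j)) (DF j) f' l"
        using F.exact[of j ?f] fp by blast
      let ?g = "\<lambda>l. x l + mat_vec (RF (Suc j)) (\<phi> (Suc j)) f' l"
      have "mat_vec (RG (Suc j)) (DG j) ?g l = 0" if l: "l < RG j" for l
      proof -
        have "mat_vec (RG (Suc j)) (DG j) (mat_vec (RF (Suc j)) (\<phi> (Suc j)) f') l =
            mat_vec (RF (Suc j)) (mat_mult (RF j) (\<phi> j) (DF j)) f' l"
          unfolding mat_vec_assoc by (rule mat_vec_cong) (use \<phi>[OF l] in auto)
        also have "\<dots> = mat_vec (RF j) (\<phi> j) ?f l"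
          unfolding mat_vec_assoc[symmetric] by (rule mat_vec_cong) (use f' in auto)
        finally show ?thesis using top[OF l] by (simp add: mat_vec_add)
      qed
      hence "cycle ?I' RG DG (Suc j) ?g" by (simp add: cycle_Suc)
      moreover have "?g l \<in> polys n" if "l < RG (Suc j)" for l
        using gp f'p graded_matrixD(1)[OF \<phi>gr that] that by (intro polys_plus mat_vec_polys) auto
      ultimately obtain g' where g'p: "\<And>k. k < RG (Suc (Suc j)) \<Longrightarrow> g' k \<in> polys n"
        and g': "\<And>l. l < RG (Suc j) \<Longrightarrow> ?g l = mat_vec (RG (Suc (Suc j))) (DG (Suc j)) g' l"
        using G.exact[of "Suc j" ?g] by blast
      define y where "y k = (if k < RG (Suc (Suc j)) then g' k else - f' (k - RG (Suc (Suc j))))" for k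
      have "x l = mat_vec (RC (Suc (Suc j))) (DC (Suc j)) y l" if "l < RC (Suc j)" for l
        using that
      proof (cases rule: row_cases)
        case 1
        have "mat_vec (RG (Suc (Suc j))) (DG (Suc j)) y l = mat_vec (RG (Suc (Suc j))) (DG (Suc j)) g' l"
          by (rule mat_vec_cong) (auto simp: y_def)
        thus ?thesis
          unfolding vec_top[OF 1] g'[OF 1, symmetric] by (simp add: y_def mat_vec_uminus)
      next
        case (2 j' l')
        thus ?thesis using f'[of l'] by (simp add: vec_bot y_def mat_vec_uminus)
      qed
      moreover have "\<forall>k<RC (Suc (Suc j)). y k \<in> polys n"
        using f'p g'p by (auto simp: y_def RCS intro!: polys_uminus)
      ultimately show ?thesis unfolding Suc by blast
    qed
  qed
  show thesis
    by (rule that[OF C]) (auto simp: RCS EC_def DC_def \<phi>0 G.rank_0)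
qed

lemma free_resolution_zero:
  "free_resolution n (monomial_span n {} :: 'k::field mpoly set) (\<lambda>i. if i = 0 then 1 else 0) (\<lambda>_ _. 0) (\<lambda>_ _ _. 0)"
proof -
  have "monomial_span n {} = {0 :: 'k mpoly}" by (auto simp: monomial_span_def)
  thus ?thesis
    by unfold_locales (auto simp: graded_matrix_def cycle_def mat_vec_def split: nat.splits)
qed

text \<open>
  By induction on the number of generators: the last one is added by a mapping cone, and both the
  ideal of the others and the colon ideal need fewer generators. That $M_1$ has the given generators
  as its basis will make its syzygies accessible.
\<close>

lemma monomial_resolution_exists:
  assumes "\<And>m. m \<in> set ms \<Longrightarrow> keys m \<subseteq> {1..n}"
  shows "\<exists>R E D. free_resolution n (monomial_span n (set ms) :: 'k::field mpoly set) R E D \<and>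
    R 1 = length ms \<and>
    (\<forall>k<length ms. D 0 0 k = Poly_Mapping.single (ms ! k) 1 \<and> E 1 k = int (pp_degree (ms ! k)))"
  using assms
proof (induction ms rule: length_induct)
  case (1 ms)
  show ?case
  proof (cases ms rule: rev_cases)
    case Nil
    thus ?thesis using free_resolution_zero[of n] by fastforce
  next
    case (snoc ms' m)
    obtain RG EG and DG :: "nat \<Rightarrow> nat \<Rightarrow> nat \<Rightarrow> 'k mpoly"
      where G: "free_resolution n (monomial_span n (set ms')) RG EG DG"
      and RG1: "RG 1 = length ms'" and G0: "\<And>k. k < length ms' \<Longrightarrow>
        DG 0 0 k = Poly_Mapping.single (ms' ! k) 1 \<and> EG 1 k = int (pp_degree (ms' ! k))"
      using 1(1)[rule_format, of ms'] 1(2) snoc by auto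
    have "keys a \<subseteq> {1..n}" if "a \<in> set (map (\<lambda>a. a - m) ms')" for a
    proof -
      obtain b where "b \<in> set ms" "a = b - m" using \<open>a \<in> _\<close> snoc by auto
      thus ?thesis using 1(2) keys_pp_minus[of b m] by blast
    qed
    then obtain RF EF and DF :: "nat \<Rightarrow> nat \<Rightarrow> nat \<Rightarrow> 'k mpoly"
      where F: "free_resolution n (monomial_span n ((\<lambda>a. a - m) ` set ms')) RF EF DF"
      using 1(1)[rule_format, of "map (\<lambda>a. a - m) ms'"] snoc by auto
    have m: "keys m \<subseteq> {1..n}" using 1(2) snoc by simp
    show ?thesis
    proof (rule mapping_cone[OF G F m])
      fix RC EC and DC :: "nat \<Rightarrow> nat \<Rightarrow> nat \<Rightarrow> 'k mpoly"
      assume C: "free_resolution n (monomial_span n (insert m (set ms'))) RC EC DC"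
        and RC: "\<And>i. RC (Suc i) = RG (Suc i) + RF i"
        and EC: "\<And>i k. k < RG (Suc i) \<Longrightarrow> EC (Suc i) k = EG (Suc i) k"
          "\<And>i k. EC (Suc i) (RG (Suc i) + k) = EF i k + int (pp_degree m)"
        and DC: "\<And>k. k < RG 1 \<Longrightarrow> DC 0 0 k = DG 0 0 k" "DC 0 0 (RG 1) = Poly_Mapping.single m 1"
      have "RC 1 = length ms"
        using RC[of 0] RG1 snoc free_resolution.rank_0[OF F] by simp
      moreover have "EC 1 (length ms') = int (pp_degree m)"
        using EC(2)[of 0 0] RG1 free_resolution.degree_0[OF F] by simp
      ultimately show ?thesis
        using C EC(1)[of _ 0] DC RG1 G0 snoc
        by (intro exI[of _ RC] exI[of _ EC] exI[of _ DC]) (auto simp: nth_append less_Suc_eq)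
    qed
  qed
qed

subsection \<open>Linear quotients\<close>

definition linear_resolution :: "nat \<Rightarrow> 'k::field mpoly set \<Rightarrow> nat \<Rightarrow> bool" where
  "linear_resolution n I d \<longleftrightarrow>
    (\<exists>R E D. free_resolution n I R E D \<and> (\<forall>i. \<forall>k<R (Suc i). E (Suc i) k = int d + int i))"

text \<open>
  In the cone, the resolution of the colon ideal moves up by one step and its degrees grow by \<open>d\<close>;
  as it starts with $S$ in degree 0 and continues linearly from degree 1, its basis elements arrive
  exactly where a \<open>d\<close>-linear resolution has them.
\<close>

lemma linear_resolution_insert:
  assumes G: "linear_resolution n (monomial_span n A :: 'k::field mpoly set) d"
    and F: "linear_resolution n (monomial_span n ((\<lambda>a. a - m) ` A) :: 'k mpoly set) 1"
    and m: "keys m \<subseteq> {1..n}" "pp_degree m = d"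
  shows "linear_resolution n (monomial_span n (insert m A) :: 'k mpoly set) d"
proof -
  obtain RG EG and DG :: "nat \<Rightarrow> nat \<Rightarrow> nat \<Rightarrow> 'k mpoly"
    where G: "free_resolution n (monomial_span n A) RG EG DG"
      and EG: "\<And>i k. k < RG (Suc i) \<Longrightarrow> EG (Suc i) k = int d + int i"
    using G unfolding linear_resolution_def by blast
  obtain RF EF and DF :: "nat \<Rightarrow> nat \<Rightarrow> nat \<Rightarrow> 'k mpoly"
    where F: "free_resolution n (monomial_span n ((\<lambda>a. a - m) ` A)) RF EF DF"
      and EF: "\<And>i k. k < RF (Suc i) \<Longrightarrow> EF (Suc i) k = 1 + int i"
    using F unfolding linear_resolution_def by (metis of_nat_1)
  have EF': "EF i k = int i" if "k < RF i" for i k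
    using that EF free_resolution.rank_0[OF F] free_resolution.degree_0[OF F] by (cases i) auto
  obtain RC EC and DC :: "nat \<Rightarrow> nat \<Rightarrow> nat \<Rightarrow> 'k mpoly" where
    C: "free_resolution n (monomial_span n (insert m A)) RC EC DC"
    and RC: "\<And>i. RC (Suc i) = RG (Suc i) + RF i"
    and EC1: "\<And>i k. k < RG (Suc i) \<Longrightarrow> EC (Suc i) k = EG (Suc i) k"
    and EC2: "\<And>i k. EC (Suc i) (RG (Suc i) + k) = EF i k + int (pp_degree m)"
    by (rule mapping_cone[OF G F m(1)], rule that)
  have "EC (Suc i) k = int d + int i" if k: "k < RC (Suc i)" for i k
  proof (cases "k < RG (Suc i)")
    case False
    hence "k - RG (Suc i) < RF i" using k RC by simp
    from EF'[OF this] show ?thesis using EC2[of i "k - RG (Suc i)"] False m(2) by simp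
  qed (simp add: EC1 EG)
  thus ?thesis unfolding linear_resolution_def using C by blast
qed

lemma linear_resolution_empty: "linear_resolution n (monomial_span n {} :: 'k::field mpoly set) d"
  unfolding linear_resolution_def
  by (intro exI conjI, rule free_resolution_zero) auto

text \<open>
  Dividing an ideal of variables by a further variable does not change it, so \<open>linear_resolution_insert\<close>
  can be iterated.
\<close>

lemma linear_resolution_variables:
  assumes "finite X" "X \<subseteq> {1..n}"
  shows "linear_resolution n (monomial_span n ((\<lambda>x. Poly_Mapping.single x 1) ` X) :: 'k::field mpoly set) 1"
  using assms
proof (induction X)
  case empty
  show ?case using linear_resolution_empty by simp
next
  case (insert x X)
  have "Poly_Mapping.single y 1 - Poly_Mapping.single x 1 = (Poly_Mapping.single y 1 :: nat \<Rightarrow>\<^sub>0 nat)"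
    if "y \<in> X" for y
    using that insert by (intro poly_mapping_eqI) (auto simp: lookup_minus lookup_single when_def)
  hence "(\<lambda>a. a - Poly_Mapping.single x 1) ` (\<lambda>x. Poly_Mapping.single x 1) ` X =
      (\<lambda>x. Poly_Mapping.single x (1::nat)) ` X"
    by (force simp: image_image)
  thus ?case
    using insert linear_resolution_insert[of n "(\<lambda>x. Poly_Mapping.single x 1) ` X" 1 "Poly_Mapping.single x 1"]
    by simp
qed

text \<open>
  The last hypothesis says that the ideal of the predecessors of \<open>s\<close>, divided by \<open>f s\<close>, is
  generated by variables; so the generators can be added in increasing order.
\<close>

lemma linear_quotients:
  fixes f :: "'b \<Rightarrow> (nat \<Rightarrow>\<^sub>0 nat)"
  assumes "finite T" "asymp_on T prec" "transp_on T prec" "totalp_on T prec"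
    and "\<And>s. s \<in> T \<Longrightarrow> keys (f s) \<subseteq> {1..n}" "\<And>s. s \<in> T \<Longrightarrow> pp_degree (f s) = d"
    and "\<And>r s. r \<in> T \<Longrightarrow> s \<in> T \<Longrightarrow> prec r s \<Longrightarrow>
      \<exists>q\<in>T. prec q s \<and> (\<exists>x. f q - f s = Poly_Mapping.single x 1 \<and> x \<in> keys (f r - f s))"
  shows "linear_resolution n (monomial_span n (f ` T) :: 'k::field mpoly set) d"
  using assms
proof (induction "card T" arbitrary: T)
  case 0
  thus ?case using linear_resolution_empty by simp
next
  case (Suc k)
  hence "T \<noteq> {}" by auto
  then obtain m where m: "m \<in> T" "\<And>s. s \<in> T \<Longrightarrow> s \<noteq> m \<Longrightarrow> \<not> prec m s"
    using Finite_Set.bex_max_element[OF Suc.prems(1-3)] by blast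
  define T' where "T' = T - {m}"
  have less: "prec s m" if "s \<in> T'" for s
    using that m Suc.prems(4) unfolding T'_def totalp_on_def by blast
  have sub: "T' \<subseteq> T" by (auto simp: T'_def)
  have "linear_resolution n (monomial_span n (f ` T') :: 'k mpoly set) d"
  proof (rule Suc.hyps(1))
    show "k = card T'" using Suc.hyps(2) Suc.prems(1) m(1) by (simp add: T'_def)
    show "finite T'" "asymp_on T' prec" "transp_on T' prec" "totalp_on T' prec"
      by (rule finite_subset[OF sub Suc.prems(1)] asymp_on_subset[OF Suc.prems(2) sub]
        transp_on_subset[OF Suc.prems(3) sub] totalp_on_subset[OF Suc.prems(4) sub])+
    fix r s assume rs: "r \<in> T'" "s \<in> T'" "prec r s"
    then obtain q where q: "q \<in> T" "prec q s"
      "\<exists>x. f q - f s = Poly_Mapping.single x 1 \<and> x \<in> keys (f r - f s)"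
      using Suc.prems(7)[of r s] sub by blast
    moreover have "q \<noteq> m" using q(2) m(2)[of s] rs(2) by (auto simp: T'_def)
    ultimately show "\<exists>q\<in>T'. prec q s \<and> (\<exists>x. f q - f s = Poly_Mapping.single x 1 \<and> x \<in> keys (f r - f s))"
      by (auto simp: T'_def)
  qed (use Suc.prems(5,6) sub in auto)
  moreover have "linear_resolution n (monomial_span n ((\<lambda>a. a - f m) ` f ` T') :: 'k mpoly set) 1"
  proof -
    define X where "X = {x. \<exists>q\<in>T'. f q - f m = Poly_Mapping.single x 1}"
    have "x \<in> {1..n}" if xX: "x \<in> X" for x
    proof -
      obtain q where q: "q \<in> T'" "f q - f m = Poly_Mapping.single x 1" using xX by (auto simp: X_def)
      have "x \<in> keys (f q - f m)" by (simp add: q)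
      thus ?thesis using Suc.prems(5)[of q] keys_pp_minus[of "f q" "f m"] q(1) sub by blast
    qed
    hence X: "X \<subseteq> {1..n}" by blast
    have "monomial_span n ((\<lambda>a. a - f m) ` f ` T') =
        (monomial_span n ((\<lambda>x. Poly_Mapping.single x 1) ` X) :: 'k mpoly set)"
    proof (rule equalityI; rule monomial_span_mono)
      fix a assume "a \<in> (\<lambda>a. a - f m) ` f ` T'"
      then obtain r where r: "r \<in> T'" "a = f r - f m" by blast
      obtain q x where q: "q \<in> T" "prec q m" "f q - f m = Poly_Mapping.single x 1" "x \<in> keys a"
        using Suc.prems(7)[of r m] r less m(1) sub by blast
      have "q \<noteq> m" using q(3) by (auto simp: single_zero dest: arg_cong[of _ _ keys])
      hence "x \<in> X" using q by (auto simp: X_def T'_def)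
      moreover have "pp_dvd (Poly_Mapping.single x 1) a"
        using q(4) by (auto simp: pp_dvd_iff lookup_single when_def in_keys_iff)
      ultimately show "\<exists>b\<in>(\<lambda>x. Poly_Mapping.single x 1) ` X. pp_dvd b a" by blast
    next
      fix a assume "a \<in> (\<lambda>x. Poly_Mapping.single x (1::nat)) ` X"
      then obtain q where "q \<in> T'" "f q - f m = a" by (auto simp: X_def)
      thus "\<exists>b\<in>(\<lambda>a. a - f m) ` f ` T'. pp_dvd b a" by force
    qed
    thus ?thesis using linear_resolution_variables[OF finite_subset[OF X] X] by simp
  qed
  ultimately have "linear_resolution n (monomial_span n (insert (f m) (f ` T')) :: 'k mpoly set) d"
    using linear_resolution_insert Suc.prems(5,6) m(1) by blast
  moreover have "insert (f m) (f ` T') = f ` T" using m(1) by (auto simp: T'_def)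
  ultimately show ?case by simp
qed

section \<open>Betti numbers\<close>

abbreviation const_mat :: "(nat \<Rightarrow> nat \<Rightarrow> 'k::field mpoly) \<Rightarrow> nat \<Rightarrow> nat \<Rightarrow> 'k" where
  "const_mat A \<equiv> (\<lambda>l k. lookup (A l k) 0)"

lemma const_mat_mult: "const_mat (mat_mult r A B) = mat_mult r (const_mat A) (const_mat B)"
  by (simp add: mat_mult_def lookup_sum lookup_times_0)

lemma const_mat_vec: "lookup (mat_vec r A x l) 0 = mat_vec r (const_mat A) (\<lambda>k. lookup (x k) 0) l"
  by (simp add: mat_vec_def lookup_sum lookup_times_0)

definition strand :: "nat \<Rightarrow> (nat \<Rightarrow> int) \<Rightarrow> int \<Rightarrow> (nat \<Rightarrow> 'k::field) \<Rightarrow> bool" where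
  "strand r e j x \<longleftrightarrow> (\<forall>k. x k \<noteq> 0 \<longrightarrow> k < r \<and> e k = j)"

lemma strand_diff: "strand r e j x \<Longrightarrow> strand r e j y \<Longrightarrow> strand r e j (\<lambda>k. x k - y k)"
  unfolding strand_def by (metis diff_zero)

lemma strand_image:
  fixes A :: "nat \<Rightarrow> nat \<Rightarrow> 'k::field mpoly"
  assumes "graded_matrix n s b r a A" "strand r a j x"
  shows "strand s b j (\<lambda>l. if l < s then mat_vec r (const_mat A) x l else 0)"
  unfolding strand_def
proof (intro allI impI)
  fix l assume "(if l < s then mat_vec r (const_mat A) x l else 0) \<noteq> 0"
  hence l: "l < s" and "mat_vec r (const_mat A) x l \<noteq> 0" by (auto split: if_splits)
  then obtain k where "k < r" "lookup (A l k) 0 * x k \<noteq> 0"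
    unfolding mat_vec_def by (metis (no_types, lifting) lessThan_iff sum.neutral)
  thus "l < s \<and> b l = j"
    using l assms(2) graded_matrix_const[OF assms(1) l, of k] by (auto simp: strand_def)
qed

text \<open>
  $\mathrm{Tor}_i(I,K)_j = 0$, computed from the given resolution; indices are shifted by one, as
  $M_{i+1} = F_i$. For $i = 0$ there is no condition on \<open>x\<close>, since the augmentation is dropped
  before tensoring.
\<close>

definition tor_vanishes ::
  "(nat \<Rightarrow> nat) \<Rightarrow> (nat \<Rightarrow> nat \<Rightarrow> int) \<Rightarrow> (nat \<Rightarrow> nat \<Rightarrow> nat \<Rightarrow> 'k::field mpoly) \<Rightarrow> nat \<Rightarrow> int \<Rightarrow> bool"
where
  "tor_vanishes R E D i j \<longleftrightarrow>
    (\<forall>x. strand (R (Suc i)) (E (Suc i)) j x \<longrightarrow>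
      (i > 0 \<longrightarrow> (\<forall>l<R i. mat_vec (R (Suc i)) (const_mat (D i)) x l = 0)) \<longrightarrow>
      (\<exists>y. strand (R (Suc (Suc i))) (E (Suc (Suc i))) j y \<and>
        (\<forall>l<R (Suc i). x l = mat_vec (R (Suc (Suc i))) (const_mat (D (Suc i))) y l)))"

text \<open>
  Let \<open>\<psi>\<close> and \<open>\<phi>\<close> be comparison maps in both directions and \<open>h\<close> a homotopy between
  \<open>\<phi>\<psi>\<close> and the identity. All three survive reduction modulo the variables. A cycle \<open>z\<close> of one
  complex goes to a cycle of the other; if that is the boundary of \<open>y\<close>, then \<open>z\<close> is the boundary
  of $\phi y - h z$.
\<close>

lemma tor_vanishes_transfer:
  assumes F: "free_resolution n (I :: 'k::field mpoly set) RF EF DF" and G: "free_resolution n I RG EG DG"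
    and vF: "tor_vanishes RF EF DF i j"
  shows "tor_vanishes RG EG DG i j"
proof -
  interpret F: free_resolution n I RF EF DF by (rule F)
  interpret G: free_resolution n I RG EG DG by (rule G)
  obtain \<psi> where \<psi>0: "\<psi> 0 0 0 = 1"
    and \<psi>gr': "\<And>i. graded_matrix n (RF i) (EF i) (RG i) (\<lambda>k. EG i k + 0) (\<psi> i)"
    and \<psi>: "\<And>i l k. l < RF i \<Longrightarrow> k < RG (Suc i) \<Longrightarrow>
      mat_mult (RG i) (\<psi> i) (DG i) l k = mat_mult (RF (Suc i)) (DF i) (\<psi> (Suc i)) l k"
    by (rule comparison_map[OF G F, of 1 0]) auto
  obtain \<phi> where \<phi>0: "\<phi> 0 0 0 = 1"
    and \<phi>gr': "\<And>i. graded_matrix n (RG i) (EG i) (RF i) (\<lambda>k. EF i k + 0) (\<phi> i)"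
    and \<phi>: "\<And>i l k. l < RG i \<Longrightarrow> k < RF (Suc i) \<Longrightarrow>
      mat_mult (RF i) (\<phi> i) (DF i) l k = mat_mult (RG (Suc i)) (DG i) (\<phi> (Suc i)) l k"
    by (rule comparison_map[OF F G, of 1 0]) auto
  have \<psi>gr: "graded_matrix n (RF i) (EF i) (RG i) (EG i) (\<psi> i)" for i using \<psi>gr'[of i] by simp
  have \<phi>gr: "graded_matrix n (RG i) (EG i) (RF i) (EF i) (\<phi> i)" for i using \<phi>gr'[of i] by simp
  define \<chi> where "\<chi> i = mat_mult (RF i) (\<phi> i) (\<psi> i)" for i
  obtain h where hgr: "\<And>i. graded_matrix n (RG (Suc i)) (EG (Suc i)) (RG i) (EG i) (h i)"
    and h0: "h 0 = (\<lambda>_ _. 0)"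
    and h: "\<And>i l k. l < RG (Suc i) \<Longrightarrow> k < RG (Suc i) \<Longrightarrow>
      \<chi> (Suc i) l k - (if l = k then 1 else 0) =
        mat_mult (RG (Suc (Suc i))) (DG (Suc i)) (h (Suc i)) l k + mat_mult (RG i) (h i) (DG i) l k"
  proof (rule G.homotopy)
    show "graded_matrix n (RG i) (EG i) (RG i) (EG i) (\<chi> i)" for i
      unfolding \<chi>_def by (rule graded_matrix_mult[OF \<phi>gr \<psi>gr])
    show "\<chi> 0 0 0 = 1" by (simp add: \<chi>_def mat_mult_def F.rank_0 \<phi>0 \<psi>0)
    fix i l k assume l: "l < RG i" and k: "k < RG (Suc i)"
    have "mat_mult (RG i) (\<chi> i) (DG i) l k = mat_vec (RF i) (\<phi> i) (\<lambda>l. mat_mult (RG i) (\<psi> i) (DG i) l k) l"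
      by (simp add: \<chi>_def mat_mult_column mat_vec_assoc mat_mult_eq)
    also have "\<dots> = mat_vec (RF i) (\<phi> i) (\<lambda>l. mat_mult (RF (Suc i)) (DF i) (\<psi> (Suc i)) l k) l"
      by (rule mat_vec_cong) (use \<psi> k in auto)
    also have "\<dots> = mat_vec (RF (Suc i)) (mat_mult (RF i) (\<phi> i) (DF i)) (\<lambda>l. \<psi> (Suc i) l k) l"
      by (simp add: mat_mult_column mat_vec_assoc)
    also have "\<dots> = mat_vec (RF (Suc i)) (mat_mult (RG (Suc i)) (DG i) (\<phi> (Suc i))) (\<lambda>l. \<psi> (Suc i) l k) l"
      by (rule mat_vec_cong) (use \<phi> l in auto)
    also have "\<dots> = mat_mult (RG (Suc i)) (DG i) (\<chi> (Suc i)) l k"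
      by (simp add: \<chi>_def mat_mult_column mat_vec_assoc mat_mult_eq)
    finally show "mat_mult (RG i) (\<chi> i) (DG i) l k = mat_mult (RG (Suc i)) (DG i) (\<chi> (Suc i)) l k" .
  qed (rule that)
  let ?c = const_mat
  show ?thesis
    unfolding tor_vanishes_def
  proof (intro allI impI)
    fix z :: "nat \<Rightarrow> 'k"
    assume z: "strand (RG (Suc i)) (EG (Suc i)) j z"
      and zc: "i > 0 \<longrightarrow> (\<forall>l<RG i. mat_vec (RG (Suc i)) (?c (DG i)) z l = 0)"
    define x where "x = (\<lambda>l. if l < RF (Suc i) then mat_vec (RG (Suc i)) (?c (\<psi> (Suc i))) z l else 0)"
    have xs: "strand (RF (Suc i)) (EF (Suc i)) j x"
      unfolding x_def by (rule strand_image[OF \<psi>gr z])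
    have xc: "mat_vec (RF (Suc i)) (?c (DF i)) x l = 0" if i: "i > 0" and l: "l < RF i" for l
    proof -
      have "mat_vec (RF (Suc i)) (?c (DF i)) x l =
          mat_vec (RF (Suc i)) (?c (DF i)) (mat_vec (RG (Suc i)) (?c (\<psi> (Suc i))) z) l"
        by (rule mat_vec_cong) (auto simp: x_def)
      also have "\<dots> = mat_vec (RG (Suc i)) (?c (mat_mult (RG i) (\<psi> i) (DG i))) z l"
        unfolding mat_vec_assoc const_mat_mult[symmetric] by (rule mat_vec_cong) (use \<psi> l in auto)
      also have "\<dots> = mat_vec (RG i) (?c (\<psi> i)) (mat_vec (RG (Suc i)) (?c (DG i)) z) l"
        by (simp add: mat_vec_assoc const_mat_mult)
      also have "\<dots> = mat_vec (RG i) (?c (\<psi> i)) (\<lambda>l. 0) l"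
        by (rule mat_vec_cong) (use zc i in auto)
      finally show ?thesis by simp
    qed
    obtain y where ys: "strand (RF (Suc (Suc i))) (EF (Suc (Suc i))) j y"
      and y: "\<And>l. l < RF (Suc i) \<Longrightarrow> x l = mat_vec (RF (Suc (Suc i))) (?c (DF (Suc i))) y l"
      using vF xs xc unfolding tor_vanishes_def by blast
    define w where "w = (\<lambda>l. (if l < RG (Suc (Suc i)) then mat_vec (RF (Suc (Suc i))) (?c (\<phi> (Suc (Suc i)))) y l else 0)
      - (if l < RG (Suc (Suc i)) then mat_vec (RG (Suc i)) (?c (h (Suc i))) z l else 0))"
    have "strand (RG (Suc (Suc i))) (EG (Suc (Suc i))) j w"
      unfolding w_def by (intro strand_diff strand_image[OF \<phi>gr ys] strand_image[OF hgr z])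
    moreover have "z l = mat_vec (RG (Suc (Suc i))) (?c (DG (Suc i))) w l" if l: "l < RG (Suc i)" for l
    proof -
      have 1: "mat_vec (RG (Suc i)) (?c (\<chi> (Suc i))) z l =
          mat_vec (RG (Suc (Suc i))) (?c (DG (Suc i))) (mat_vec (RF (Suc (Suc i))) (?c (\<phi> (Suc (Suc i)))) y) l"
      proof -
        have "mat_vec (RG (Suc i)) (?c (\<chi> (Suc i))) z l = mat_vec (RF (Suc i)) (?c (\<phi> (Suc i))) x l"
          unfolding \<chi>_def const_mat_mult mat_vec_assoc[symmetric]
          by (rule mat_vec_cong) (auto simp: x_def)
        also have "\<dots> = mat_vec (RF (Suc i)) (?c (\<phi> (Suc i))) (mat_vec (RF (Suc (Suc i))) (?c (DF (Suc i))) y) l"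
          by (rule mat_vec_cong) (auto simp: y)
        also have "\<dots> = mat_vec (RF (Suc (Suc i))) (?c (mat_mult (RG (Suc (Suc i))) (DG (Suc i)) (\<phi> (Suc (Suc i))))) y l"
          unfolding mat_vec_assoc const_mat_mult[symmetric]
          by (rule mat_vec_cong) (use \<phi>[OF l] in auto)
        finally show ?thesis by (simp add: mat_vec_assoc const_mat_mult)
      qed
      have 2: "mat_vec (RG i) (?c (h i)) (mat_vec (RG (Suc i)) (?c (DG i)) z) l = 0"
      proof (cases "i = 0")
        case True
        thus ?thesis by (simp add: h0 mat_vec_def)
      next
        case False
        hence "mat_vec (RG i) (?c (h i)) (mat_vec (RG (Suc i)) (?c (DG i)) z) l =
            mat_vec (RG i) (?c (h i)) (\<lambda>l. 0) l"
          by (intro mat_vec_cong) (use zc in auto)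
        thus ?thesis by simp
      qed
      have "mat_vec (RG (Suc i)) (?c (\<chi> (Suc i))) z l - z l =
          mat_vec (RG (Suc i)) (\<lambda>l k. ?c (\<chi> (Suc i)) l k - (if l = k then 1 else 0)) z l"
        by (simp add: mat_vec_minus_left mat_vec_unit l)
      also have "\<dots> = mat_vec (RG (Suc i)) (\<lambda>l k. ?c (mat_mult (RG (Suc (Suc i))) (DG (Suc i)) (h (Suc i))) l k
          - (- ?c (mat_mult (RG i) (h i) (DG i)) l k)) z l"
      proof (rule mat_vec_cong)
        fix k assume k: "k < RG (Suc i)"
        from arg_cong[OF h[OF l k], of "\<lambda>p. lookup p 0"]
        show "lookup (\<chi> (Suc i) l k) 0 - (if l = k then 1 else 0) =
            lookup (mat_mult (RG (Suc (Suc i))) (DG (Suc i)) (h (Suc i)) l k) 0 -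
            (- lookup (mat_mult (RG i) (h i) (DG i) l k) 0)"
          by (simp add: lookup_minus lookup_add split: if_splits)
      qed simp
      also have "\<dots> = mat_vec (RG (Suc (Suc i))) (?c (DG (Suc i))) (mat_vec (RG (Suc i)) (?c (h (Suc i))) z) l
          + mat_vec (RG i) (?c (h i)) (mat_vec (RG (Suc i)) (?c (DG i)) z) l"
        unfolding mat_vec_assoc const_mat_mult[symmetric]
        by (simp add: mat_vec_def sum.distrib algebra_simps)
      finally have "z l = mat_vec (RG (Suc i)) (?c (\<chi> (Suc i))) z l -
          mat_vec (RG (Suc (Suc i))) (?c (DG (Suc i))) (mat_vec (RG (Suc i)) (?c (h (Suc i))) z) l"
        using 2 by (simp add: algebra_simps)
      also have "\<dots> = mat_vec (RG (Suc (Suc i))) (?c (DG (Suc i))) w l"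
        unfolding 1 mat_vec_diff[symmetric] by (rule mat_vec_cong) (auto simp: w_def)
      finally show ?thesis .
    qed
    ultimately show "\<exists>y. strand (RG (Suc (Suc i))) (EG (Suc (Suc i))) j y \<and>
        (\<forall>l<RG (Suc i). z l = mat_vec (RG (Suc (Suc i))) (?c (DG (Suc i))) y l)"
      by blast
  qed
qed

subsection \<open>Passage to records and dimensions\<close>

text \<open>
  The complex of a record, in the form used above: the augmentation becomes $D_0$.
\<close>

definition res_rank :: "'k::field free_complex \<Rightarrow> nat \<Rightarrow> nat" where
  "res_rank F i = (case i of 0 \<Rightarrow> 1 | Suc j \<Rightarrow> rnk F j)"

definition res_degree :: "'k::field free_complex \<Rightarrow> nat \<Rightarrow> nat \<Rightarrow> int" where
  "res_degree F i k = (case i of 0 \<Rightarrow> 0 | Suc j \<Rightarrow> dgr F j k)"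

definition res_diff :: "'k::field free_complex \<Rightarrow> nat \<Rightarrow> nat \<Rightarrow> nat \<Rightarrow> 'k mpoly" where
  "res_diff F i l k = (case i of 0 \<Rightarrow> aug F k | Suc j \<Rightarrow> dif F j l k)"

lemma res_simps [simp]:
  "res_rank F 0 = 1" "res_rank F (Suc i) = rnk F i"
  "res_degree F 0 k = 0" "res_degree F (Suc i) = dgr F i"
  "res_diff F 0 l k = aug F k" "res_diff F (Suc i) = dif F i"
  by (auto simp: res_rank_def res_degree_def res_diff_def fun_eq_iff)

lemma mat_apply_eq: "mat_apply r s A x = (\<lambda>l. if l < s then mat_vec r A x l else 0)"
  unfolding mat_apply_def mat_vec_def ..

lemma mat_apply_eq_0_iff: "mat_apply r s A x = 0 \<longleftrightarrow> (\<forall>l<s. mat_vec r A x l = 0)"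
  by (auto simp: mat_apply_eq fun_eq_iff)

lemma free_resolution_of_record:
  assumes "graded_free_resolution n (I :: 'k::field mpoly set) F"
  shows "free_resolution n I (res_rank F) (res_degree F) (res_diff F)"
proof -
  note F = assms[unfolded graded_free_resolution_def]
  have aug: "\<forall>k<rnk F 0. aug F k \<in> polys n \<and> homogeneous_of_degree (dgr F 0 k) (aug F k)"
    and dif: "\<And>i. \<forall>l<rnk F i. \<forall>k<rnk F (Suc i). dif F i l k \<in> polys n \<and>
       homogeneous_of_degree (dgr F (Suc i) k - dgr F i l) (dif F i l k)"
    and img: "aug_map F ` free_module n (rnk F 0) = I"
    and ker0: "{x \<in> free_module n (rnk F 0). aug_map F x = 0} = dif_map F 0 ` free_module n (rnk F 1)"
    and ker: "\<And>i. {x \<in> free_module n (rnk F (Suc i)). dif_map F i x = 0} =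
       dif_map F (Suc i) ` free_module n (rnk F (Suc (Suc i)))"
    using F by auto
  have augv: "aug_map F x = mat_vec (rnk F 0) (res_diff F 0) x l" for x l
    by (simp add: mat_vec_def)
  define trunc where "trunc r x = (\<lambda>k. if k < r then x k else 0)" for r and x :: "nat \<Rightarrow> 'k mpoly"
  have trunc: "trunc r x \<in> free_module n r" if "\<And>k. k < r \<Longrightarrow> x k \<in> polys n" for r x
    using that by (simp add: trunc_def free_module_def)
  have vec_trunc: "mat_vec r A (trunc r x) l = mat_vec r A x l" for r A x l
    by (rule mat_vec_cong) (auto simp: trunc_def)
  define unit where "unit k = (\<lambda>j. if j = k then 1 else 0 :: 'k mpoly)" for k :: nat
  have unit: "unit k \<in> free_module n r" if "k < r" for k r
    using that by (auto simp: unit_def free_module_def)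
  have vec_unit: "mat_vec r A (unit k) l = A l k" if "k < r" for r A k l
    using that by (simp add: mat_vec_def unit_def if_distrib[of "\<lambda>c. _ * c"] sum.delta cong: if_cong)
  have cyc: "cycle I (res_rank F) (res_diff F) i x \<longleftrightarrow>
      trunc (res_rank F i) x \<in> (\<lambda>y. (\<lambda>l. if l < res_rank F i then mat_vec (res_rank F (Suc i)) (res_diff F i) y l else 0))
        ` free_module n (res_rank F (Suc i))" if x: "\<And>l. l < res_rank F i \<Longrightarrow> x l \<in> polys n" for i x
  proof (cases i)
    case 0
    have "x 0 \<in> I \<longleftrightarrow> (\<exists>y\<in>free_module n (rnk F 0). x 0 = mat_vec (rnk F 0) (res_diff F 0) y 0)"
      unfolding img[symmetric] augv[of _ 0] by blast
    thus ?thesis unfolding 0 cycle_0 by (auto simp: image_iff trunc_def fun_eq_iff)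
  next
    case (Suc j)
    show ?thesis
    proof (cases j)
      case 0
      have "cycle I (res_rank F) (res_diff F) i x \<longleftrightarrow>
          trunc (rnk F 0) x \<in> {x \<in> free_module n (rnk F 0). aug_map F x = 0}"
        using x Suc 0 trunc[of "rnk F 0" x] unfolding augv[of _ 0]
        by (simp add: cycle_Suc vec_trunc)
      thus ?thesis unfolding ker0 unfolding mat_apply_eq Suc 0 by (simp cong: if_cong)
    next
      case (Suc j')
      have "cycle I (res_rank F) (res_diff F) i x \<longleftrightarrow>
          trunc (rnk F j) x \<in> {x \<in> free_module n (rnk F (Suc j')). dif_map F j' x = 0}"
        using x \<open>i = Suc j\<close> Suc trunc[of "rnk F j" x] by (simp add: cycle_Suc mat_apply_eq_0_iff vec_trunc)
      thus ?thesis unfolding ker unfolding mat_apply_eq \<open>i = Suc j\<close> Suc by (simp cong: if_cong)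
    qed
  qed
  have gr: "graded_matrix n (res_rank F i) (res_degree F i) (res_rank F (Suc i)) (res_degree F (Suc i)) (res_diff F i)" for i
    using aug dif by (cases i) (auto simp: graded_matrix_def)
  show ?thesis
  proof
    show "cycle I (res_rank F) (res_diff F) i (\<lambda>l. res_diff F i l k)" if k: "k < res_rank F (Suc i)" for i k
    proof (subst cyc)
      show "res_diff F i l k \<in> polys n" if "l < res_rank F i" for l
        using graded_matrixD(1)[OF gr that k] .
      show "trunc (res_rank F i) (\<lambda>l. res_diff F i l k) \<in> (\<lambda>y. (\<lambda>l. if l < res_rank F i then mat_vec (res_rank F (Suc i)) (res_diff F i) y l else 0))
        ` free_module n (res_rank F (Suc i))"
        unfolding trunc_def by (rule image_eqI[OF _ unit[OF k]]) (simp only: vec_unit[OF k])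
    qed
    fix i and x :: "nat \<Rightarrow> 'k mpoly"
    assume x: "\<And>l. l < res_rank F i \<Longrightarrow> x l \<in> polys n" and c: "cycle I (res_rank F) (res_diff F) i x"
    obtain y where y: "y \<in> free_module n (res_rank F (Suc i))"
      "trunc (res_rank F i) x = (\<lambda>l. if l < res_rank F i then mat_vec (res_rank F (Suc i)) (res_diff F i) y l else 0)"
      using c cyc[of i x, OF x] by blast
    have "x l = mat_vec (res_rank F (Suc i)) (res_diff F i) y l" if "l < res_rank F i" for l
      using fun_cong[OF y(2), of l] that by (simp add: trunc_def)
    thus "\<exists>y. (\<forall>k<res_rank F (Suc i). y k \<in> polys n) \<and>
        (\<forall>l<res_rank F i. x l = mat_vec (res_rank F (Suc i)) (res_diff F i) y l)"
      using y(1) by (auto simp: free_module_def)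
  qed (use gr in auto)
qed

lemma record_of_free_resolution:
  fixes R E D
  assumes F: "free_resolution n (monomial_span n A :: 'k::field mpoly set) R E D"
  shows "graded_free_resolution n (monomial_span n A :: 'k mpoly set)
    \<lparr>rnk = \<lambda>i. R (Suc i), dgr = \<lambda>i. E (Suc i), aug = D 0 0, dif = \<lambda>i. D (Suc i)\<rparr>"
proof -
  interpret free_resolution n "monomial_span n A :: 'k mpoly set" R E D by (rule F)
  let ?I = "monomial_span n A :: 'k mpoly set"
  have aug: "(\<Sum>k<R (Suc 0). D 0 0 k * x k) = mat_vec (R (Suc 0)) (D 0) x 0" for x
    by (simp add: mat_vec_def)
  have img: "(\<lambda>x. mat_vec (R (Suc 0)) (D 0) x 0) ` free_module n (R (Suc 0)) = ?I"
  proof (intro equalityI subsetI)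
    fix p assume "p \<in> (\<lambda>x. mat_vec (R (Suc 0)) (D 0) x 0) ` free_module n (R (Suc 0))"
    then obtain x where x: "x \<in> free_module n (R (Suc 0))" "p = mat_vec (R (Suc 0)) (D 0) x 0" by blast
    thus "p \<in> ?I"
      using columns[of _ 0] unfolding mat_vec_def
      by (auto simp: cycle_0 free_module_def intro!: monomial_span_sum monomial_span_times)
  next
    fix p assume p: "p \<in> ?I"
    then obtain y where y: "\<forall>k<R (Suc 0). y k \<in> polys n" "p = mat_vec (R (Suc 0)) (D 0) y 0"
      using exact[of 0 "\<lambda>_. p"] by (auto simp: cycle_0 rank_0 monomial_span_def)
    have "p = mat_vec (R (Suc 0)) (D 0) (\<lambda>k. if k < R (Suc 0) then y k else 0) 0"
      unfolding y(2) by (rule mat_vec_cong) auto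
    moreover have "(\<lambda>k. if k < R (Suc 0) then y k else 0) \<in> free_module n (R (Suc 0))"
      using y(1) by (simp add: free_module_def)
    ultimately show "p \<in> (\<lambda>x. mat_vec (R (Suc 0)) (D 0) x 0) ` free_module n (R (Suc 0))" by blast
  qed
  have ker: "{x \<in> free_module n (R (Suc i)). \<forall>l<R i. mat_vec (R (Suc i)) (D i) x l = 0} =
      (\<lambda>x l. if l < R (Suc i) then mat_vec (R (Suc (Suc i))) (D (Suc i)) x l else 0) `
        free_module n (R (Suc (Suc i)))" (is "?L = ?f ` _") for i
  proof (intro equalityI subsetI)
    fix x assume x: "x \<in> ?L"
    hence "cycle ?I R D (Suc i) x" by (simp add: cycle_Suc)
    then obtain y where y: "\<forall>k<R (Suc (Suc i)). y k \<in> polys n"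
      "\<forall>l<R (Suc i). x l = mat_vec (R (Suc (Suc i))) (D (Suc i)) y l"
      using exact[of "Suc i" x] x by (auto simp: free_module_def)
    let ?y = "\<lambda>k. if k < R (Suc (Suc i)) then y k else 0"
    have eq: "mat_vec (R (Suc (Suc i))) (D (Suc i)) ?y l = mat_vec (R (Suc (Suc i))) (D (Suc i)) y l" for l
      by (rule mat_vec_cong) auto
    have "x = ?f ?y"
    proof
      fix l show "x l = ?f ?y l"
        using x y(2) unfolding eq by (simp add: free_module_def)
    qed
    moreover have "?y \<in> free_module n (R (Suc (Suc i)))"
      using y(1) by (simp add: free_module_def)
    ultimately show "x \<in> ?f ` free_module n (R (Suc (Suc i)))" by blast
  next
    fix x assume "x \<in> ?f ` free_module n (R (Suc (Suc i)))"
    then obtain y where y: "y \<in> free_module n (R (Suc (Suc i)))" "x = ?f y" by blast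
    have "mat_vec (R (Suc i)) (D i) x l = 0" if "l < R i" for l
    proof -
      have "mat_vec (R (Suc i)) (D i) x l = mat_vec (R (Suc i)) (D i) (mat_vec (R (Suc (Suc i))) (D (Suc i)) y) l"
        unfolding y(2) by (rule mat_vec_cong) auto
      thus ?thesis using complex_vec[OF that] by simp
    qed
    moreover have "mat_vec (R (Suc (Suc i))) (D (Suc i)) y l \<in> polys n" if "l < R (Suc i)" for l
      using y(1) graded_matrixD(1)[OF graded that] by (intro mat_vec_polys) (auto simp: free_module_def)
    ultimately show "x \<in> ?L" using y(2) by (simp add: free_module_def)
  qed
  have gr: "D i l k \<in> polys n \<and> homogeneous_of_degree (E (Suc i) k - E i l) (D i l k)"
    if "l < R i" "k < R (Suc i)" for i l k
    using graded_matrixD[OF graded that] by blast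
  show ?thesis
    unfolding graded_free_resolution_def
  proof (intro conjI, goal_cases)
    case 1 thus ?case using gr[of 0 0] by (simp add: rank_0 degree_0)
  next
    case 2 thus ?case using gr by simp
  next
    case 3 thus ?case using img by (simp add: aug)
  next
    case 4 thus ?case using ker[of 0] by (simp add: aug rank_0 mat_apply_eq)
  next
    case 5 thus ?case using ker by (simp add: mat_apply_eq fun_eq_iff)
  qed
qed

interpretation K_vs: vector_space "\<lambda>(c::'k::field) (x::nat \<Rightarrow> 'k) k. c * x k"
  by (rule vector_space_K)

text \<open>
  The subtraction is truncated, so that only $\dim Z \<le> \dim B$ is known. But then no element of
  \<open>Z\<close> can extend a basis of \<open>B\<close> to a larger independent set.
\<close>

lemma K_dim_diff_eq_0_iff:
  fixes B Z :: "(nat \<Rightarrow> 'k::field) set"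
  assumes sub: "B \<subseteq> Z" and B: "K_vs.subspace B" and fin: "\<And>x k. x \<in> Z \<Longrightarrow> k \<ge> r \<Longrightarrow> x k = 0"
  shows "K_dim Z - K_dim B = 0 \<longleftrightarrow> Z \<subseteq> B"
proof
  assume "Z \<subseteq> B"
  hence "Z = B" using sub by blast
  thus "K_dim Z - K_dim B = 0" by simp
next
  assume dim: "K_dim Z - K_dim B = 0"
  define e where "e i = (\<lambda>k. if k = i then 1 else 0 :: 'k)" for i :: nat
  have Zspan: "Z \<subseteq> K_vs.span (e ` {..<r})"
  proof
    fix x assume x: "x \<in> Z"
    have "x = (\<Sum>i<r. (\<lambda>k. x i * e i k))"
    proof
      fix k
      have "(\<Sum>i<r. (\<lambda>k. x i * e i k)) k = (\<Sum>i<r. x i * e i k)"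
        by (induction r) simp_all
      also have "\<dots> = x k"
        using fin[OF x, of k] by (auto simp: e_def if_distrib[of "\<lambda>c. _ * c"] sum.delta' cong: if_cong)
      finally show "x k = (\<Sum>i<r. (\<lambda>k. x i * e i k)) k" ..
    qed
    moreover have "(\<Sum>i<r. (\<lambda>k. x i * e i k)) \<in> K_vs.span (e ` {..<r})"
      by (intro K_vs.span_sum K_vs.span_scale K_vs.span_base) auto
    ultimately show "x \<in> K_vs.span (e ` {..<r})" by simp
  qed
  obtain b where b: "b \<subseteq> B" "K_vs.independent b" "B \<subseteq> K_vs.span b" "card b = K_vs.dim B"
    using K_vs.basis_exists[of B] by blast
  obtain c where c: "c \<subseteq> Z" "K_vs.independent c" "Z \<subseteq> K_vs.span c" "card c = K_vs.dim Z"
    using K_vs.basis_exists[of Z] by blast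
  have finc: "finite c"
    using K_vs.independent_span_bound[of "e ` {..<r}" c] c Zspan by blast
  show "Z \<subseteq> B"
  proof (rule ccontr)
    assume "\<not> Z \<subseteq> B"
    then obtain z where z: "z \<in> Z" "z \<notin> B" by blast
    have "K_vs.span b \<subseteq> B" using b(1) B by (intro K_vs.span_minimal)
    hence zb: "z \<notin> K_vs.span b" using z by blast
    hence "K_vs.independent (insert z b)" using b(2) K_vs.independent_insertI by blast
    moreover have "insert z b \<subseteq> K_vs.span c" using b(1) sub c(3) z(1) by blast
    ultimately have "finite (insert z b) \<and> card (insert z b) \<le> card c"
      by (rule K_vs.independent_span_bound[OF finc])
    moreover have "z \<notin> b" using zb K_vs.span_base by blast
    ultimately have "K_vs.dim B < K_vs.dim Z" using b(4) c(4) by auto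
    thus False using dim by (simp add: K_dim_def)
  qed
qed

lemma tensor_homology_dim_eq_0_iff:
  assumes "graded_free_resolution n (I :: 'k::field mpoly set) F"
  shows "tensor_homology_dim F i j = 0 \<longleftrightarrow> tor_vanishes (res_rank F) (res_degree F) (res_diff F) i j"
proof -
  interpret free_resolution n I "res_rank F" "res_degree F" "res_diff F"
    by (rule free_resolution_of_record[OF assms])
  have strand: "x \<in> tensor_strand F i j \<longleftrightarrow> strand (rnk F i) (dgr F i) j x" for i x
    by (auto simp: tensor_strand_def strand_def)
  have cyc: "x \<in> tensor_cycles F i j \<longleftrightarrow> strand (rnk F i) (dgr F i) j x \<and>
      (i > 0 \<longrightarrow> (\<forall>l<res_rank F i. mat_vec (rnk F i) (const_mat (res_diff F i)) x l = 0))" for x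
    by (cases i) (auto simp: tensor_cycles_def strand mat_apply_eq_0_iff)
  let ?B = "\<lambda>y l. if l < rnk F i then mat_vec (rnk F (Suc i)) (const_mat (dif F i)) y l else 0"
  have bd: "tensor_boundaries F i j = ?B ` {y. strand (rnk F (Suc i)) (dgr F (Suc i)) j y}"
    using strand by (auto simp: tensor_boundaries_def mat_apply_eq)
  have sub: "tensor_boundaries F i j \<subseteq> tensor_cycles F i j"
  proof
    fix x assume "x \<in> tensor_boundaries F i j"
    then obtain y where y: "strand (rnk F (Suc i)) (dgr F (Suc i)) j y" "x = ?B y"
      unfolding bd by blast
    have gr: "graded_matrix n (rnk F i) (dgr F i) (rnk F (Suc i)) (dgr F (Suc i)) (dif F i)"
      using graded[of "Suc i"] unfolding graded_matrix_def by simp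
    have "mat_vec (rnk F i) (const_mat (res_diff F i)) x l = 0" if "l < res_rank F i" for l
    proof -
      have "mat_vec (rnk F i) (const_mat (res_diff F i)) x l =
          mat_vec (rnk F i) (const_mat (res_diff F i)) (mat_vec (rnk F (Suc i)) (const_mat (dif F i)) y) l"
        unfolding y(2) by (rule mat_vec_cong) auto
      also have "\<dots> = mat_vec (rnk F (Suc i)) (const_mat (mat_mult (rnk F i) (res_diff F i) (dif F i))) y l"
        by (simp add: mat_vec_assoc const_mat_mult)
      also have "\<dots> = mat_vec (rnk F (Suc i)) (\<lambda>l k. 0) y l"
        by (rule mat_vec_cong) (use complex[OF that] in auto)
      finally show ?thesis by (simp add: mat_vec_def)
    qed
    thus "x \<in> tensor_cycles F i j"
      using strand_image[OF gr y(1)] unfolding cyc y(2) by blast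
  qed
  have sp: "K_vs.subspace (tensor_boundaries F i j)"
    unfolding bd
  proof (rule K_vs.subspaceI; (elim imageE)?)
    show "0 \<in> ?B ` {y. strand (rnk F (Suc i)) (dgr F (Suc i)) j y}"
      by (rule image_eqI[of _ _ "\<lambda>_. 0"]) (auto simp: strand_def fun_eq_iff)
    fix x y and x' y' :: "nat \<Rightarrow> 'k"
    assume *: "x = ?B x'" "y = ?B y'" "x' \<in> {y. strand (rnk F (Suc i)) (dgr F (Suc i)) j y}"
      "y' \<in> {y. strand (rnk F (Suc i)) (dgr F (Suc i)) j y}"
    show "x + y \<in> ?B ` {y. strand (rnk F (Suc i)) (dgr F (Suc i)) j y}"
      by (rule image_eqI[of _ _ "\<lambda>k. x' k + y' k"])
         (use * in \<open>auto simp: strand_def fun_eq_iff mat_vec_add\<close>, (metis add_0)+)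
  next
    fix c x and x' :: "nat \<Rightarrow> 'k"
    assume *: "x = ?B x'" "x' \<in> {y. strand (rnk F (Suc i)) (dgr F (Suc i)) j y}"
    show "(\<lambda>k. c * x k) \<in> ?B ` {y. strand (rnk F (Suc i)) (dgr F (Suc i)) j y}"
      by (rule image_eqI[of _ _ "\<lambda>k. c * x' k"])
         (use * in \<open>auto simp: strand_def fun_eq_iff mat_vec_def sum_distrib_left algebra_simps\<close>)
  qed
  have "tensor_homology_dim F i j = 0 \<longleftrightarrow> tensor_cycles F i j \<subseteq> tensor_boundaries F i j"
    unfolding tensor_homology_dim_def
    by (rule K_dim_diff_eq_0_iff[OF sub sp, of "rnk F i"]) (auto simp: cyc strand_def)
  also have "\<dots> \<longleftrightarrow> tor_vanishes (res_rank F) (res_degree F) (res_diff F) i j"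
  proof -
    have bd': "x \<in> tensor_boundaries F i j \<longleftrightarrow> (\<exists>y. strand (rnk F (Suc i)) (dgr F (Suc i)) j y \<and>
        (\<forall>l<rnk F i. x l = mat_vec (rnk F (Suc i)) (const_mat (dif F i)) y l))"
      if xs: "strand (rnk F i) (dgr F i) j x" for x
    proof -
      have "x = ?B y \<longleftrightarrow> (\<forall>l<rnk F i. x l = mat_vec (rnk F (Suc i)) (const_mat (dif F i)) y l)" for y
        using xs unfolding strand_def fun_eq_iff by (metis less_irrefl)
      thus ?thesis unfolding bd by blast
    qed
    have "tensor_cycles F i j \<subseteq> tensor_boundaries F i j \<longleftrightarrow>
        (\<forall>x. strand (rnk F i) (dgr F i) j x \<longrightarrow>
          (i > 0 \<longrightarrow> (\<forall>l<res_rank F i. mat_vec (rnk F i) (const_mat (res_diff F i)) x l = 0)) \<longrightarrow>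
          x \<in> tensor_boundaries F i j)"
      unfolding subset_iff cyc by blast
    also have "\<dots> \<longleftrightarrow> tor_vanishes (res_rank F) (res_degree F) (res_diff F) i j"
      unfolding tor_vanishes_def by (intro iff_allI) (simp add: bd' cong: imp_cong)
    finally show ?thesis .
  qed
  finally show ?thesis .
qed

text \<open>
  Betti numbers refer to a chosen resolution. One can be chosen because there is the given one, and
  the vanishing of Tor is the same for both.
\<close>

lemma graded_betti_eq_0_iff:
  assumes "free_resolution n (monomial_span n A :: 'k::field mpoly set) R E D"
  shows "graded_betti n (monomial_span n A :: 'k mpoly set) i j = 0 \<longleftrightarrow> tor_vanishes R E D i j"
proof -
  let ?I = "monomial_span n A :: 'k mpoly set"
  define F where "F = (SOME F. graded_free_resolution n ?I F)"
  have F: "graded_free_resolution n ?I F"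
    unfolding F_def by (rule someI[of "graded_free_resolution n ?I"], rule record_of_free_resolution[OF assms])
  note F' = free_resolution_of_record[OF F]
  have "graded_betti n ?I i j = 0 \<longleftrightarrow> tor_vanishes (res_rank F) (res_degree F) (res_diff F) i j"
    unfolding graded_betti_def F_def[symmetric] by (rule tensor_homology_dim_eq_0_iff[OF F])
  thus ?thesis
    using tor_vanishes_transfer[OF F' assms] tor_vanishes_transfer[OF assms F'] by blast
qed

lemma has_linear_resolutionI:
  assumes "linear_resolution n (monomial_span n A :: 'k::field mpoly set) d"
  shows "has_linear_resolution n d (monomial_span n A :: 'k mpoly set)"
proof -
  obtain R E and D :: "nat \<Rightarrow> nat \<Rightarrow> nat \<Rightarrow> 'k mpoly" where
    F: "free_resolution n (monomial_span n A) R E D" and E: "\<And>i k. k < R (Suc i) \<Longrightarrow> E (Suc i) k = int d + int i"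
    using assms unfolding linear_resolution_def by blast
  have "tor_vanishes R E D i (int i + j)" if "j \<noteq> int d" for i j
  proof -
    show ?thesis
      unfolding tor_vanishes_def
    proof (intro allI impI)
      fix x :: "nat \<Rightarrow> 'k"
      assume "strand (R (Suc i)) (E (Suc i)) (int i + j) x"
      hence "x l = 0" for l
        using E[of l i] \<open>j \<noteq> int d\<close> unfolding strand_def by force
      moreover have "strand (R (Suc (Suc i))) (E (Suc (Suc i))) (int i + j) (\<lambda>_. 0)"
        by (simp add: strand_def)
      ultimately show "\<exists>y. strand (R (Suc (Suc i))) (E (Suc (Suc i))) (int i + j) y \<and>
          (\<forall>l<R (Suc i). x l = mat_vec (R (Suc (Suc i))) (const_mat (D (Suc i))) y l)"
        by (intro exI[of _ "\<lambda>_. 0"]) simp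
    qed
  qed
  thus ?thesis unfolding has_linear_resolution_def by (simp add: graded_betti_eq_0_iff[OF F])
qed

section \<open>Linear first syzygies\<close>

text \<open>
  Call two generators adjacent inside \<open>\<alpha>\<close> if both divide a divisor of \<open>\<alpha>\<close> of degree at most
  $d + 1$, and let \<open>C\<close> be closed under adjacency. If \<open>\<alpha>\<close> has degree at most $d + 1$, then \<open>C\<close>
  contains either all generators dividing \<open>\<alpha>\<close> or none, and the sum is the coefficient of \<open>\<alpha>\<close>
  in $\sum_k x_k m_k = 0$ or empty. In higher degrees there are no new minimal syzygies, as
  $\mathrm{Tor}_1$ is concentrated in degree $d + 1$: the syzygy is a combination of others with
  coefficients without constant term, and induction applies to the quotients of \<open>\<alpha>\<close> by the
  monomials of these coefficients.
\<close>

lemma closed_set_kills_syzygies: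
  fixes D :: "nat \<Rightarrow> nat \<Rightarrow> nat \<Rightarrow> 'k::field mpoly" and x :: "nat \<Rightarrow> 'k mpoly"
  assumes F: "free_resolution n (monomial_span n (set ms)) R E D"
    and R1: "R 1 = length ms"
    and D0: "\<And>k. k < length ms \<Longrightarrow> D 0 0 k = Poly_Mapping.single (ms ! k) 1"
    and E1: "\<And>k. k < length ms \<Longrightarrow> E 1 k = int d"
    and deg: "\<And>m. m \<in> set ms \<Longrightarrow> pp_degree m = d"
    and tor: "\<And>j. j \<noteq> int (d + 1) \<Longrightarrow> tor_vanishes R E D 1 j"
    and x: "\<And>k. k < length ms \<Longrightarrow> x k \<in> polys n" "(\<Sum>k<length ms. Poly_Mapping.single (ms ! k) 1 * x k) = 0"
    and closed: "\<And>a b \<beta>. a \<in> C \<Longrightarrow> b \<in> set ms \<Longrightarrow> pp_dvd a \<beta> \<Longrightarrow> pp_dvd b \<beta> \<Longrightarrow> pp_dvd \<beta> \<alpha> \<Longrightarrow>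
      pp_degree \<beta> \<le> d + 1 \<Longrightarrow> b \<in> C"
  shows "(\<Sum>k\<in>{k. k < length ms \<and> ms ! k \<in> C \<and> pp_dvd (ms ! k) \<alpha>}. lookup (x k) (\<alpha> - ms ! k)) = 0"
  using x closed
proof (induction "pp_degree \<alpha>" arbitrary: \<alpha> x rule: less_induct)
  case less
  interpret free_resolution n "monomial_span n (set ms)" R E D by (rule F)
  let ?r = "length ms"
  let ?S = "\<lambda>\<alpha>. {k. k < ?r \<and> ms ! k \<in> C \<and> pp_dvd (ms ! k) \<alpha>}"
  have R1': "R (Suc 0) = ?r" using R1 by simp
  show ?case
  proof (cases "pp_degree \<alpha> \<le> d + 1")
    case True
    show ?thesis
    proof (cases "?S \<alpha> = {}")
      case False
      then obtain a where a: "a \<in> C" "pp_dvd a \<alpha>" by blast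
      have S: "?S \<alpha> = {k\<in>{..<?r}. pp_dvd (ms ! k) \<alpha>}"
        using less.prems(3)[OF a(1) _ a(2) _ pp_dvd_refl True] by auto
      have "(\<Sum>k\<in>?S \<alpha>. lookup (x k) (\<alpha> - ms ! k)) =
          (\<Sum>k<?r. if pp_dvd (ms ! k) \<alpha> then lookup (x k) (\<alpha> - ms ! k) else 0)"
        unfolding S by (rule sum.inter_filter) simp
      also have "\<dots> = lookup (\<Sum>k<?r. Poly_Mapping.single (ms ! k) 1 * x k) \<alpha>"
        by (simp add: lookup_sum lookup_single_times cong: if_cong)
      finally show ?thesis using less.prems(2) by simp
    qed (simp only: sum.empty)
  next
    case False
    let ?j = "int (pp_degree \<alpha>)"
    have "mat_vec (R (Suc 0)) (D 0) x 0 = (\<Sum>k<?r. Poly_Mapping.single (ms ! k) 1 * x k)"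
      unfolding mat_vec_def R1' by (intro sum.cong) (auto simp: D0)
    hence "cycle (monomial_span n (set ms)) R D (Suc 0) x"
      using less.prems(2) by (simp add: cycle_Suc rank_0)
    then obtain y where yp: "\<And>k. k < R (Suc (Suc 0)) \<Longrightarrow> y k \<in> polys n"
      and y: "\<And>l. l < ?r \<Longrightarrow> x l = mat_vec (R (Suc (Suc 0))) (D (Suc 0)) y l"
      using exact[of "Suc 0" x] less.prems(1) R1' by auto
    \<comment> \<open>The constants of \<open>y\<close> in degree \<open>\<alpha>\<close> form a cycle, so they can be removed.\<close>
    define c where "c k = (if k < R (Suc (Suc 0)) \<and> E (Suc (Suc 0)) k = ?j then lookup (y k) 0 else 0)" for k
    have "strand (R (Suc (Suc 0))) (E (Suc (Suc 0))) ?j c"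
      by (auto simp: strand_def c_def)
    moreover have "mat_vec (R (Suc (Suc 0))) (const_mat (D (Suc 0))) c l = 0" if l: "l < R (Suc 0)" for l
      unfolding mat_vec_def
    proof (rule sum.neutral, rule ballI)
      fix k assume k: "k \<in> {..<R (Suc (Suc 0))}"
      have "E (Suc 0) l = int d" using l E1[of l] R1' by simp
      hence "lookup (D (Suc 0) l k) 0 = 0 \<or> E (Suc (Suc 0)) k = int d"
        using graded_matrix_const[OF graded[of "Suc 0"] l, of k] k by fastforce
      thus "lookup (D (Suc 0) l k) 0 * c k = 0"
        using False by (auto simp: c_def)
    qed
    moreover have "tor_vanishes R E D (Suc 0) ?j"
      using tor[of ?j] False by simp
    ultimately obtain z
      where z: "\<And>l. l < R (Suc (Suc 0)) \<Longrightarrow> c l = mat_vec (R (Suc (Suc (Suc 0)))) (const_mat (D (Suc (Suc 0)))) z l"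
      unfolding tor_vanishes_def by blast
    define y' where "y' k = y k - mat_vec (R (Suc (Suc (Suc 0)))) (D (Suc (Suc 0))) (\<lambda>k. Poly_Mapping.single 0 (z k)) k" for k
    have y'x: "x l = mat_vec (R (Suc (Suc 0))) (D (Suc 0)) y' l" if "l < ?r" for l
      unfolding y'_def mat_vec_diff using complex_vec[of l "Suc 0"] that y R1' by simp
    have y'0: "lookup (y' k) 0 = 0" if "k < R (Suc (Suc 0))" "E (Suc (Suc 0)) k = ?j" for k
      using z[OF that(1)] that unfolding y'_def lookup_minus const_mat_vec by (simp add: c_def)
    have "(\<Sum>l\<in>?S \<alpha>. lookup (y' k * D (Suc 0) l k) (\<alpha> - ms ! l)) = 0"
      if k: "k < R (Suc (Suc 0))" for k
    proof -
      have dvd: "pp_dvd s (\<alpha> - ms ! l) \<longleftrightarrow> pp_dvd s \<alpha> \<and> pp_dvd (ms ! l) (\<alpha> - s)" if "pp_dvd (ms ! l) \<alpha>" for s l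
        using that unfolding pp_dvd_iff lookup_minus
        by (metis (no_types, lifting) add.commute diff_le_self le_diff_conv2 order_trans)
      have "(\<Sum>l\<in>?S \<alpha>. lookup (y' k * D (Suc 0) l k) (\<alpha> - ms ! l)) =
          (\<Sum>l\<in>?S \<alpha>. \<Sum>s\<in>keys (y' k). if pp_dvd s \<alpha> \<and> pp_dvd (ms ! l) (\<alpha> - s)
            then lookup (y' k) s * lookup (D (Suc 0) l k) (\<alpha> - ms ! l - s) else 0)"
        unfolding lookup_times by (intro sum.cong) (auto simp: dvd)
      also have "\<dots> = (\<Sum>s\<in>keys (y' k). \<Sum>l\<in>?S \<alpha>. if pp_dvd s \<alpha> \<and> pp_dvd (ms ! l) (\<alpha> - s)
            then lookup (y' k) s * lookup (D (Suc 0) l k) (\<alpha> - ms ! l - s) else 0)"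
        by (rule sum.swap)
      also have "\<dots> = 0"
      proof (rule sum.neutral, rule ballI)
        fix s assume s: "s \<in> keys (y' k)"
        show "(\<Sum>l\<in>?S \<alpha>. if pp_dvd s \<alpha> \<and> pp_dvd (ms ! l) (\<alpha> - s)
            then lookup (y' k) s * lookup (D (Suc 0) l k) (\<alpha> - ms ! l - s) else 0) = 0"
        proof (cases "s = 0 \<or> \<not> pp_dvd s \<alpha>")
          case True
          have "lookup (D (Suc 0) l k) (\<alpha> - ms ! l) = 0" if l: "l \<in> ?S \<alpha>" "s = 0" for l
          proof -
            have "E (Suc (Suc 0)) k \<noteq> ?j" using y'0[OF k] s l(2) by (auto simp: in_keys_iff)
            moreover have "homogeneous_of_degree (E (Suc (Suc 0)) k - int d) (D (Suc 0) l k)"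
              using graded_matrixD(2)[OF graded[of "Suc 0"] _ k, of l] l E1[of l] R1' by simp
            moreover have "int (pp_degree (\<alpha> - ms ! l)) = ?j - int d"
              using l deg[of "ms ! l"] pp_dvd_degree_le[of "ms ! l" \<alpha>] by (simp add: pp_degree_minus of_nat_diff)
            ultimately show ?thesis by (auto simp: homogeneous_iff)
          qed
          thus ?thesis using True by (intro sum.neutral) auto
        next
          case False
          hence s0: "s \<noteq> 0" and sa: "pp_dvd s \<alpha>" by auto
          have small: "pp_degree (\<alpha> - s) < pp_degree \<alpha>"
            using s0 sa pp_degree_eq_0_iff[of s] pp_dvd_degree_le[OF sa] by (simp add: pp_degree_minus)
          have aa: "pp_dvd (\<alpha> - s) \<alpha>" by (simp add: pp_dvd_iff lookup_minus)
          have syz: "(\<Sum>l<?r. Poly_Mapping.single (ms ! l) 1 * D (Suc 0) l k) = 0"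
          proof -
            have "mat_mult (R (Suc 0)) (D 0) (D (Suc 0)) 0 k = (\<Sum>l<?r. Poly_Mapping.single (ms ! l) 1 * D (Suc 0) l k)"
              unfolding mat_mult_def R1' by (intro sum.cong) (auto simp: D0)
            thus ?thesis using complex[of 0 0 k] k by (simp add: rank_0)
          qed
          have IH: "(\<Sum>l\<in>?S (\<alpha> - s). lookup (D (Suc 0) l k) (\<alpha> - s - ms ! l)) = 0"
          proof (rule less.hyps[OF small _ syz])
            show "D (Suc 0) l k \<in> polys n" if "l < ?r" for l
              using graded_matrixD(1)[OF graded[of "Suc 0"] _ k] R1' that by simp
            show "b \<in> C" if "a \<in> C" "b \<in> set ms" "pp_dvd a \<beta>" "pp_dvd b \<beta>" "pp_dvd \<beta> (\<alpha> - s)"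
              "pp_degree \<beta> \<le> d + 1" for a b \<beta>
              by (rule less.prems(3)[OF that(1-4) pp_dvd_trans[OF that(5) aa] that(6)])
          qed
          have "(\<Sum>l\<in>?S \<alpha>. if pp_dvd s \<alpha> \<and> pp_dvd (ms ! l) (\<alpha> - s)
              then lookup (y' k) s * lookup (D (Suc 0) l k) (\<alpha> - ms ! l - s) else 0) =
            (\<Sum>l\<in>?S (\<alpha> - s). lookup (y' k) s * lookup (D (Suc 0) l k) (\<alpha> - s - ms ! l))"
          proof (rule sum.mono_neutral_cong_right)
            show "?S (\<alpha> - s) \<subseteq> ?S \<alpha>" using aa pp_dvd_trans by blast
            show "\<forall>l\<in>?S \<alpha> - ?S (\<alpha> - s). (if pp_dvd s \<alpha> \<and> pp_dvd (ms ! l) (\<alpha> - s)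
                then lookup (y' k) s * lookup (D (Suc 0) l k) (\<alpha> - ms ! l - s) else 0) = 0"
              by auto
          qed (use sa in \<open>auto simp: diff_diff_eq add.commute\<close>)
          thus ?thesis using IH by (simp add: sum_distrib_left[symmetric])
        qed
      qed
      finally show ?thesis .
    qed
    hence "(\<Sum>k<R (Suc (Suc 0)). \<Sum>l\<in>?S \<alpha>. lookup (D (Suc 0) l k * y' k) (\<alpha> - ms ! l)) = 0"
      by (intro sum.neutral) (simp add: mult.commute)
    hence "(\<Sum>l\<in>?S \<alpha>. \<Sum>k<R (Suc (Suc 0)). lookup (D (Suc 0) l k * y' k) (\<alpha> - ms ! l)) = 0"
      by (subst sum.swap)
    moreover have "(\<Sum>l\<in>?S \<alpha>. lookup (x l) (\<alpha> - ms ! l)) =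
        (\<Sum>l\<in>?S \<alpha>. \<Sum>k<R (Suc (Suc 0)). lookup (D (Suc 0) l k * y' k) (\<alpha> - ms ! l))"
      by (intro sum.cong) (auto simp: y'x mat_vec_def lookup_sum)
    ultimately show ?thesis by simp
  qed
qed

text \<open>
  If \<open>b\<close> were outside \<open>C\<close>, then summation over \<open>C\<close> would not kill the syzygy between \<open>a\<close> and
  \<open>b\<close> at \<open>\<alpha>\<close>. So generators dividing \<open>\<alpha>\<close> are joined by paths of adjacent ones.
\<close>

lemma linear_resolution_connected:
  fixes A :: "(nat \<Rightarrow>\<^sub>0 nat) set"
  assumes fin: "finite A" and keys: "\<And>m. m \<in> A \<Longrightarrow> keys m \<subseteq> {1..n}" and deg: "\<And>m. m \<in> A \<Longrightarrow> pp_degree m = d"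
    and lin: "has_linear_resolution n d (monomial_span n A :: 'k::field mpoly set)"
    and \<alpha>: "keys \<alpha> \<subseteq> {1..n}" "a \<in> A" "a \<in> C" "pp_dvd a \<alpha>" "b \<in> A" "pp_dvd b \<alpha>"
    and closed: "\<And>a b \<beta>. a \<in> C \<Longrightarrow> b \<in> A \<Longrightarrow> pp_dvd a \<beta> \<Longrightarrow> pp_dvd b \<beta> \<Longrightarrow> pp_dvd \<beta> \<alpha> \<Longrightarrow>
      pp_degree \<beta> \<le> d + 1 \<Longrightarrow> b \<in> C"
  shows "b \<in> C"
proof (rule ccontr)
  assume bC: "b \<notin> C"
  obtain ms where ms: "set ms = A" "distinct ms" using finite_distinct_list[OF fin] by blast
  obtain R E and D :: "nat \<Rightarrow> nat \<Rightarrow> nat \<Rightarrow> 'k mpoly" where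
    F: "free_resolution n (monomial_span n (set ms)) R E D" and R1: "R 1 = length ms"
    and D0: "\<And>k. k < length ms \<Longrightarrow> D 0 0 k = Poly_Mapping.single (ms ! k) 1"
    and E1: "\<And>k. k < length ms \<Longrightarrow> E 1 k = int (pp_degree (ms ! k))"
    using monomial_resolution_exists[of ms n] keys ms by blast
  have tor: "tor_vanishes R E D 1 j" if "j \<noteq> int (d + 1)" for j
  proof -
    have "graded_betti n (monomial_span n A :: 'k mpoly set) 1 (int 1 + (j - 1)) = 0"
      using lin that unfolding has_linear_resolution_def by (metis add_diff_cancel_right' diff_add_cancel of_nat_1 of_nat_add)
    thus ?thesis using graded_betti_eq_0_iff[OF F] ms by simp
  qed
  obtain p q where p: "p < length ms" "ms ! p = a" and q: "q < length ms" "ms ! q = b"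
    using \<alpha> ms by (metis in_set_conv_nth)
  have pq: "p \<noteq> q" using p q bC \<alpha> by auto
  define x :: "nat \<Rightarrow> 'k mpoly" where
    "x k = (if k = p then Poly_Mapping.single (\<alpha> - a) 1 else if k = q then - Poly_Mapping.single (\<alpha> - b) 1 else 0)" for k
  have xp: "x k \<in> polys n" for k
    using \<alpha>(1) keys_pp_minus[of \<alpha> a] keys_pp_minus[of \<alpha> b]
    by (auto simp: x_def simp del: atLeastAtMost_iff intro!: polys_uminus polys_single)
  have "(\<Sum>k<length ms. Poly_Mapping.single (ms ! k) 1 * x k) =
      (\<Sum>k\<in>{p, q}. Poly_Mapping.single (ms ! k) 1 * x k)"
    using p q by (intro sum.mono_neutral_right) (auto simp: x_def)
  also have "\<dots> = 0"
    using pq p q \<alpha> by (simp add: x_def mult_single pp_dvd_diff)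
  finally have x0: "(\<Sum>k<length ms. Poly_Mapping.single (ms ! k) 1 * x k) = 0" .
  let ?S = "{k. k < length ms \<and> ms ! k \<in> C \<and> pp_dvd (ms ! k) \<alpha>}"
  have "(\<Sum>k\<in>?S. lookup (x k) (\<alpha> - ms ! k)) = 0"
  proof (rule closed_set_kills_syzygies[OF F R1 D0 _ _ tor xp x0])
    show "E 1 k = int d" if "k < length ms" for k using E1[OF that] deg that ms by auto
    show "b \<in> C" if "a \<in> C" "b \<in> set ms" "pp_dvd a \<beta>" "pp_dvd b \<beta>" "pp_dvd \<beta> \<alpha>" "pp_degree \<beta> \<le> d + 1" for a b \<beta>
      using closed that ms by blast
  qed (use deg ms in auto)
  moreover have "(\<Sum>k\<in>?S. lookup (x k) (\<alpha> - ms ! k)) = (\<Sum>k\<in>{p}. lookup (x k) (\<alpha> - ms ! k))"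
    using p q bC \<alpha> by (intro sum.mono_neutral_right) (auto simp: x_def)
  ultimately show False using p by (simp add: x_def)
qed

section \<open>Spread index lists\<close>

abbreviation spread :: "nat \<Rightarrow> nat list \<Rightarrow> bool" where
  "spread t \<equiv> sorted_wrt (\<lambda>a b. a + t \<le> b)"

definition spread_lists :: "nat \<Rightarrow> nat \<Rightarrow> nat \<Rightarrow> nat list set" where
  "spread_lists n d t = {xs. length xs = d \<and> set xs \<subseteq> {1..n} \<and> spread t xs}"

lemma spread_strict: "t \<ge> 1 \<Longrightarrow> spread t xs \<Longrightarrow> sorted_wrt (<) xs"
  by (erule sorted_wrt_mono_rel[rotated]) auto

lemma spread_distinct: "t \<ge> 1 \<Longrightarrow> spread t xs \<Longrightarrow> distinct xs"
  using spread_strict strict_sorted_iff by blast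

lemma finite_spread_lists: "finite (spread_lists n d t)"
  by (rule finite_subset[OF _ finite_lists_length_eq[of "{1..n}" d]]) (auto simp: spread_lists_def)

lemma spread_iff_nth:
  "spread t xs \<longleftrightarrow> (\<forall>i. Suc i < length xs \<longrightarrow> xs ! i + t \<le> xs ! Suc i)"
  by (rule sorted_wrt_iff_nth_Suc_transp) (auto simp: transp_def)

lemma spread_monomials_eq:
  assumes "t \<ge> 1"
  shows "spread_monomials n d t = pp_of_indices ` spread_lists n d t"
proof -
  have "sorted xs \<and> (\<forall>j. Suc j < d \<longrightarrow> xs ! Suc j - xs ! j \<ge> t) \<longleftrightarrow> spread t xs"
    if "length xs = d" for xs
  proof
    assume *: "sorted xs \<and> (\<forall>j. Suc j < d \<longrightarrow> xs ! Suc j - xs ! j \<ge> t)"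
    show "spread t xs"
      unfolding spread_iff_nth
    proof (intro allI impI)
      fix i assume "Suc i < length xs"
      hence "t \<le> xs ! Suc i - xs ! i" using * that by blast
      thus "xs ! i + t \<le> xs ! Suc i" using assms by linarith
    qed
  next
    assume *: "spread t xs"
    have "sorted xs" using spread_strict[OF assms *] strict_sorted_iff by blast
    thus "sorted xs \<and> (\<forall>j. Suc j < d \<longrightarrow> xs ! Suc j - xs ! j \<ge> t)"
      using * that unfolding spread_iff_nth by (auto simp: le_diff_conv2)
  qed
  thus ?thesis unfolding spread_monomials_def spread_lists_def by blast
qed

lemma pp_of_indices_simps [simp]:
  "pp_of_indices [] = 0" "pp_of_indices (x # xs) = Poly_Mapping.single x 1 + pp_of_indices xs"
  by (simp_all add: pp_of_indices_def)

lemma lookup_pp_of_indices: "distinct xs \<Longrightarrow> lookup (pp_of_indices xs) i = (if i \<in> set xs then 1 else 0)"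
  by (induction xs) (auto simp: lookup_add lookup_single when_def)

lemma keys_pp_of_indices: "keys (pp_of_indices xs) = set xs"
  by (induction xs) (auto simp: pp_keys_add)

lemma pp_degree_pp_of_indices: "pp_degree (pp_of_indices xs) = length xs"
  by (induction xs) (simp_all add: pp_degree_add)

lemma pp_dvd_pp_of_indices:
  "distinct xs \<Longrightarrow> pp_dvd (pp_of_indices xs) m \<longleftrightarrow> set xs \<subseteq> keys m"
  by (auto simp: pp_dvd_iff lookup_pp_of_indices in_keys_iff subset_iff Suc_le_eq)

lemma pp_of_indices_inj:
  assumes "sorted_wrt (<) xs" "sorted_wrt (<) ys" "pp_of_indices xs = pp_of_indices ys"
  shows "xs = ys"
  using assms keys_pp_of_indices strict_sorted_equal by metis

lemma card_keys_le_pp_degree: "card (keys m) \<le> pp_degree m"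
proof -
  have "card (keys m) = (\<Sum>i\<in>keys m. 1)" by simp
  also have "\<dots> \<le> pp_degree m"
    unfolding pp_degree_def by (rule sum_mono) (simp add: in_keys_iff Suc_le_eq)
  finally show ?thesis .
qed

lemma list_less_iff_nth:
  fixes xs ys :: "nat list"
  assumes "length xs = length ys"
  shows "xs < ys \<longleftrightarrow> (\<exists>s<length xs. take s xs = take s ys \<and> xs ! s < ys ! s)"
  using assms
proof (induction xs ys rule: list_induct2)
  case (Cons x xs y ys)
  have "(\<exists>s<length (x # xs). take s (x # xs) = take s (y # ys) \<and> (x # xs) ! s < (y # ys) ! s) \<longleftrightarrow>
      x < y \<or> x = y \<and> (\<exists>s<length xs. take s xs = take s ys \<and> xs ! s < ys ! s)"
    by (auto simp: less_Suc_eq_0_disj)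
  thus ?case using Cons.IH by simp
qed simp

lemma slex_less_pp_of_indices:
  assumes "sorted_wrt (<) xs" "sorted_wrt (<) ys" "length xs = length ys"
  shows "slex_less (pp_of_indices ys) (pp_of_indices xs) \<longleftrightarrow> xs < ys"
proof -
  have "slex_less (pp_of_indices ys) (pp_of_indices xs) \<longleftrightarrow>
      (\<exists>s<length xs. take s xs = take s ys \<and> xs ! s < ys ! s)"
    unfolding slex_less_def using assms pp_of_indices_inj by metis
  thus ?thesis using list_less_iff_nth[OF assms(3)] by simp
qed

lemma slex_le_pp_of_indices:
  assumes "sorted_wrt (<) xs" "sorted_wrt (<) ys" "length xs = length ys"
  shows "slex_le (pp_of_indices ys) (pp_of_indices xs) \<longleftrightarrow> xs \<le> ys"
  unfolding slex_le_def slex_less_pp_of_indices[OF assms] using pp_of_indices_inj[OF assms(1,2)] by (auto simp: le_less)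

lemma sorted_lists_of_equal_card:
  assumes "sorted_wrt (<) (xs :: nat list)" "sorted_wrt (<) ys" "length xs = length ys" "set xs \<subseteq> set ys"
  shows "xs = ys"
proof -
  have "card (set xs) = card (set ys)" using assms by (metis distinct_card strict_sorted_iff)
  hence "set xs = set ys" using assms(4) by (simp add: card_subset_eq)
  thus ?thesis using assms strict_sorted_equal by blast
qed

lemma pointwise_le_imp_list_le:
  fixes xs ys :: "nat list"
  assumes "length xs = length ys" "\<And>i. i < length xs \<Longrightarrow> xs ! i \<le> ys ! i"
  shows "xs \<le> ys"
  using assms
proof (induction xs ys rule: list_induct2)
  case (Cons x xs y ys)
  have "x \<le> y" using Cons.prems[of 0] by simp
  moreover have "xs \<le> ys" using Cons.prems[of "Suc _"] by (intro Cons.IH) auto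
  ultimately show ?case by auto
qed simp

lemma spread_nth_diff:
  "spread t xs \<Longrightarrow> i + k < length xs \<Longrightarrow> xs ! i + k * t \<le> xs ! (i + k)"
proof (induction k)
  case (Suc k)
  hence "xs ! (i + k) + t \<le> xs ! Suc (i + k)" by (simp add: spread_iff_nth)
  thus ?case using Suc by simp
qed simp

lemma spread_hd_le:
  assumes "spread t xs" "x \<in> set xs"
  shows "hd xs \<le> x"
  using assms by (cases xs) auto

lemma list_le_hd: "(xs :: nat list) \<le> ys \<Longrightarrow> xs \<noteq> [] \<Longrightarrow> ys \<noteq> [] \<Longrightarrow> hd xs \<le> hd ys"
  by (cases xs; cases ys) auto

subsection \<open>Exchange properties\<close>

text \<open>
  The first entry where \<open>ys\<close> differs may replace the corresponding entry of \<open>xs\<close>: being smaller,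
  it keeps its distance from the next entry, and its distance from the previous one is as in \<open>ys\<close>.
\<close>

lemma exchange_first:
  assumes "length ys = length xs" "spread t ys" "spread t xs" "ys < xs" "t \<ge> 1"
  shows "\<exists>zs x. spread t zs \<and> length zs = length xs \<and> zs < xs \<and> set zs - set xs = {x} \<and> x \<in> set ys \<and>
    (hd zs = hd xs \<or> hd zs = hd ys)"
  using assms
proof (induction ys xs rule: list_induct2)
  case (Cons y ys x xs)
  show ?case
  proof (cases "y < x")
    case True
    have "spread t (y # xs)" "y \<notin> set (x # xs)" using Cons.prems True by force+
    thus ?thesis using True by (intro exI[of _ "y # xs"] exI[of _ y]) auto
  next
    case False
    hence yx: "y = x" "ys < xs" using Cons.prems(3) by auto
    obtain zs z where zs: "spread t zs" "length zs = length xs" "zs < xs" "set zs - set xs = {z}" "z \<in> set ys"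
      using Cons.IH Cons.prems yx by auto
    have "z > x" using zs(5) Cons.prems(1,4) yx(1) by force
    moreover have "spread t (x # zs)"
      using zs(1,4,5) Cons.prems(1,2) yx(1) by (auto simp: subset_iff)
    ultimately show ?thesis
      using zs yx by (intro exI[of _ "x # zs"] exI[of _ z]) auto
  qed
qed simp

text \<open>
  Here the first difference need not do, since the larger entry of \<open>ys\<close> may come too close to the
  next entry of \<open>xs\<close>. But then the tails compare in the same way, and one may exchange there.
\<close>

lemma exchange_last:
  assumes "length xs = length ys" "spread t xs" "spread t ys" "xs < ys" "t \<ge> 1"
  shows "\<exists>zs x. spread t zs \<and> length zs = length xs \<and> xs < zs \<and> set zs - set xs = {x} \<and> x \<in> set ys"
  using assms
proof (induction xs ys rule: list_induct2)
  case (Cons x xs y ys)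
  have tails: ?case if less: "xs < ys" and xy: "x \<le> y"
  proof -
    obtain zs z where zs: "spread t zs" "length zs = length xs" "xs < zs" "set zs - set xs = {z}" "z \<in> set ys"
      using Cons.IH Cons.prems less by auto
    have zy: "y + t \<le> z" using zs(5) Cons.prems(2) by simp
    moreover have "spread t (x # zs)"
    proof -
      have "x + t \<le> w" if "w \<in> set zs" for w
      proof (cases "w \<in> set xs")
        case False
        hence "w = z" using that zs(4) by blast
        thus ?thesis using zy xy by simp
      qed (use Cons.prems(1) in simp)
      thus ?thesis using zs(1) by simp
    qed
    moreover have "z \<noteq> x" using zy xy Cons.prems(4) by simp
    ultimately show ?thesis
      using zs by (intro exI[of _ "x # zs"] exI[of _ z]) auto
  qed
  show ?case
  proof (cases "x = y")
    case True
    thus ?thesis using tails Cons.prems(3) by auto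
  next
    case False
    hence xy: "x < y" using Cons.prems(3) by auto
    show ?thesis
    proof (cases "\<forall>w\<in>set xs. y + t \<le> w")
      case True
      hence "y \<notin> set (x # xs)" using xy Cons.prems(4) by force
      thus ?thesis
        using True xy Cons.prems(1) by (intro exI[of _ "y # xs"] exI[of _ y]) auto
    next
      case False
      then obtain w where w: "w \<in> set xs" "w < y + t" by force
      have ne: "xs \<noteq> []" "ys \<noteq> []" using w Cons.hyps by auto
      have "hd xs < y + t" using spread_hd_le[of t xs w] w Cons.prems(1) by auto
      moreover have "y + t \<le> hd ys" using Cons.prems(2) ne by simp
      ultimately have "xs < ys" using ne by (cases xs; cases ys) auto
      thus ?thesis using tails xy by simp
    qed
  qed
qed simp

lemma spread_lists_Cons:
  "x # xs \<in> spread_lists n d t \<longleftrightarrow>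
    x \<in> {1..n} \<and> (\<forall>y\<in>set xs. x + t \<le> y) \<and> xs \<in> spread_lists n (d - 1) t \<and> d \<ge> 1"
  by (auto simp: spread_lists_def)

lemma spread_lists_cases:
  assumes "xs \<in> spread_lists n d t" "d \<ge> 1"
  obtains x ys where "xs = x # ys"
  using assms by (cases xs) (auto simp: spread_lists_def)

text \<open>
  Each entry has to leave room for the entries after it.
\<close>

lemma spread_list_le_top:
  assumes "xs \<in> spread_lists n k t"
  shows "xs \<le> map (\<lambda>i. n - (k - 1 - i) * t) [0..<k]"
proof (rule pointwise_le_imp_list_le)
  fix i assume i: "i < length xs"
  have k: "length xs = k" and s: "spread t xs" using assms by (auto simp: spread_lists_def)
  have "xs ! i + (k - 1 - i) * t \<le> xs ! (k - 1)"
    using spread_nth_diff[OF s, of i "k - 1 - i"] i k by simp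
  moreover have "xs ! (k - 1) \<le> n"
    using assms i k nth_mem[of "k - 1" xs] by (force simp: spread_lists_def)
  ultimately show "xs ! i \<le> map (\<lambda>i. n - (k - 1 - i) * t) [0..<k] ! i"
    using i k by simp
qed (use assms in \<open>auto simp: spread_lists_def\<close>)

lemma top_list_ge: "x \<in> set (map (\<lambda>i. n - (k - 1 - i) * t) [0..<k]) \<Longrightarrow> n - (k - 1) * t \<le> x"
  by (auto intro!: diff_le_mono2 mult_le_mono1)

lemma spread_top_list:
  assumes "(k - 1) * t \<le> n"
  shows "spread t (map (\<lambda>i. n - (k - 1 - i) * t) [0..<k])"
  unfolding spread_iff_nth
proof (intro allI impI)
  fix i assume i: "Suc i < length (map (\<lambda>i. n - (k - 1 - i) * t) [0..<k])"
  hence "k - 1 - i = Suc (k - 1 - Suc i)" by simp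
  hence "(k - 1 - i) * t = (k - 1 - Suc i) * t + t" by (metis add.commute mult_Suc)
  moreover have "(k - 1 - i) * t \<le> (k - 1) * t" by (intro mult_le_mono1) simp
  moreover have arith: "a = b + t \<Longrightarrow> a \<le> c \<Longrightarrow> c \<le> n \<Longrightarrow> n - a + t \<le> n - b" for a b c :: nat
    by simp
  ultimately have "n - (k - 1 - i) * t + t \<le> n - (k - 1 - Suc i) * t"
    using arith assms by blast
  thus "map (\<lambda>i. n - (k - 1 - i) * t) [0..<k] ! i + t \<le> map (\<lambda>i. n - (k - 1 - i) * t) [0..<k] ! Suc i"
    using i by (simp only: length_map length_upt nth_map_upt diff_zero Suc_lessD add_0)
qed

lemma list_ge_bottom:
  assumes "spread t xs" "\<And>x. x \<in> set xs \<Longrightarrow> a \<le> x"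
  shows "map (\<lambda>i. a + i * t) [0..<length xs] \<le> xs"
proof (rule pointwise_le_imp_list_le)
  fix i assume i: "i < length (map (\<lambda>i. a + i * t) [0..<length xs])"
  have "xs ! 0 + i * t \<le> xs ! i" using spread_nth_diff[OF assms(1), of 0 i] i by simp
  moreover have "a \<le> xs ! 0" using i by (intro assms(2) nth_mem) auto
  ultimately show "map (\<lambda>i. a + i * t) [0..<length xs] ! i \<le> xs ! i" using i by simp
qed simp

section \<open>Lexsegments\<close>

text \<open>
  The lexicographic order of lists is opposite to that of monomials: greater monomials have
  smaller index lists.
\<close>

definition segment_lists :: "nat \<Rightarrow> nat \<Rightarrow> nat \<Rightarrow> nat list \<Rightarrow> nat list \<Rightarrow> nat list set" where
  "segment_lists n d t us vs = {ws \<in> spread_lists n d t. us \<le> ws \<and> ws \<le> vs}"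

lemma keys_spread_lists: "xs \<in> spread_lists n d t \<Longrightarrow> keys (pp_of_indices xs) \<subseteq> {1..n}"
  by (simp add: keys_pp_of_indices spread_lists_def)

lemma slex_le_spread_lists:
  assumes "t \<ge> 1" "us \<in> spread_lists n d t" "ws \<in> spread_lists n d t"
  shows "slex_le (pp_of_indices ws) (pp_of_indices us) \<longleftrightarrow> us \<le> ws"
  using assms by (intro slex_le_pp_of_indices) (auto simp: spread_lists_def spread_strict)

lemma lexsegments_eq_image:
  assumes "t \<ge> 1" "us \<in> spread_lists n d t" "vs \<in> spread_lists n d t"
  shows "lexsegment n d t (pp_of_indices us) (pp_of_indices vs) = pp_of_indices ` segment_lists n d t us vs"
    and "initial_lexsegment n d t (pp_of_indices vs) = pp_of_indices ` {ws \<in> spread_lists n d t. ws \<le> vs}"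
    and "final_lexsegment n d t (pp_of_indices us) = pp_of_indices ` {ws \<in> spread_lists n d t. us \<le> ws}"
  unfolding lexsegment_def initial_lexsegment_def final_lexsegment_def segment_lists_def
    spread_monomials_eq[OF assms(1)]
  using slex_le_spread_lists[OF assms(1,2)] slex_le_spread_lists[OF assms(1) _ assms(3)] by blast+

lemma monomial_ideal_spread_lists:
  "T \<subseteq> spread_lists n d t \<Longrightarrow> monomial_ideal n (pp_of_indices ` T) = monomial_span n (pp_of_indices ` T)"
  using keys_spread_lists by (intro monomial_ideal_eq_span) blast

subsection \<open>Necessity\<close>

text \<open>
  Products of distinct variables have a common multiple of degree at most $d + 1$ iff they involve
  at most $d + 1$ variables; this turns adjacency into a condition on index sets.
\<close>

lemma spread_family_connected:
  assumes t: "t \<ge> 1" and T: "T \<subseteq> spread_lists n d t"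
    and lin: "has_linear_resolution n d (monomial_span n (pp_of_indices ` T) :: 'k::field mpoly set)"
    and U: "U \<subseteq> {1..n}" "xs \<in> T" "set xs \<subseteq> U" "P xs" "ys \<in> T" "set ys \<subseteq> U"
    and closed: "\<And>xs ys. xs \<in> T \<Longrightarrow> ys \<in> T \<Longrightarrow> P xs \<Longrightarrow> set xs \<subseteq> U \<Longrightarrow> set ys \<subseteq> U \<Longrightarrow>
      card (set xs \<union> set ys) \<le> d + 1 \<Longrightarrow> P ys"
  shows "P ys"
proof -
  have dist: "distinct xs" "sorted_wrt (<) xs" if "xs \<in> T" for xs
    using that T spread_distinct[OF t] spread_strict[OF t] by (auto simp: spread_lists_def)
  define C where "C = pp_of_indices ` {xs \<in> T. P xs \<and> set xs \<subseteq> U}"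
  define \<alpha> where "\<alpha> = pp_of_indices (sorted_list_of_set U)"
  have "finite U" using U(1) finite_subset by blast
  hence \<alpha>: "keys \<alpha> = U" by (simp add: \<alpha>_def keys_pp_of_indices)
  have "pp_of_indices ys \<in> C"
  proof (rule linear_resolution_connected[OF _ _ _ lin, of \<alpha> "pp_of_indices xs"])
    show "finite (pp_of_indices ` T)" using T finite_spread_lists finite_subset by blast
    show "keys m \<subseteq> {1..n}" if "m \<in> pp_of_indices ` T" for m
      using that T keys_spread_lists by blast
    show "pp_degree m = d" if "m \<in> pp_of_indices ` T" for m
      using that T by (auto simp: pp_degree_pp_of_indices spread_lists_def)
    show "pp_of_indices xs \<in> C" using U by (auto simp: C_def)
    fix a b \<beta> assume ab: "a \<in> C" "b \<in> pp_of_indices ` T" "pp_dvd a \<beta>" "pp_dvd b \<beta>" "pp_dvd \<beta> \<alpha>" "pp_degree \<beta> \<le> d + 1"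
    obtain x y where x: "x \<in> T" "P x" "set x \<subseteq> U" "a = pp_of_indices x" and y: "y \<in> T" "b = pp_of_indices y"
      using ab by (auto simp: C_def)
    have "set y \<subseteq> U" using pp_dvd_keys[OF pp_dvd_trans[OF ab(4,5)]] y \<alpha> by (simp add: keys_pp_of_indices)
    moreover have "set x \<union> set y \<subseteq> keys \<beta>"
      using pp_dvd_keys[OF ab(3)] pp_dvd_keys[OF ab(4)] x y by (simp add: keys_pp_of_indices)
    hence "card (set x \<union> set y) \<le> card (keys \<beta>)" by (simp add: card_mono)
    hence "card (set x \<union> set y) \<le> d + 1" using ab(6) card_keys_le_pp_degree[of \<beta>] by simp
    ultimately have "P y" using closed x y by blast
    thus "b \<in> C" using y \<open>set y \<subseteq> U\<close> by (auto simp: C_def)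
  qed (use U \<alpha> dist in \<open>auto simp: pp_dvd_pp_of_indices simp del: atLeastAtMost_iff\<close>)
  then obtain zs where "zs \<in> T" "P zs" "pp_of_indices ys = pp_of_indices zs"
    by (auto simp: C_def)
  thus ?thesis using pp_of_indices_inj dist U by metis
qed

text \<open>
  A path inside \<open>U\<close> from a monomial divisible by $x_1$ to one that is not must replace $x_1$ by
  another variable at some step. The new monomial is not smaller than the end of the segment, so
  its first index is at most \<open>l\<close>, hence equal to \<open>l\<close> by the choice of \<open>U\<close>. The factor \<open>c'\<close> that
  the two monomials share has only indices above \<open>l\<close>, and comparison with both ends of the segment
  bounds it.
\<close>

lemma crossing:
  assumes t: "t \<ge> 1" and us: "1 # us \<in> spread_lists n d t" and vs: "l # vs \<in> spread_lists n d t" and l: "l \<ge> 2"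
    and lin: "has_linear_resolution n d
      (monomial_span n (pp_of_indices ` segment_lists n d t (1 # us) (l # vs)) :: 'k::field mpoly set)"
    and us_gt: "\<And>x. x \<in> set us \<Longrightarrow> l < x"
    and U: "U \<subseteq> {1..n}" "\<And>x. x \<in> U \<Longrightarrow> x = 1 \<or> l \<le> x"
    and c: "1 # c \<in> segment_lists n d t (1 # us) (l # vs)" "insert 1 (set c) \<subseteq> U"
    and e: "l # e \<in> segment_lists n d t (1 # us) (l # vs)" "insert l (set e) \<subseteq> U"
  obtains (conclude) c' where "set c' \<subseteq> U" "1 # c' \<in> spread_lists n d t" "us \<le> c'" "c' \<le> vs"
proof (rule ccontr)
  assume "\<not> thesis"
  hence no: "\<not> (us \<le> c' \<and> c' \<le> vs)" if "set c' \<subseteq> U" "1 # c' \<in> spread_lists n d t" for c'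
    using conclude[OF that] \<open>\<not> thesis\<close> by blast
  let ?T = "segment_lists n d t (1 # us) (l # vs)"
  have T: "?T \<subseteq> spread_lists n d t" by (auto simp: segment_lists_def)
  have d1: "d \<ge> 1" using us by (simp add: spread_lists_Cons)
  have "hd (l # e) = 1"
  proof (rule spread_family_connected[OF t T lin U(1) c(1)])
    fix xs ys assume xs: "xs \<in> ?T" "hd xs = 1" "set xs \<subseteq> U" and ys: "ys \<in> ?T" "set ys \<subseteq> U"
      and card: "card (set xs \<union> set ys) \<le> d + 1"
    obtain x c' where "xs = x # c'" by (rule spread_lists_cases[OF subsetD[OF T xs(1)] d1])
    hence c': "xs = 1 # c'" using xs(2) by simp
    obtain y ys' where y: "ys = y # ys'" by (rule spread_lists_cases[OF subsetD[OF T ys(1)] d1])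
    have xsS: "1 # c' \<in> spread_lists n d t" and ysS: "y # ys' \<in> spread_lists n d t" using T xs ys c' y by blast+
    show "hd ys = 1"
    proof (rule ccontr)
      assume "hd ys \<noteq> 1"
      hence "y \<noteq> 1" using y by simp
      hence yl: "y = l" and ys': "ys' \<le> vs"
        using U(2)[of y] ys y by (auto simp: segment_lists_def)
      have usc: "us \<le> c'" using xs c' by (simp add: segment_lists_def)
      have len: "length c' = d - 1" "length ys' = d - 1" "length us = d - 1"
        using xsS ysS us by (auto simp: spread_lists_def)
      have "spread t c'" "spread t (y # ys')" using xsS ysS by (simp_all add: spread_lists_def)
      hence srt: "sorted_wrt (<) c'" "sorted_wrt (<) (y # ys')" by (simp_all only: spread_strict[OF t])
      have cl: "l < x" if x: "x \<in> set c'" for x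
      proof -
        have "c' \<noteq> []" using x by auto
        hence "us \<noteq> []" using len by auto
        hence "l < hd us" using us_gt by simp
        also have "hd us \<le> hd c'" by (rule list_le_hd) fact+
        also have "hd c' \<le> x" using xsS x by (intro spread_hd_le[of t]) (auto simp: spread_lists_def)
        finally show ?thesis .
      qed
      have ly: "l < x" if "x \<in> set ys'" for x using srt(2) yl that by simp
      have notin: "1 \<notin> set c'" "l \<notin> set c'" using cl[of 1] cl[of l] l by auto
      have notin': "1 \<notin> set ys" using ly[of 1] l y yl by auto
      have "set xs \<union> set ys = insert 1 (set c' \<union> set ys)" using c' by auto
      hence "card (set xs \<union> set ys) = Suc (card (set c' \<union> set ys))" using notin notin' by simp
      moreover have "card (set ys) = d"
        using srt(2) y ysS distinct_card[of ys] strict_sorted_iff[of ys] by (auto simp: spread_lists_def)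
      ultimately have "card (set c' \<union> set ys) \<le> card (set ys)" using card by simp
      hence "set ys = set c' \<union> set ys" by (intro card_seteq) auto
      hence "set c' \<subseteq> set ys'" using notin yl y by auto
      hence "c' = ys'" using srt len by (intro sorted_lists_of_equal_card) auto
      thus False using no[of c'] xsS usc ys' xs(3) c' by auto
    qed
  qed (use c e in auto)
  thus False using l by simp
qed

text \<open>
  A monomial in the intersection that is not in the segment ideal is divisible by a generator
  greater than \<open>u\<close>, hence by $x_1$, and by one smaller than \<open>v\<close>, but by none in between. If the
  first variable of the latter is replaced by $x_1$, the product still divides that monomial; as it
  is now greater than \<open>v\<close>, it must be greater than \<open>u\<close>.
\<close>

lemma incomplete_witness:
  assumes t: "t \<ge> 1" and us: "1 # us \<in> spread_lists n d t" and vs: "l # vs \<in> spread_lists n d t" and l: "l \<ge> 2"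
    and ne: "monomial_span n (pp_of_indices ` segment_lists n d t (1 # us) (l # vs)) \<noteq>
      monomial_span n (pp_of_indices ` {ws \<in> spread_lists n d t. ws \<le> l # vs}) \<inter>
      (monomial_span n (pp_of_indices ` {ws \<in> spread_lists n d t. 1 # us \<le> ws}) :: 'k::field mpoly set)"
  obtains b bs where "b # bs \<in> spread_lists n d t" "l # vs < b # bs" "bs < us"
proof -
  let ?S = "spread_lists n d t" and ?T = "segment_lists n d t (1 # us) (l # vs)"
  have d1: "d \<ge> 1" using us by (simp add: spread_lists_Cons)
  have dvd: "pp_dvd (pp_of_indices xs) m \<longleftrightarrow> set xs \<subseteq> keys m" if "xs \<in> ?S" for xs m
    using that spread_distinct[OF t] by (intro pp_dvd_pp_of_indices) (auto simp: spread_lists_def)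
  have "monomial_span n (pp_of_indices ` ?T) \<subseteq>
      monomial_span n (pp_of_indices ` {ws \<in> ?S. ws \<le> l # vs}) \<inter>
      (monomial_span n (pp_of_indices ` {ws \<in> ?S. 1 # us \<le> ws}) :: 'k mpoly set)"
    by (intro Int_greatest monomial_span_mono) (auto simp: segment_lists_def intro!: pp_dvd_refl)
  then obtain p :: "'k mpoly" where p: "p \<in> monomial_span n (pp_of_indices ` {ws \<in> ?S. ws \<le> l # vs})"
    "p \<in> monomial_span n (pp_of_indices ` {ws \<in> ?S. 1 # us \<le> ws})" "p \<notin> monomial_span n (pp_of_indices ` ?T)"
    using ne by blast
  then obtain m where m: "m \<in> keys p" "\<And>ws. ws \<in> ?T \<Longrightarrow> \<not> pp_dvd (pp_of_indices ws) m"
    by (auto simp: monomial_span_def)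
  obtain as where as: "as \<in> ?S" "as \<le> l # vs" "set as \<subseteq> keys m"
    using p(1) m(1) dvd by (auto simp: monomial_span_def)
  obtain bs' where bs': "bs' \<in> ?S" "1 # us \<le> bs'" "set bs' \<subseteq> keys m"
    using p(2) m(1) dvd by (auto simp: monomial_span_def)
  obtain b bs where b: "bs' = b # bs" using spread_lists_cases[OF bs'(1) d1] .
  obtain a as' where a: "as = a # as'" using spread_lists_cases[OF as(1) d1] .
  have notT: "\<not> set ws \<subseteq> keys m" if "ws \<in> ?T" for ws
    using m(2)[OF that] dvd[of ws] that by (simp add: segment_lists_def)
  have "\<not> 1 # us \<le> as" using notT[of as] as by (auto simp: segment_lists_def)
  hence "as < 1 # us" by (simp only: not_le)
  hence "a \<le> 1" using a by auto
  moreover have "a \<ge> 1" using as(1) a by (auto simp: spread_lists_def)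
  ultimately have one: "1 \<in> keys m" using as a by auto
  have "\<not> b # bs \<le> l # vs" using notT[of bs'] bs' b by (auto simp: segment_lists_def)
  hence less: "l # vs < b # bs" by (simp only: not_le)
  have "1 # bs \<in> ?S"
    using bs'(1) b us by (force simp: spread_lists_Cons)
  moreover have "set (1 # bs) \<subseteq> keys m" using one bs' b by auto
  moreover have "1 # bs \<le> l # vs" using l by simp
  ultimately have "\<not> 1 # us \<le> 1 # bs" using notT[of "1 # bs"] by (auto simp: segment_lists_def)
  hence "bs < us" by simp
  thus thesis using that bs' b less by blast
qed

text \<open>
  Two applications of \<open>crossing\<close>. The path from \<open>u\<close> to \<open>v\<close> gives $us \<le> vs$, which forces the
  witness to start after \<open>l\<close> and so bounds \<open>us\<close>. For the second path let \<open>z\<close> be the greatest list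
  of length $d - 1$: it leads from \<open>1 # z\<close> to \<open>l # (l + t) # tl z\<close>. All entries of a spread
  list that is at least \<open>us\<close> exceed $l + t$, so that only \<open>z\<close> itself is available for the crossing.
\<close>

lemma segment_necessary:
  assumes t: "t \<ge> 1" and d: "d \<ge> 1"
    and us: "1 # us \<in> spread_lists n d t" and vs: "l # vs \<in> spread_lists n d t" and l: "l \<ge> 2"
    and b: "b # bs \<in> spread_lists n d t" "l # vs < b # bs" "bs < us"
    and lin: "has_linear_resolution n d
      (monomial_span n (pp_of_indices ` segment_lists n d t (1 # us) (l # vs)) :: 'k::field mpoly set)"
  shows "l < n - (d - 1) * t" and "map (\<lambda>i. l + 1 + t + i * t) [0..<d - 1] < us"
    and "vs = map (\<lambda>i. n - (d - 1 - 1 - i) * t) [0..<d - 1]"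
proof -
  let ?S = "spread_lists n d t" and ?T = "segment_lists n d t (1 # us) (l # vs)"
  let ?z = "map (\<lambda>i. n - (d - 1 - 1 - i) * t) [0..<d - 1]"
  have len: "length us = d - 1" "length vs = d - 1" "length bs = d - 1"
    using us vs b by (auto simp: spread_lists_def)
  have usT: "1 # us \<in> ?T" and vsT: "l # vs \<in> ?T" using us vs l by (auto simp: segment_lists_def)
  have ne: "us \<noteq> []" using b(3) by auto
  hence ne': "vs \<noteq> []" "bs \<noteq> []" using len by auto
  have us_hd: "hd us \<le> x" if "x \<in> set us" for x
    using us that by (intro spread_hd_le[of t]) (auto simp: spread_lists_def)
  have spr: "spread t us" "spread t vs" "spread t bs" "set vs \<subseteq> {1..n}" "set us \<subseteq> {1..n}" "l + t \<le> hd vs"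
    using us vs b ne' by (auto simp: spread_lists_def)
  have l1n: "l \<in> {1..n}" "1 \<in> {1..n}" using vs us by (auto simp: spread_lists_def)
  have us_le_vs: "us \<le> vs"
  proof (rule ccontr)
    assume "\<not> us \<le> vs"
    hence less: "vs < us" by simp
    hence "hd vs \<le> hd us" using ne ne' by (intro list_le_hd) auto
    hence gt: "l < x" if "x \<in> set us" for x using us_hd[OF that] spr(6) t by simp
    have gt': "l < x" if "x \<in> set vs" for x
      using spread_hd_le[OF spr(2) that] spr(6) t by simp
    obtain c' where "us \<le> c'" "c' \<le> vs"
    proof (rule crossing[OF t us vs l lin gt])
      show "insert 1 (insert l (set us \<union> set vs)) \<subseteq> {1..n}" using spr l1n by auto
      show "x = 1 \<or> l \<le> x" if "x \<in> insert 1 (insert l (set us \<union> set vs))" for x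
        using that gt gt' by force
      show "1 # us \<in> ?T" "l # vs \<in> ?T" by fact+
    qed auto
    thus False using less by simp
  qed
  have bl: "b \<ge> l + 1"
  proof (rule ccontr)
    assume "\<not> b \<ge> l + 1"
    hence "vs < bs" using b(2) by (auto simp: not_le)
    thus False using b(3) us_le_vs by simp
  qed
  have bs_ge: "l + 1 + t \<le> x" if "x \<in> set bs" for x
    using b(1) that bl by (force simp: spread_lists_def)
  hence "l + 1 + t \<le> hd bs" using ne' by simp
  also have "hd bs \<le> hd us" using b(3) ne ne' by (intro list_le_hd) auto
  finally have us_hd_ge: "l + 1 + t \<le> hd us" .
  have "map (\<lambda>i. l + 1 + t + i * t) [0..<length bs] \<le> bs"
    by (rule list_ge_bottom) (use spr bs_ge in auto)
  thus "map (\<lambda>i. l + 1 + t + i * t) [0..<d - 1] < us" using b(3) len by simp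
  have "(b # bs) ! 0 + (d - 1) * t \<le> (b # bs) ! (0 + (d - 1))"
    by (rule spread_nth_diff) (use b(1) d len in \<open>auto simp: spread_lists_def\<close>)
  moreover have "(b # bs) ! (d - 1) \<le> n"
    using b(1) nth_mem[of "d - 1" "b # bs"] len by (force simp: spread_lists_def)
  ultimately have ln: "l + 1 + (d - 1) * t \<le> n" using bl by simp
  thus "l < n - (d - 1) * t" by simp
  \<comment> \<open>The top list agrees with its neighbour starting in \<open>l + t\<close> from the second entry on.\<close>
  obtain k where k: "d - 1 = Suc k" using ne len by (cases "d - 1") auto
  define z where "z = map (\<lambda>i. n - (k - 1 - i) * t) [0..<k]"
  have zeq: "?z = (n - k * t) # z"
    unfolding k z_def by (simp add: upt_conv_Cons map_Suc_upt[symmetric] del: upt_Suc) 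
  have kt: "l + 1 + t + k * t \<le> n" using ln unfolding k by simp
  have "k * t = (k - 1) * t + t" if "k > 0" using that by (cases k) simp_all
  hence zk: "n - k * t + t \<le> x" if "x \<in> set z" for x
    using top_list_ge[of x n k t] that kt by (cases "k = 0") (auto simp: z_def)
  have zn: "set z \<subseteq> {1..n}" using zk t by (force simp: z_def)
  have zs: "spread t z"
  proof -
    have "(k - 1) * t \<le> k * t" by (intro mult_le_mono1) simp
    hence "(k - 1) * t \<le> n" using kt by linarith
    thus ?thesis unfolding z_def by (rule spread_top_list)
  qed
  have zlen: "length z = k" by (simp add: z_def)
  have dk: "d = Suc (Suc k)" using k by simp
  have cS: "1 # ?z \<in> ?S" unfolding zeq
    using kt zn zk zs zlen t dk l1n by (auto simp: spread_lists_Cons spread_lists_def) (use zk in fastforce)+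
  have eS: "l # (l + t) # z \<in> ?S"
    using kt zn zk zs zlen t dk l1n by (auto simp: spread_lists_Cons spread_lists_def) (use zk in fastforce)+
  have us_le: "us \<le> ?z" and vs_le: "vs \<le> ?z"
    using spread_list_le_top[of us n "d - 1" t] spread_list_le_top[of vs n "d - 1" t] us vs
    by (simp_all add: spread_lists_Cons)
  have "hd us \<le> hd vs" using us_le_vs ne ne'(1) by (rule list_le_hd)
  hence "(l + t) # z \<le> vs" using us_hd_ge ne' by (cases vs) auto
  obtain c' where c': "set c' \<subseteq> {1, l, l + t} \<union> set ?z" "1 # c' \<in> ?S" "us \<le> c'" "c' \<le> vs"
  proof (rule crossing[OF t us vs l lin])
    show "l < x" if "x \<in> set us" for x using us_hd[OF that] us_hd_ge by simp
    show "{1, l, l + t} \<union> set ?z \<subseteq> {1..n}" using cS eS by (auto simp: spread_lists_def)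
    show "x = 1 \<or> l \<le> x" if "x \<in> {1, l, l + t} \<union> set ?z" for x
      using that kt zk[of x] unfolding zeq by auto
    show "1 # ?z \<in> ?T" using cS us_le l by (simp add: segment_lists_def)
    show "l # (l + t) # z \<in> ?T" using eS \<open>(l + t) # z \<le> vs\<close> l by (simp add: segment_lists_def)
    show "insert l (set ((l + t) # z)) \<subseteq> {1, l, l + t} \<union> set ?z" unfolding zeq by auto
  qed auto
  have "l + t < x" if x: "x \<in> set c'" for x
  proof -
    have "c' \<noteq> []" using x by auto
    hence "hd us \<le> hd c'" using c'(3) ne by (intro list_le_hd)
    also have "hd c' \<le> x" using c'(2) x by (intro spread_hd_le[of t]) (auto simp: spread_lists_def)
    finally show ?thesis using us_hd_ge by simp
  qed
  hence "set c' \<subseteq> set ?z" using c'(1) l by force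
  moreover have "sorted_wrt (<) c'" "sorted_wrt (<) ?z"
    using c'(2) cS spread_strict[OF t] by (auto simp: spread_lists_def simp del: map_upt_eqI)
  moreover have "length c' = length ?z" using c'(2) by (auto simp: spread_lists_def)
  ultimately have "c' = ?z" by (intro sorted_lists_of_equal_card)
  thus "vs = ?z" using c'(4) vs_le by simp
qed

subsection \<open>Sufficiency\<close>

text \<open>
  In the order of the quotients, the generators not divisible by $x_1$ come first, the greatest
  monomial being the very first; those divisible by $x_1$ follow in the opposite order. All indices
  of the latter, except 1, exceed $l + t$, so that 1 may be replaced by each of $2, \dots, l$; within
  the two groups the exchange properties apply.
\<close>

lemma segment_sufficient:
  assumes t: "t \<ge> 1" and d: "d \<ge> 1" and l: "2 \<le> l" "l < n - (d - 1) * t"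
    and us: "1 # us \<in> spread_lists n d t" "map (\<lambda>i. l + 1 + t + i * t) [0..<d - 1] \<le> us"
    and vs: "vs = map (\<lambda>i. n - (d - 1 - 1 - i) * t) [0..<d - 1]"
  shows "linear_resolution n
    (monomial_span n (pp_of_indices ` segment_lists n d t (1 # us) (l # vs)) :: 'k::field mpoly set) d"
proof -
  let ?S = "spread_lists n d t"
  define T where "T = segment_lists n d t (1 # us) (l # vs)"
  have T_Cons: "x # xs \<in> T \<longleftrightarrow> x # xs \<in> ?S \<and> (x = 1 \<and> us \<le> xs \<or> 2 \<le> x \<and> x \<le> l)" for x xs
  proof (cases "x # xs \<in> ?S")
    case True
    hence "xs \<in> spread_lists n (d - 1) t" "x \<ge> 1" by (auto simp: spread_lists_Cons)
    hence "xs \<le> vs" using spread_list_le_top vs by blast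
    thus ?thesis using True \<open>x \<ge> 1\<close> l by (auto simp: T_def segment_lists_def)
  qed (simp add: T_def segment_lists_def)
  have TS: "T \<subseteq> ?S" by (auto simp: T_def segment_lists_def)
  have tail: "l + 1 + t \<le> y" if "1 # xs \<in> T" "y \<in> set xs" for xs y
  proof -
    have "map (\<lambda>i. l + 1 + t + i * t) [0..<d - 1] \<le> xs"
      using that(1) order_trans[OF us(2)] T_Cons[of 1 xs] by simp
    moreover have ne: "xs \<noteq> []" using that(2) by auto
    moreover have "length xs = d - 1" using that(1) TS by (auto simp: spread_lists_def)
    hence d1: "d - 1 > 0" using ne by (cases xs) auto
    ultimately have "hd (map (\<lambda>i. l + 1 + t + i * t) [0..<d - 1]) \<le> hd xs"
      by (intro list_le_hd) auto
    moreover have "hd xs \<le> y"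
      using that TS by (intro spread_hd_le[of t]) (auto simp: spread_lists_def)
    ultimately show ?thesis using d1 by (simp add: hd_map)
  qed
  define prec where "prec xs ys \<longleftrightarrow>
    (if hd xs = 1 then hd ys = 1 \<and> ys < xs else hd ys = 1 \<or> xs < ys)" for xs ys :: "nat list"
  have diff: "pp_of_indices qs - pp_of_indices xs = Poly_Mapping.single x 1 \<longleftrightarrow> set qs - set xs = {x}"
    and keys_diff: "x \<in> keys (pp_of_indices qs - pp_of_indices xs) \<longleftrightarrow> x \<in> set qs - set xs"
    if "qs \<in> ?S" "xs \<in> ?S" for qs xs x
  proof -
    have "distinct qs" "distinct xs" using that spread_distinct[OF t] by (auto simp: spread_lists_def)
    hence look: "lookup (pp_of_indices qs - pp_of_indices xs) y = (if y \<in> set qs - set xs then 1 else 0)" for y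
      by (simp add: lookup_minus lookup_pp_of_indices)
    thus "x \<in> keys (pp_of_indices qs - pp_of_indices xs) \<longleftrightarrow> x \<in> set qs - set xs"
      by (simp add: in_keys_iff)
    show "pp_of_indices qs - pp_of_indices xs = Poly_Mapping.single x 1 \<longleftrightarrow> set qs - set xs = {x}"
      unfolding poly_mapping_eq_iff fun_eq_iff look by (auto simp: lookup_single when_def split: if_splits)
  qed
  show ?thesis
    unfolding T_def[symmetric]
  proof (rule linear_quotients[where prec = prec])
    show "finite T" using TS finite_spread_lists finite_subset by blast
    show "asymp_on T prec" by (auto simp: asymp_on_def prec_def split: if_splits)
    show "transp_on T prec" by (auto simp: transp_on_def prec_def split: if_splits)
    show "totalp_on T prec" by (auto simp: totalp_on_def prec_def split: if_splits)
    show "keys (pp_of_indices s) \<subseteq> {1..n}" "pp_degree (pp_of_indices s) = d" if "s \<in> T" for s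
      using that TS by (auto simp: keys_pp_of_indices pp_degree_pp_of_indices spread_lists_def simp del: atLeastAtMost_iff)
    fix ys xs assume ys: "ys \<in> T" and xs: "xs \<in> T" and p: "prec ys xs"
    obtain y ys' where y: "ys = y # ys'" by (rule spread_lists_cases[OF subsetD[OF TS ys] d])
    obtain x xs' where x: "xs = x # xs'" by (rule spread_lists_cases[OF subsetD[OF TS xs] d])
    have xS: "x # xs' \<in> ?S" and yS: "y # ys' \<in> ?S" using xs ys TS x y by blast+
    have sp: "spread t (x # xs')" "spread t (y # ys')" "length (y # ys') = d" "length (x # xs') = d"
      "set (x # xs') \<subseteq> {1..n}" "set (y # ys') \<subseteq> {1..n}"
      using xS yS by (auto simp: spread_lists_def simp del: atLeastAtMost_iff)
    have "\<exists>qs\<in>T. prec qs xs \<and> (\<exists>w. set qs - set xs = {w} \<and> w \<in> set ys)"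
    proof (cases "x = 1")
      case False
      hence x2: "2 \<le> x" "x \<le> l" using xs x by (auto simp: T_Cons)
      have yx: "y \<noteq> 1" "ys < xs" using p x y False by (auto simp: prec_def split: if_splits)
      hence y2: "2 \<le> y" "y \<le> l" using ys y by (auto simp: T_Cons)
      obtain zs w where zs: "spread t zs" "length zs = d" "zs < xs" "set zs - set xs = {w}" "w \<in> set ys"
        "hd zs = x \<or> hd zs = y"
        using exchange_first[of "y # ys'" "x # xs'" t] sp yx t x y by auto
      have "set zs \<subseteq> set xs \<union> set ys"
        using zs(4,5) by (metis Diff_subset_conv empty_subsetI insert_subset)
      hence "set zs \<subseteq> {1..n}" using sp(5,6) x y by blast
      hence "zs \<in> ?S" using zs by (simp add: spread_lists_def)
      moreover obtain z zs' where z: "zs = z # zs'" using zs(2) d by (cases zs) auto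
      ultimately have "zs \<in> T" using zs(6) x2 y2 by (auto simp: T_Cons)
      moreover have "prec zs xs" using zs(3,6) False x y yx x2 by (auto simp: prec_def)
      ultimately show ?thesis using zs(4,5) by blast
    next
      case x1: True
      have tl: "l + 1 + t \<le> w" if "w \<in> set xs'" for w using tail xs x x1 that by blast
      show ?thesis
      proof (cases "y = 1")
        case False
        hence y2: "2 \<le> y" "y \<le> l" using ys y by (auto simp: T_Cons)
        have "y # xs' \<in> ?S"
          using sp xS y2 tl by (force simp: spread_lists_def)
        hence "y # xs' \<in> T" using y2 by (simp add: T_Cons)
        moreover have "prec (y # xs') xs" using False x x1 by (simp add: prec_def)
        moreover have "y \<notin> set (x # xs')" using tl[of y] y2 x1 by auto
        hence "set (y # xs') - set xs = {y}" using x by auto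
        ultimately show ?thesis using y by (intro bexI[of _ "y # xs'"]) auto
      next
        case True
        have less: "xs' < ys'" using p x y x1 True by (auto simp: prec_def)
        obtain zs w where zs: "spread t zs" "length zs = length xs'" "xs' < zs" "set zs - set xs' = {w}" "w \<in> set ys'"
          using exchange_last[of xs' ys' t] sp less t by auto
        have w: "l + 1 + t \<le> w" using tail[of ys' w] ys y True zs(5) by simp
        have zs_ge: "l + 1 + t \<le> v" if "v \<in> set zs" for v
        proof (cases "v \<in> set xs'")
          case False
          hence "v \<in> set zs - set xs'" using that by blast
          thus ?thesis using zs(4) w by simp
        qed (rule tl)
        have "set zs \<subseteq> {1..n}" using zs(4,5) sp(5,6) by auto
        hence "1 # zs \<in> ?S"
          using zs sp(4) zs_ge l by (force simp: spread_lists_def)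
        moreover have "us \<le> zs" using xs x x1 zs(3) by (auto simp: T_Cons)
        ultimately have "1 # zs \<in> T" by (simp add: T_Cons)
        moreover have "prec (1 # zs) xs" using zs(3) x x1 by (simp add: prec_def)
        moreover have "set (1 # zs) - set xs = (set zs - set xs') - {1}" unfolding x x1 by auto
        hence "set (1 # zs) - set xs = {w}" unfolding zs(4) using w l by simp
        moreover have "w \<in> set ys" using zs(5) y by simp
        ultimately show ?thesis by blast
      qed
    qed
    then obtain qs w where qs: "qs \<in> T" "prec qs xs" "set qs - set xs = {w}" "w \<in> set ys" by blast
    have S: "qs \<in> ?S" "xs \<in> ?S" "ys \<in> ?S" by (rule subsetD[OF TS], fact)+
    have "w \<in> set ys - set xs" using qs(3,4) by blast
    hence "pp_of_indices qs - pp_of_indices xs = Poly_Mapping.single w 1 \<and>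
        w \<in> keys (pp_of_indices ys - pp_of_indices xs)"
      using diff[OF S(1,2)] keys_diff[OF S(3,2)] qs(3) by blast
    thus "\<exists>q\<in>T. prec q xs \<and> (\<exists>x. pp_of_indices q - pp_of_indices xs = Poly_Mapping.single x 1 \<and>
        x \<in> keys (pp_of_indices ys - pp_of_indices xs))"
      using qs(1,2) by blast
  qed
qed

theorem theorem2p8:
  fixes n d t :: nat and u v :: "nat \<Rightarrow>\<^sub>0 nat" and I :: "'k::field mpoly set"
  assumes "n \<ge> 1" and "d \<ge> 1" and "t \<ge> 1" and "n \<ge> 1 + (d - 1) * t"
    and "u \<in> spread_monomials n d t" and "v \<in> spread_monomials n d t"
    and "Min (Poly_Mapping.keys u) = 1" and "Min (Poly_Mapping.keys v) > 1"
    and "I = monomial_ideal n (lexsegment n d t u v)"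
    and "incompletely_lexsegment_ideal n d t I"
  shows "has_linear_resolution n d I \<longleftrightarrow>
    (\<exists>l. 2 \<le> l \<and> l < n - (d - 1) * t \<and>
       slex_less u (pp_of_indices (1 # map (\<lambda>k. l + 1 + k * t) [1..<d])) \<and>
       v = pp_of_indices (l # map (\<lambda>k. n - (d - k) * t) [2..<d + 1]))"
proof -
  note d = assms(2) and t = assms(3)
  let ?S = "spread_lists n d t"
  have hd_Min: "hd xs = Min (set xs)" if xsS: "xs \<in> ?S" for xs
  proof -
    obtain x xs' where xs: "xs = x # xs'" using spread_lists_cases[OF xsS d] .
    have "x \<le> y" if "y \<in> set xs" for y
      using spread_hd_le[OF _ that] xsS xs by (auto simp: spread_lists_def)
    hence "Min (set xs) = x" using xs by (intro Min_eqI) auto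
    thus ?thesis using xs by simp
  qed
  obtain us0 where us0: "us0 \<in> ?S" "u = pp_of_indices us0" using assms(5) spread_monomials_eq[OF t] by blast
  obtain vs0 where vs0: "vs0 \<in> ?S" "v = pp_of_indices vs0" using assms(6) spread_monomials_eq[OF t] by blast
  obtain us where us: "us0 = 1 # us"
    using spread_lists_cases[OF us0(1) d] hd_Min[OF us0(1)] assms(7) us0(2) by (metis keys_pp_of_indices list.sel(1))
  obtain l vs where vs: "vs0 = l # vs" "l \<ge> 2"
    using spread_lists_cases[OF vs0(1) d] hd_Min[OF vs0(1)] assms(8) vs0(2)
    by (metis keys_pp_of_indices list.sel(1) Suc_1 Suc_leI)
  have usS: "1 # us \<in> ?S" and vsS: "l # vs \<in> ?S" using us0 vs0 us vs by simp_all
  have len: "length us = d - 1" "length vs = d - 1" using usS vsS by (auto simp: spread_lists_def)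
  let ?T = "segment_lists n d t (1 # us) (l # vs)"
  have T: "?T \<subseteq> ?S" by (auto simp: segment_lists_def)
  have I: "I = monomial_span n (pp_of_indices ` ?T)"
    unfolding assms(9) us0 vs0 us vs lexsegments_eq_image(1)[OF t usS vsS] by (rule monomial_ideal_spread_lists[OF T])
  \<comment> \<open>The lists of the statement, reindexed from 0.\<close>
  have G: "map (\<lambda>k. m + 1 + k * t) [1..<d] = map (\<lambda>i. m + 1 + t + i * t) [0..<d - 1]" for m
    using d by (intro nth_equalityI) auto
  have Z: "map (\<lambda>k. n - (d - k) * t) [2..<d + 1] = map (\<lambda>i. n - (d - 1 - 1 - i) * t) [0..<d - 1]"
    by (intro nth_equalityI) (simp_all del: upt_Suc)
  have v_eq: "v = pp_of_indices (m # map (\<lambda>k. n - (d - k) * t) [2..<d + 1]) \<longleftrightarrow>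
      m = l \<and> vs = map (\<lambda>i. n - (d - 1 - 1 - i) * t) [0..<d - 1]" if m: "m < n - (d - 1) * t" for m
  proof -
    let ?z = "map (\<lambda>i. n - (d - 1 - 1 - i) * t) [0..<d - 1]"
    have "(d - 1 - 1) * t + t = (d - 1) * t" if "d - 1 > 0"
      using that by (cases "d - 1") simp_all
    hence "m < x" if x: "x \<in> set ?z" for x
    proof -
      have "d - 1 > 0" using x by (cases "d - 1") auto
      thus ?thesis using top_list_ge[OF x] m \<open>d - 1 > 0 \<Longrightarrow> _\<close> by linarith
    qed
    moreover have "(d - 1 - 1) * t \<le> (d - 1) * t" by (intro mult_le_mono1) simp
    hence "spread t ?z" using m by (intro spread_top_list) linarith
    hence "sorted_wrt (<) ?z" by (rule spread_strict[OF t])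
    ultimately have "sorted_wrt (<) (m # ?z)" by simp
    moreover have "sorted_wrt (<) (l # vs)"
      by (rule spread_strict[OF t]) (use vsS in \<open>simp add: spread_lists_def\<close>)
    ultimately show ?thesis
      unfolding Z vs0(2) vs(1) using pp_of_indices_inj[of "l # vs" "m # ?z"] by auto
  qed
  have u_less: "slex_less u (pp_of_indices (1 # map (\<lambda>k. m + 1 + k * t) [1..<d])) \<longleftrightarrow>
      map (\<lambda>i. m + 1 + t + i * t) [0..<d - 1] < us" for m
  proof -
    let ?g = "map (\<lambda>i. m + 1 + t + i * t) [0..<d - 1]"
    have "spread t (1 # ?g)" by (auto simp: spread_iff_nth nth_Cons split: nat.splits)
    hence "sorted_wrt (<) (1 # ?g)" by (rule spread_strict[OF t])
    moreover have "sorted_wrt (<) (1 # us)"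
      by (rule spread_strict[OF t]) (use usS in \<open>simp add: spread_lists_def\<close>)
    ultimately show ?thesis
      unfolding G us0(2) us using len by (subst slex_less_pp_of_indices) simp_all
  qed
  have "slex_le v u"
    unfolding us0(2) vs0(2) us vs(1) using slex_le_spread_lists[OF t usS vsS] vs(2) by simp
  hence "I \<noteq> monomial_ideal n (initial_lexsegment n d t v) \<inter> monomial_ideal n (final_lexsegment n d t u)"
    using assms(5,6,9,10) unfolding incompletely_lexsegment_ideal_def completely_lexsegment_ideal_def by blast
  moreover have "monomial_ideal n (initial_lexsegment n d t v) =
      (monomial_span n (pp_of_indices ` {ws \<in> ?S. ws \<le> l # vs}) :: 'k mpoly set)"
    unfolding vs0(2) vs(1) lexsegments_eq_image(2)[OF t usS vsS] by (rule monomial_ideal_spread_lists) auto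
  moreover have "monomial_ideal n (final_lexsegment n d t u) =
      (monomial_span n (pp_of_indices ` {ws \<in> ?S. 1 # us \<le> ws}) :: 'k mpoly set)"
    unfolding us0(2) us lexsegments_eq_image(3)[OF t usS vsS] by (rule monomial_ideal_spread_lists) auto
  ultimately have ne: "monomial_span n (pp_of_indices ` ?T) \<noteq>
      monomial_span n (pp_of_indices ` {ws \<in> ?S. ws \<le> l # vs}) \<inter>
      (monomial_span n (pp_of_indices ` {ws \<in> ?S. 1 # us \<le> ws}) :: 'k mpoly set)"
    using I by simp
  show ?thesis
  proof
    assume lin: "has_linear_resolution n d I"
    obtain b bs where b: "b # bs \<in> ?S" "l # vs < b # bs" "bs < us"
      by (rule incomplete_witness[OF t usS vsS vs(2) ne])
    note nec = segment_necessary[OF t d usS vsS vs(2) b lin[unfolded I]]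
    show "\<exists>l. 2 \<le> l \<and> l < n - (d - 1) * t \<and>
       slex_less u (pp_of_indices (1 # map (\<lambda>k. l + 1 + k * t) [1..<d])) \<and>
       v = pp_of_indices (l # map (\<lambda>k. n - (d - k) * t) [2..<d + 1])"
      by (intro exI[of _ l] conjI vs(2) nec(1)) (use nec v_eq[OF nec(1)] u_less in blast)+
  next
    assume "\<exists>l. 2 \<le> l \<and> l < n - (d - 1) * t \<and>
       slex_less u (pp_of_indices (1 # map (\<lambda>k. l + 1 + k * t) [1..<d])) \<and>
       v = pp_of_indices (l # map (\<lambda>k. n - (d - k) * t) [2..<d + 1])"
    then obtain m where m: "2 \<le> m" "m < n - (d - 1) * t"
      "slex_less u (pp_of_indices (1 # map (\<lambda>k. m + 1 + k * t) [1..<d]))"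
      "v = pp_of_indices (m # map (\<lambda>k. n - (d - k) * t) [2..<d + 1])" by blast
    have ml: "m = l" and vsz: "vs = map (\<lambda>i. n - (d - 1 - 1 - i) * t) [0..<d - 1]"
      using v_eq[OF m(2)] m(4) by blast+
    have "map (\<lambda>i. l + 1 + t + i * t) [0..<d - 1] \<le> us"
      using u_less[of m] m(3) ml by simp
    from segment_sufficient[OF t d _ _ usS this vsz] m(1,2) ml show "has_linear_resolution n d I"
      unfolding I by (intro has_linear_resolutionI) simp
  qed
qed

end
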